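(* Every hexagonal Tangle is constructible.
   Context: Fix $r>0$ and let $\mathscr T$ be the tiling of the plane by regular hexagons of side length $2r$. Center a circle of radius $r$ at each vertex of $\mathscr T$; circles at adjacent vertices are tangent at the midpoint of the common edge. A link is a third of one of these circles whose endpoints are two consecutive tangency points with circles at adjacent vertices. A hexagonal Tangle is a smooth (continuously turning tangent) simple closed curve that is the union of finitely many links. Each circle of radius $r$ centered at a vertex of $\mathscr T$ is a hexagonal Tangle. The region enclosed is the bounded component of the complement of the curve; a link is convex if, near the link, the enclosed region lies on the same side as the center of its circle, and concave otherwise (always measured with respect to the Tangle containing the link). Operations (each allowed only when the result is a hexagonal Tangle, and each replacement having the same two endpoints as the replaced sequence): a shear insertion replaces a single convex link by seven consecutive links which are, in order, concave, convex, convex, concave, convex, convex, concave; a reflection replaces four consecutive links which are, in order, convex, concave, concave, convex by four consecutive links which are, in order, concave, convex, convex, concave; a shear reduction replaces seven consecutive links which are, in order, convex, concave, concave, convex, concave, concave, convex by a single concave link. A hexagonal Tangle $\tau$ is constructible if there are hexagonal Tangles $\tau_0,\dots,\tau_k=\tau$ such that $\tau_0$ is a circle of radius $r$ centered at a vertex of $\mathscr T$ and each $\tau_i$ is obtained from $\tau_{i-1}$ by one of these operations. *)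

theory Defs
  imports "HOL-Analysis.Analysis"
begin

text \<open>The plane is the type \<^typ>\<open>complex\<close>. A tiling by regular hexagons is given by the centre p of
  one hexagon and the vector d from p to one of its corners; the side length is then \<^term>\<open>norm d\<close>.
  The centres of the hexagons adjacent to this one are p plus the vectors of length
  \<open>sqrt 3 * norm d\<close> orthogonal to its sides. Every tiling by regular hexagons with
  side length \<open>2 * r\<close> arises from some p and d with \<open>norm d = 2 * r\<close>.\<close>

definition hexagon_centers :: "complex \<Rightarrow> complex \<Rightarrow> complex set" where
  "hexagon_centers p d =
     {p + of_real (sqrt 3) * d * (of_int m * cis (pi / 6) + of_int n * cis (pi / 2)) | m n :: int. True}"

definition hexagon_corners :: "complex \<Rightarrow> complex \<Rightarrow> complex set" where
  "hexagon_corners c d = {c + d * cis (of_nat k * pi / 3) | k :: nat. k < 6}"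

definition tiling_vertices :: "complex \<Rightarrow> complex \<Rightarrow> complex set" where
  "tiling_vertices p d = (\<Union>c\<in>hexagon_centers p d. hexagon_corners c d)"


text \<open>In the following, V is the vertex set of a tiling with side length \<open>2 * r\<close>; adjacent vertices
  are those at distance \<open>2 * r\<close>. A link is encoded by a pair \<open>(v, w)\<close> of adjacent vertices: it is the
  third of the circle around v that runs counterclockwise from the tangency point with the circle
  around w to the next tangency point. Distinct pairs give distinct arcs, and each circle has
  exactly three links because each vertex has three neighbours at mutual angles \<open>2 * pi / 3\<close>.\<close>

type_synonym link = "complex \<times> complex"

definition is_link :: "real \<Rightarrow> complex set \<Rightarrow> link \<Rightarrow> bool" where
  "is_link r V L \<longleftrightarrow> fst L \<in> V \<and> snd L \<in> V \<and> dist (fst L) (snd L) = 2 * r"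

definition link_point :: "link \<Rightarrow> real \<Rightarrow> complex" where
  "link_point L t = fst L + (snd L - fst L) / 2 * cis t"

definition link_arc :: "link \<Rightarrow> complex set" where
  "link_arc L = link_point L ` {0..2 * pi / 3}"

definition link_ends :: "link \<Rightarrow> complex set" where
  "link_ends L = {link_point L 0, link_point L (2 * pi / 3)}"


text \<open>Continuously turning tangent: there is a C1 parametrization with nowhere vanishing derivative
  whose derivatives also agree at the point where the curve closes up.\<close>

definition smooth_simple_closed_curve :: "complex set \<Rightarrow> bool" where
  "smooth_simple_closed_curve S \<longleftrightarrow>
     (\<exists>g. simple_path g \<and> pathfinish g = pathstart g \<and> path_image g = S \<and>
          g C1_differentiable_on {0..1} \<and>
          (\<forall>t\<in>{0..1}. vector_derivative g (at t) \<noteq> 0) \<and>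
          vector_derivative g (at 0) = vector_derivative g (at 1))"

definition hexagonal_tangle :: "real \<Rightarrow> complex set \<Rightarrow> complex set \<Rightarrow> bool" where
  "hexagonal_tangle r V S \<longleftrightarrow>
     smooth_simple_closed_curve S \<and>
     (\<exists>F. finite F \<and> (\<forall>L\<in>F. is_link r V L) \<and> S = (\<Union>L\<in>F. link_arc L))"

text \<open>Distinct links meet at most in endpoints, so a Tangle determines the links it is made of.\<close>

definition links_of :: "real \<Rightarrow> complex set \<Rightarrow> complex set \<Rightarrow> link set" where
  "links_of r V S = {L. is_link r V L \<and> link_arc L \<subseteq> S}"

text \<open>The enclosed region of S is \<^term>\<open>inside S\<close>. A link of S is convex if around each of its
  points (other than the two endpoints, where the neighbouring link interferes) the enclosed region
  coincides locally with the open disc bounded by the circle of the link. A link of S that is not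
  convex is concave.\<close>

definition convex_link :: "real \<Rightarrow> complex set \<Rightarrow> link \<Rightarrow> bool" where
  "convex_link r S L \<longleftrightarrow>
     (\<forall>t\<in>{0<..<2 * pi / 3}. \<exists>e>0. \<forall>z\<in>ball (link_point L t) e. z \<in> inside S \<longleftrightarrow> z \<in> ball (fst L) r)"


fun link_chain :: "complex \<Rightarrow> link list \<Rightarrow> complex \<Rightarrow> bool" where
  "link_chain a [] b \<longleftrightarrow> a = b"
| "link_chain a (L # Ls) b \<longleftrightarrow> (\<exists>c. link_ends L = {a, c} \<and> link_chain c Ls b)"

definition consecutive_links ::
  "real \<Rightarrow> complex set \<Rightarrow> complex set \<Rightarrow> complex \<Rightarrow> link list \<Rightarrow> complex \<Rightarrow> bool" where
  "consecutive_links r V S a Ls b \<longleftrightarrow>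
     set Ls \<subseteq> links_of r V S \<and> distinct Ls \<and> link_chain a Ls b"

datatype curvature = Convex | Concave

definition link_curvature :: "real \<Rightarrow> complex set \<Rightarrow> link \<Rightarrow> curvature" where
  "link_curvature r S L = (if convex_link r S L then Convex else Concave)"

text \<open>S' arises from S by replacing consecutive links of S with curvatures \<open>old\<close> by consecutive
  links of S' with curvatures \<open>new\<close> and the same endpoints; all other links are kept. The curvatures
  of the replaced links are measured in S, those of the replacing links in S'.\<close>

definition replacement ::
  "curvature list \<Rightarrow> curvature list \<Rightarrow> real \<Rightarrow> complex set \<Rightarrow> complex set \<Rightarrow> complex set \<Rightarrow> bool" where
  "replacement old new r V S S' \<longleftrightarrow>
     hexagonal_tangle r V S \<and> hexagonal_tangle r V S' \<and>
     (\<exists>a b Ls Ls'.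
        consecutive_links r V S a Ls b \<and> map (link_curvature r S) Ls = old \<and>
        consecutive_links r V S' a Ls' b \<and> map (link_curvature r S') Ls' = new \<and>
        links_of r V S - set Ls = links_of r V S' - set Ls')"

definition shear_insertion :: "real \<Rightarrow> complex set \<Rightarrow> complex set \<Rightarrow> complex set \<Rightarrow> bool" where
  "shear_insertion =
     replacement [Convex] [Concave, Convex, Convex, Concave, Convex, Convex, Concave]"

definition reflection :: "real \<Rightarrow> complex set \<Rightarrow> complex set \<Rightarrow> complex set \<Rightarrow> bool" where
  "reflection =
     replacement [Convex, Concave, Concave, Convex] [Concave, Convex, Convex, Concave]"

definition shear_reduction :: "real \<Rightarrow> complex set \<Rightarrow> complex set \<Rightarrow> complex set \<Rightarrow> bool" where
  "shear_reduction =
     replacement [Convex, Concave, Concave, Convex, Concave, Concave, Convex] [Concave]"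

definition tangle_operation :: "real \<Rightarrow> complex set \<Rightarrow> complex set \<Rightarrow> complex set \<Rightarrow> bool" where
  "tangle_operation r V S S' \<longleftrightarrow>
     shear_insertion r V S S' \<or> reflection r V S S' \<or> shear_reduction r V S S'"

definition constructible :: "real \<Rightarrow> complex set \<Rightarrow> complex set \<Rightarrow> bool" where
  "constructible r V T \<longleftrightarrow>
     (\<exists>(k :: nat) \<tau>. (\<forall>i\<le>k. hexagonal_tangle r V (\<tau> i)) \<and>
        (\<exists>v\<in>V. \<tau> 0 = sphere v r) \<and> \<tau> k = T \<and>
        (\<forall>i<k. tangle_operation r V (\<tau> i) (\<tau> (Suc i))))"

end

theory Submission
  imports Defs
begin

text \<open>A Tangle passes through the midpoints of the edges of the tiling, and crossing an edge from one hexagon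
  to the next turns it into a closed walk on the triangular lattice of hexagon centres that uses each
  directed edge at most once, all steps lying in three directions at mutual angles \<open>2 * pi / 3\<close>. At each
  centre the walk turns left or right; by Hopf's theorem on turning tangents one kind of turn exceeds the
  other by three, and these turns are the convex links.

  Call a centre inner if it lies in the enclosed region. A link separates its vertex from the centre of
  its hexagon, whereas at the other corners both lie on the same side. If a convex link has no inner centre
  among the three around its vertex, the Tangle is a circle. Otherwise distribute the unit weight of each
  convex link equally among the inner centres at its vertex and give each concave link to the inner centre
  of its hexagon with weight -1. The total weight is 3, so some inner centre has positive weight. Inspecting the
  few possibilities, the Tangle near this centre is the result of a shear insertion or of a
  reflection, whose inverse shortens the walk or keeps its length and lowers its area by a constant. Hence
  repeated reduction ends at a circle; shear reductions are not needed.\<close>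

section \<open>Arithmetic of the hexagonal lattice\<close>

text \<open>Curvature is measured in the Tangle that contains the link, so undoing an operation
  seems to require the enclosed region of a curve that has only just been built. Counting turns
  avoids this. On a closed walk with distinct edges one of the two primitive cube roots of unity has
  excess 3 among the turns, the other one excess -3, and the links turning by the former are the
  convex ones. Both sides of an insertion have excess 1, both sides of a reflection excess 0. After
  a local change of the edge list it therefore suffices that the new edges are distinct from each
  other and from the kept ones; all curvatures follow. The weights keep the search local: the weight
  of an inner centre depends only on which of the six adjacent centres and which of three of its six
  corners are enclosed, and positivity leaves few patterns. A reflection keeps the length, so
  termination needs the area, which is bounded below in terms of the length.\<close>

definition turn :: "complex \<Rightarrow> bool" where
  "turn s \<longleftrightarrow> s * s = - 1 - s"

lemma turn_Re_Im:
  assumes "turn s"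
  shows "Re s = - 1 / 2" and "(Im s)\<^sup>2 = 3 / 4"
proof -
  have 1: "Re s * Re s - Im s * Im s = - 1 - Re s" and 2: "2 * (Re s * Im s) = - Im s"
    using assms by (auto simp: turn_def complex_eq_iff mult.commute)
  have "Im s \<noteq> 0"
  proof
    assume "Im s = 0"
    with 1 have "(Re s + 1/2)\<^sup>2 + 3/4 = 0" by (simp add: power2_eq_square algebra_simps)
    moreover have "(Re s + 1/2)\<^sup>2 \<ge> 0" by simp
    ultimately show False by linarith
  qed
  moreover have "(2 * Re s + 1) * Im s = 0" using 2 by (simp add: algebra_simps)
  ultimately show R: "Re s = - 1 / 2" by simp
  with 1 show "(Im s)\<^sup>2 = 3 / 4" by (simp add: power2_eq_square)
qed

lemma turn_Im_nz: "turn s \<Longrightarrow> Im s \<noteq> 0"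
  using turn_Re_Im(2)[of s] by auto

lemma turn_iff: "turn s \<longleftrightarrow> Re s = - 1 / 2 \<and> (Im s)\<^sup>2 = 3 / 4"
  using turn_Re_Im[of s] by (auto simp: turn_def complex_eq_iff power2_eq_square)

lemma turn_norm: "turn s \<Longrightarrow> norm s = 1"
  by (simp add: cmod_def turn_Re_Im power_divide)

lemma turn_nz: "turn s \<Longrightarrow> s \<noteq> 0"
  using turn_norm by force

lemma turn_sq: "turn s \<Longrightarrow> s * s = - 1 - s"
  by (simp add: turn_def)

text \<open>The quadratic relation in the shape that still matches inside right-nested products.
  With \<open>turn_sq\<close> and \<open>algebra_simps\<close> it brings polynomials in
  \<open>s\<close> to the form a + b * s, which settles most of the identities below.\<close>

lemma turn_sq_left: "turn s \<Longrightarrow> s * (s * x) = - x - s * x"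
  unfolding turn_def by algebra

lemma turn_cube: "turn s \<Longrightarrow> s * s * s = 1"
  unfolding turn_def by algebra

lemma turn_square [simp]: "turn s \<Longrightarrow> turn (s * s)"
  unfolding turn_def by algebra

lemma turn_cases: "turn s \<Longrightarrow> turn w \<Longrightarrow> s = w \<or> s = w * w"
proof -
  assume "turn s" "turn w"
  then have "(s - w) * (s - w * w) = 0"
    by (simp add: algebra_simps turn_sq turn_sq_left)
  then show ?thesis by simp
qed

lemma turn_sq_neq: "turn s \<Longrightarrow> s * s \<noteq> s"
proof
  assume s: "turn s" and "s * s = s"
  then have "- 1 - s = s" using turn_sq[OF s] by (simp only:)
  then have "Im (- 1 - s) = Im s" by (rule arg_cong)
  then show False using turn_Im_nz[OF s] by simp
qed

lemma turn_neq_1: "turn s \<Longrightarrow> s \<noteq> 1"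
  using turn_Re_Im(1) by force

lemma turn_cis: "turn (cis (2 * pi / 3))"
  by (simp add: turn_iff cos_120 sin_120 power_divide)

text \<open>The norm form of the Eisenstein integers; it carries all distance computations.\<close>

lemma cmod_turn_comb:
  assumes "turn s"
  shows "(cmod (of_real a + of_real b * s))\<^sup>2 = a\<^sup>2 - a * b + b\<^sup>2"
proof -
  have "(cmod (of_real a + of_real b * s))\<^sup>2 = (a + b * Re s)\<^sup>2 + b\<^sup>2 * (Im s)\<^sup>2"
    by (simp add: cmod_power2 power_mult_distrib)
  also have "\<dots> = a\<^sup>2 - a * b + b\<^sup>2"
    unfolding turn_Re_Im[OF assms] by (simp add: power2_eq_square field_simps)
  finally show ?thesis .
qed

lemma turn_comb_eq_0:
  assumes "turn s" "of_real a + of_real b * s = 0"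
  shows "a = 0 \<and> b = 0"
proof -
  have "b * Im s = 0" "a + b * Re s = 0"
    using assms(2) by (auto simp: complex_eq_iff)
  with turn_Im_nz[OF assms(1)] show ?thesis by auto
qed

lemma turn_comb_exists:
  assumes "turn s"
  obtains a b :: real where "z = of_real a + of_real b * s"
proof
  show "z = of_real (Re z - Im z / Im s * Re s) + of_real (Im z / Im s) * s"
    using turn_Im_nz[OF assms] by (simp add: complex_eq_iff)
qed

text \<open>The Eisenstein integers. By \<open>eis_alt\<close> the choice of the cube root is
  immaterial.\<close>

definition eis :: "complex set" where
  "eis = {of_int m + of_int n * cis (2 * pi / 3) | m n. True}"

lemma eis_alt:
  assumes "turn s"
  shows "eis = {of_int m + of_int n * s | m n. True}"
proof -
  let ?w = "cis (2 * pi / 3)"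
  have *: "{of_int m + of_int n * s | m n. True} \<subseteq> {of_int m + of_int n * (s * s) | m n. True}"
    if "turn s" for s
  proof clarify
    fix m n :: int
    have "of_int m + of_int n * s = of_int (m - n) + of_int (- n) * (s * s)"
      using that by (simp add: turn_sq algebra_simps)
    then show "\<exists>k l. of_int m + of_int n * s = of_int k + of_int l * (s * s) \<and> True"
      by blast
  qed
  have 1: "?w * ?w * (?w * ?w) = ?w"
    using turn_cube[OF turn_cis] by (simp only: mult.assoc[symmetric] mult_1_left)
  have "{of_int m + of_int n * ?w | m n. True} = {of_int m + of_int n * (?w * ?w) | m n. True}"
    using *[OF turn_cis] *[OF turn_square[OF turn_cis]] unfolding 1 by (rule equalityI)
  moreover have "s = ?w \<or> s = ?w * ?w" using turn_cases assms turn_cis by blast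
  ultimately show ?thesis unfolding eis_def by (elim disjE) simp_all
qed

lemma eisI: "turn s \<Longrightarrow> of_int m + of_int n * s \<in> eis"
  using eis_alt by blast

lemma eis_add: "x \<in> eis \<Longrightarrow> y \<in> eis \<Longrightarrow> x + y \<in> eis"
proof -
  assume "x \<in> eis" "y \<in> eis"
  then obtain a b c d where "x = of_int a + of_int b * cis (2 * pi / 3)"
    "y = of_int c + of_int d * cis (2 * pi / 3)" unfolding eis_def by blast
  then have "x + y = of_int (a + c) + of_int (b + d) * cis (2 * pi / 3)"
    by (simp add: algebra_simps)
  then show ?thesis unfolding eis_def by blast
qed

lemma eis_uminus: "x \<in> eis \<Longrightarrow> - x \<in> eis"
proof -
  assume "x \<in> eis"
  then obtain a b where "x = of_int a + of_int b * cis (2 * pi / 3)" unfolding eis_def by blast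
  then have "- x = of_int (- a) + of_int (- b) * cis (2 * pi / 3)"
    by (simp add: algebra_simps)
  then show ?thesis unfolding eis_def by blast
qed

lemma eis_mult_turn: "x \<in> eis \<Longrightarrow> turn s \<Longrightarrow> x * s \<in> eis"
proof -
  assume "x \<in> eis" and s: "turn s"
  then obtain a b where "x = of_int a + of_int b * s" using eis_alt by blast
  then have "x * s = of_int (- b) + of_int (a - b) * s"
    using s by (simp add: algebra_simps turn_sq_left)
  then show ?thesis using eisI[OF s] by metis
qed

lemma eis_1 [simp]: "1 \<in> eis"
  using eisI[OF turn_cis, of 1 0] by simp

lemma eis_diff: "x \<in> eis \<Longrightarrow> y \<in> eis \<Longrightarrow> x - y \<in> eis"
  using eis_add[of x "- y"] eis_uminus[of y] by simp

text \<open>The vector \<delta> joins two adjacent hexagon centres: its length is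
  \<open>sqrt 3\<close> times the side length \<open>2 * r\<close>.\<close>

locale hexgrid =
  fixes p \<delta> :: complex and r :: real
  assumes r_pos: "r > 0" and norm_\<delta>: "norm \<delta> = 2 * sqrt 3 * r"
begin

definition centers :: "complex set" where
  "centers = {p + \<delta> * z | z. z \<in> eis}"

text \<open>The vectors \<delta>, \<delta> w, \<delta> w w for a primitive cube root w. The three
  opposite vectors are left out on purpose: each edge of the tiling then has one encoding and each
  curve one direction of traversal. That direction may be clockwise or counterclockwise, so both
  orientations must be carried along.\<close>

definition dirs :: "complex set" where
  "dirs = {u. u * u * u = \<delta> * \<delta> * \<delta>}"

lemma \<delta>_nz: "\<delta> \<noteq> 0"
  using norm_\<delta> r_pos by auto

lemma dirs_\<delta>: "\<delta> \<in> dirs"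
  by (simp add: dirs_def)

lemma dirs_eq:
  assumes "turn s" "u \<in> dirs"
  shows "dirs = {u, u * s, u * s * s}"
proof -
  have 1: "x * x * x = u * u * u \<longleftrightarrow> x = u \<or> x = u * s \<or> x = u * s * s" for x
  proof -
    have "(x - u) * (x - u * s) * (x - u * s * s) = x * x * x - u * u * u"
      using assms(1) unfolding turn_def by algebra
    then show ?thesis by (metis eq_iff_diff_eq_0 mult_eq_0_iff)
  qed
  with assms(2) show ?thesis unfolding dirs_def by auto
qed

lemma dirs_turn: "u \<in> dirs \<Longrightarrow> turn s \<Longrightarrow> u * s \<in> dirs"
  using dirs_eq by blast

lemma dirs_quot:
  assumes "u \<in> dirs" "u' \<in> dirs" "turn s"
  shows "u' = u \<or> u' = u * s \<or> u' = u * s * s"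
  using dirs_eq[OF assms(3,1)] assms(2) by blast

lemma dirs_eis: "u \<in> dirs \<Longrightarrow> \<exists>z\<in>eis. u = \<delta> * z"
proof -
  let ?w = "cis (2 * pi / 3)"
  assume "u \<in> dirs"
  then have "u = \<delta> * 1 \<or> u = \<delta> * (1 * ?w) \<or> u = \<delta> * (1 * ?w * ?w)"
    using dirs_eq[OF turn_cis dirs_\<delta>] by (auto simp: mult.assoc)
  then show ?thesis using eis_1 eis_mult_turn[OF _ turn_cis] by blast
qed

lemma dirs_norm: "u \<in> dirs \<Longrightarrow> norm u = 2 * sqrt 3 * r"
  using dirs_eq[OF turn_cis dirs_\<delta>] norm_\<delta> by (auto simp: norm_mult)

lemma dirs_nz: "u \<in> dirs \<Longrightarrow> u \<noteq> 0"
  using dirs_norm r_pos by force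

lemma finite_dirs: "finite dirs"
  using dirs_eq[OF turn_cis dirs_\<delta>] by simp

lemma centers_add: "H \<in> centers \<Longrightarrow> u \<in> dirs \<Longrightarrow> H + u \<in> centers"
proof -
  assume "H \<in> centers" "u \<in> dirs"
  then obtain y z where "y \<in> eis" "z \<in> eis" "H = p + \<delta> * y" "u = \<delta> * z"
    unfolding centers_def using dirs_eis by blast
  then show ?thesis unfolding centers_def using eis_add[of y z]
    by (auto simp: algebra_simps intro!: exI[of _ "y + z"])
qed

lemma centers_diff: "H \<in> centers \<Longrightarrow> u \<in> dirs \<Longrightarrow> H - u \<in> centers"
proof -
  assume "H \<in> centers" "u \<in> dirs"
  then obtain y z where "y \<in> eis" "z \<in> eis" "H = p + \<delta> * y" "u = \<delta> * z"
    unfolding centers_def using dirs_eis by blast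
  then show ?thesis unfolding centers_def using eis_diff[of y z]
    by (auto simp: algebra_simps intro!: exI[of _ "y - z"])
qed

lemma dirs_eis_unit: "u \<in> dirs \<Longrightarrow> z \<in> eis \<Longrightarrow> \<exists>z'\<in>eis. \<delta> * z = u * z'"
proof -
  assume u: "u \<in> dirs" and z: "z \<in> eis"
  have "\<delta> = u \<or> \<delta> = u * cis (2 * pi / 3) \<or> \<delta> = u * cis (2 * pi / 3) * cis (2 * pi / 3)"
    using dirs_quot[OF u dirs_\<delta> turn_cis] .
  then have "\<delta> * z = u * z \<or> \<delta> * z = u * (z * cis (2 * pi / 3)) \<or>
      \<delta> * z = u * (z * cis (2 * pi / 3) * cis (2 * pi / 3))"
    by (elim disjE) (simp_all only: mult_ac simp_thms)
  then show ?thesis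
    using z eis_mult_turn[OF _ turn_cis] by blast
qed

lemma centers_rep:
  assumes "H \<in> centers" "H' \<in> centers" "u \<in> dirs" "turn s"
  obtains m n :: int where "H' - H = u * (of_int m + of_int n * s)"
proof -
  obtain y z where yz: "y \<in> eis" "z \<in> eis" "H = p + \<delta> * y" "H' = p + \<delta> * z"
    using assms unfolding centers_def by blast
  obtain x where "x \<in> eis" "\<delta> * (z - y) = u * x"
    using dirs_eis_unit[OF assms(3) eis_diff[OF yz(2,1)]] by blast
  moreover obtain m n where "x = of_int m + of_int n * s"
    using \<open>x \<in> eis\<close> unfolding eis_alt[OF assms(4)] by auto
  ultimately show ?thesis using that[of m n] yz by (simp add: algebra_simps)
qed

section \<open>Corners, vertices and arcs\<close>

text \<open>An edge of the tiling is encoded by the pair (P, u) of adjacent hexagon centres P and \<open>P + u\<close> that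
  it separates; its midpoint is \<open>P + u / 2\<close>. A link leads from an edge \<open>(H - u, u)\<close> to an edge
  \<open>(H, u * s)\<close> with s a primitive cube root of unity and is encoded by the corner (H, u, s); its circle
  has centre \<open>vertex H u s\<close>. In the coordinates of pt, whose axes point from that centre to the two
  edge midpoints, this circle is \<open>quad x y = 1 / 4\<close>, the link is its part in the first quadrant, and H
  is the point (1, 1).\<close>

definition vertex :: "complex \<Rightarrow> complex \<Rightarrow> complex \<Rightarrow> complex" where
  "vertex H u s = H + u * (s - 1) / 3"

definition vertices :: "complex set" where
  "vertices = {vertex H u s | H u s. H \<in> centers \<and> u \<in> dirs \<and> turn s}"

definition pt :: "complex \<Rightarrow> complex \<Rightarrow> complex \<Rightarrow> real \<Rightarrow> real \<Rightarrow> complex" where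
  "pt H u s x y = vertex H u s + u / 3 * (of_real x * (- 1 - 2 * s) + of_real y * (2 + s))"

definition quad :: "real \<Rightarrow> real \<Rightarrow> real" where
  "quad x y = x\<^sup>2 - x * y + y\<^sup>2"

lemma pt_alt: "pt H u s x y = vertex H u s + u / 3 * (of_real (2 * y - x) + of_real (y - 2 * x) * s)"
  by (simp add: pt_def algebra_simps)

lemma pt_exists:
  assumes "u \<in> dirs" "turn s"
  obtains x y where "z = pt H u s x y"
proof -
  obtain a b where ab: "(z - vertex H u s) * 3 / u = of_real a + of_real b * s"
    using turn_comb_exists[OF assms(2)] by blast
  have "z = pt H u s ((a - 2 * b) / 3) ((2 * a - b) / 3)"
  proof -
    have 1: "2 * ((2 * a - b) / 3) - (a - 2 * b) / 3 = a" "(2 * a - b) / 3 - 2 * ((a - 2 * b) / 3) = b"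
      by (simp_all add: field_simps)
    show ?thesis unfolding pt_alt 1 using ab dirs_nz[OF assms(1)] by (simp add: field_simps)
  qed
  then show ?thesis using that by blast
qed

text \<open>The two axes have unit \<open>2 * r\<close> and enclose an angle of 120 degrees, whence
  the mixed term of \<open>quad\<close>.\<close>

lemma pt_dist:
  assumes "u \<in> dirs" "turn s"
  shows "(dist (pt H u s x y) (pt H u s x' y'))\<^sup>2 = 4 * r\<^sup>2 * quad (x - x') (y - y')"
proof -
  have "pt H u s x y - pt H u s x' y' =
     u / 3 * (of_real (2 * (y - y') - (x - x')) + of_real ((y - y') - 2 * (x - x')) * s)"
    by (simp add: pt_alt algebra_simps)
  then have "dist (pt H u s x y) (pt H u s x' y') = norm u / 3 *
     cmod (of_real (2 * (y - y') - (x - x')) + of_real ((y - y') - 2 * (x - x')) * s)"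
    by (simp only: dist_norm norm_mult norm_divide) simp
  then have "(dist (pt H u s x y) (pt H u s x' y'))\<^sup>2 = (norm u / 3)\<^sup>2 *
     (cmod (of_real (2 * (y - y') - (x - x')) + of_real ((y - y') - 2 * (x - x')) * s))\<^sup>2"
    by (simp only: power_mult_distrib)
  also have "\<dots> = (2 * sqrt 3 * r / 3)\<^sup>2 * (3 * quad (x - x') (y - y'))"
    unfolding cmod_turn_comb[OF assms(2)] dirs_norm[OF assms(1)] quad_def
    by (simp add: power2_eq_square algebra_simps)
  also have "\<dots> = 4 * r\<^sup>2 * quad (x - x') (y - y')"
    by (simp add: power_mult_distrib power_divide)
  finally show ?thesis .
qed

lemma pt_0 [simp]: "pt H u s 0 0 = vertex H u s"
  by (simp add: pt_def)

lemma pt_center: "turn s \<Longrightarrow> pt H u s 1 1 = H"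
  by (simp add: pt_def vertex_def field_simps)

lemma pt_start: "pt H u s (1/2) 0 = H - u / 2"
  by (simp add: pt_def vertex_def field_simps)

lemma pt_end: "pt H u s 0 (1/2) = H + u * s / 2"
  by (simp add: pt_def vertex_def field_simps)

text \<open>Completing the square in three ways. Up to factors, \<open>2 * x - y\<close>,
  \<open>2 * y - x\<close> and \<open>x + y\<close> are the components of a point along the three
  edges that meet at the vertex.\<close>

lemma quad_alt: "quad x y = ((2 * x - y)\<^sup>2 + 3 * y\<^sup>2) / 4" "quad x y = ((2 * y - x)\<^sup>2 + 3 * x\<^sup>2) / 4"
  "quad x y = ((x + y)\<^sup>2 + 3 * (x - y)\<^sup>2) / 4"
  by (simp_all add: quad_def power2_eq_square algebra_simps)

lemma pt_inj:
  assumes "u \<in> dirs" "turn s" "pt H u s x y = pt H u s x' y'"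
  shows "x = x' \<and> y = y'"
proof -
  have "quad (x - x') (y - y') = 0"
    using pt_dist[OF assms(1,2), of H x y x' y'] assms(3) r_pos by simp
  then have "(2 * (x - x') - (y - y'))\<^sup>2 + 3 * (y - y')\<^sup>2 = 0"
    by (simp add: quad_alt(1))
  moreover have "(2 * (x - x') - (y - y'))\<^sup>2 \<ge> 0" "(y - y')\<^sup>2 \<ge> 0" by simp_all
  ultimately have "(y - y')\<^sup>2 = 0" "(2 * (x - x') - (y - y'))\<^sup>2 = 0" by linarith+
  then have "y - y' = 0" "2 * (x - x') - (y - y') = 0" by simp_all
  then show ?thesis by simp
qed

lemma on_circle_iff:
  assumes "u \<in> dirs" "turn s"
  shows "dist (pt H u s x y) (vertex H u s) = r \<longleftrightarrow> quad x y = 1 / 4"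
    and "dist (pt H u s x y) (vertex H u s) < r \<longleftrightarrow> quad x y < 1 / 4"
proof -
  have *: "(dist (pt H u s x y) (vertex H u s))\<^sup>2 = r\<^sup>2 * (4 * quad x y)"
    using pt_dist[OF assms, of H x y 0 0] by simp
  have "dist (pt H u s x y) (vertex H u s) = r \<longleftrightarrow> r\<^sup>2 * (4 * quad x y) = r\<^sup>2"
    unfolding *[symmetric] using r_pos by (simp add: power2_eq_iff_nonneg)
  also have "\<dots> \<longleftrightarrow> 4 * quad x y = 1"
    using r_pos by (metis mult.right_neutral mult_cancel_left power_eq_0_iff less_irrefl)
  finally show "dist (pt H u s x y) (vertex H u s) = r \<longleftrightarrow> quad x y = 1 / 4" by linarith
  have "dist (pt H u s x y) (vertex H u s) < r \<longleftrightarrow> r\<^sup>2 * (4 * quad x y) < r\<^sup>2 * 1"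
    unfolding *[symmetric] 
    using r_pos abs_le_square_iff[of r "dist (pt H u s x y) (vertex H u s)"] by (simp add: not_le[symmetric])
  also have "\<dots> \<longleftrightarrow> 4 * quad x y < 1"
    using r_pos by (subst mult_less_cancel_left_pos) simp_all
  finally show "dist (pt H u s x y) (vertex H u s) < r \<longleftrightarrow> quad x y < 1 / 4" by linarith
qed

end

text \<open>The law of sines in the triangle with angles \<theta>, 120 degrees minus \<theta>, and
  60 degrees whose longest given side 1/2 faces the 60 degrees: (1/2) / sin 60 = 1 /
  \<open>sqrt 3\<close>.\<close>

lemma cis_sum_turn:
  "cis \<theta> / 2 = of_real (sin (2 * pi / 3 - \<theta>) / sqrt 3) + of_real (sin \<theta> / sqrt 3) * cis (2 * pi / 3)"
proof -
  have 1: "sin (2 * pi / 3 - \<theta>) = sqrt 3 / 2 * cos \<theta> + sin \<theta> / 2"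
    by (simp add: sin_diff sin_120 cos_120)
  have "sqrt 3 * sqrt 3 = 3" by simp
  then have "cos \<theta> / 2 = (sqrt 3 / 2 * cos \<theta> + sin \<theta> / 2) / sqrt 3 + sin \<theta> / sqrt 3 * (- 1 / 2)"
    by (simp add: field_simps)
  then show ?thesis
    by (intro complex_eqI) (simp_all only: 1 Re_divide_numeral Im_divide_numeral plus_complex.sel
        times_complex.sel Re_complex_of_real Im_complex_of_real cis.sel sin_120 cos_120, simp_all)
qed

lemma square_gt_1: "t < - 1 \<or> 1 < t \<Longrightarrow> 1 < (t::real)\<^sup>2"
  using one_less_power[of "\<bar>t\<bar>" 2] by auto

text \<open>By \<open>cis_sum_turn\<close> the oblique coordinates are positive multiples of the
  sines of 2\<pi>/3 - Arg and of Arg; their signs confine the argument to the sector.\<close>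

lemma cis_in_sector:
  assumes "cmod (of_real x + of_real y * cis (2 * pi / 3)) = 1 / 2" "x \<ge> 0" "y \<ge> 0"
  shows "\<exists>\<theta>\<in>{0..2 * pi / 3}. of_real x + of_real y * cis (2 * pi / 3) = cis \<theta> / 2"
proof -
  define z where "z = of_real x + of_real y * cis (2 * pi / 3)"
  have z: "z = cis (Arg z) / 2"
    using rcis_cmod_Arg[of z] assms(1) by (simp add: z_def rcis_def)
  have "Im z = sin (Arg z) / 2" by (subst z) simp
  moreover have "Im z \<ge> 0" using assms by (simp add: z_def sin_120)
  ultimately have s0: "sin (Arg z) \<ge> 0" by simp
  have A: "- pi < Arg z" "Arg z \<le> pi" using mpi_less_Arg Arg_le_pi by auto
  have A0: "Arg z \<ge> 0"
  proof (rule ccontr)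
    assume "\<not> ?thesis"
    then have "sin (- Arg z) > 0" using A by (intro sin_gt_zero) auto
    then show False using s0 by simp
  qed
  have "x = sin (2 * pi / 3 - Arg z) / sqrt 3"
  proof -
    have "of_real x + of_real y * cis (2 * pi / 3) =
      of_real (sin (2 * pi / 3 - Arg z) / sqrt 3) + of_real (sin (Arg z) / sqrt 3) * cis (2 * pi / 3)"
      using z unfolding cis_sum_turn z_def[symmetric] by simp
    then have "of_real (x - sin (2 * pi / 3 - Arg z) / sqrt 3) +
        of_real (y - sin (Arg z) / sqrt 3) * cis (2 * pi / 3) = 0"
      by (simp add: algebra_simps)
    from turn_comb_eq_0[OF turn_cis this] show ?thesis by simp
  qed
  then have s1: "sin (2 * pi / 3 - Arg z) \<ge> 0"
    using assms(2) by (simp add: zero_le_divide_iff)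
  have "Arg z \<le> 2 * pi / 3"
  proof (rule ccontr)
    assume "\<not> ?thesis"
    then have "sin (Arg z - 2 * pi / 3) > 0" using A by (intro sin_gt_zero) auto
    moreover have "sin (2 * pi / 3 - Arg z) = - sin (Arg z - 2 * pi / 3)"
      by (metis minus_diff_eq sin_minus)
    ultimately show False using s1 by simp
  qed
  with A0 z show ?thesis unfolding z_def[symmetric] by auto
qed

text \<open>The signed angle of a turn. It is meaningful for the two cube roots only; everything
  except the counterclockwise root gets the clockwise value.\<close>

definition ang :: "complex \<Rightarrow> real" where
  "ang s = (if s = cis (2 * pi / 3) then 2 * pi / 3 else - (2 * pi / 3))"

lemma turn_ang: "turn s \<Longrightarrow> s = cis (ang s)"
proof -
  assume "turn s"
  then have "s = cis (2 * pi / 3) \<or> s = cis (2 * pi / 3) * cis (2 * pi / 3)"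
    using turn_cases turn_cis by blast
  moreover have "cis (2 * pi / 3) * cis (2 * pi / 3) = cis (- (2 * pi / 3))"
    by (rule complex_eqI) (simp_all only: cis_mult cis.sel cos_add sin_add cos_minus sin_minus sin_120 cos_120,
        simp_all)
  ultimately show ?thesis by (auto simp: ang_def)
qed

lemma ang_turn_sq: "turn s \<Longrightarrow> ang (s * s) = - ang s"
proof -
  assume s: "turn s"
  let ?w = "cis (2 * pi / 3)"
  have 1: "?w * ?w * (?w * ?w) = ?w"
    using turn_cube[OF turn_cis] by (simp only: mult.assoc[symmetric] mult_1_left)
  show ?thesis
    using turn_cases[OF s turn_cis] turn_sq_neq[OF turn_cis] 1 by (auto simp: ang_def)
qed

text \<open>The clockwise root is the conjugate of the counterclockwise one, and conjugation fixes
  the real coefficients, so a single parametrisation serves both kinds of link.\<close>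

lemma ang_arc_comb:
  assumes "turn s"
  shows "cis (ang s * \<tau>) / 2 = of_real (sin (2 * pi / 3 * (1 - \<tau>)) / sqrt 3)
    + of_real (sin (2 * pi / 3 * \<tau>) / sqrt 3) * s"
proof (cases "s = cis (2 * pi / 3)")
  case True
  then show ?thesis
    using cis_sum_turn[of "2 * pi / 3 * \<tau>"] by (simp add: ang_def right_diff_distrib)
next
  case False
  then have a: "ang s = - (2 * pi / 3)" by (simp add: ang_def)
  then have s: "s = cnj (cis (2 * pi / 3))" using turn_ang[OF assms] by (simp add: cis_cnj)
  have "cis (ang s * \<tau>) / 2 = cnj (cis (2 * pi / 3 * \<tau>) / 2)"
    by (simp add: a cis_cnj)
  then show ?thesis
    unfolding cis_sum_turn s by (simp add: right_diff_distrib)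
qed

context hexgrid
begin

abbreviation is_corner :: "complex \<Rightarrow> complex \<Rightarrow> complex \<Rightarrow> bool" where
  "is_corner H u s \<equiv> H \<in> centers \<and> u \<in> dirs \<and> turn s"

text \<open>Half of this vector leads from the centre of the circle to the start of the link, all of
  it to the adjacent vertex behind that start.\<close>

definition radial :: "complex \<Rightarrow> complex \<Rightarrow> complex" where
  "radial u s = - (u * (1 + 2 * s) / 3)"

lemma radial_turn: "turn s \<Longrightarrow> radial u s * s = u * (2 + s) / 3"
proof -
  assume "turn s"
  then have "- (u * (1 + 2 * s)) * s = u * (2 + s)"
    by (simp add: algebra_simps turn_sq turn_sq_left)
  then have "- (u * (1 + 2 * s)) * s / 3 = u * (2 + s) / 3" by (rule arg_cong)
  then show ?thesis by (simp add: radial_def)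
qed

lemma radial_nz: "u \<in> dirs \<Longrightarrow> turn s \<Longrightarrow> radial u s \<noteq> 0"
proof
  assume "u \<in> dirs" "turn s" "radial u s = 0"
  then have "of_real 1 + of_real 2 * s = 0" using dirs_nz by (auto simp: radial_def)
  from turn_comb_eq_0[OF \<open>turn s\<close> this] show False by simp
qed

lemma pt_radial:
  assumes "turn s"
  shows "pt H u s x y = vertex H u s + radial u s * (of_real x + of_real y * s)"
proof -
  have "radial u s * (of_real x + of_real y * s) = radial u s * of_real x + of_real y * (radial u s * s)"
    by (simp add: algebra_simps)
  also have "\<dots> = u / 3 * (of_real x * (- 1 - 2 * s) + of_real y * (2 + s))"
    unfolding radial_turn[OF assms] by (simp add: radial_def field_simps)
  finally show ?thesis by (simp add: pt_def)
qed

text \<open>The open quadrilateral with corners at the vertex (0, 0), the two edge midpoints (1/2,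
  0) and (0, 1/2), and the hexagon centre (1, 1). It contains the open link and meets no other link,
  so it localises every statement about one link.\<close>

definition kite :: "complex \<Rightarrow> complex \<Rightarrow> complex \<Rightarrow> complex set" where
  "kite H u s = {pt H u s x y | x y. 0 < x \<and> 0 < y \<and> 2 * x - y < 1 \<and> 2 * y - x < 1}"

definition arc :: "complex \<Rightarrow> complex \<Rightarrow> complex \<Rightarrow> complex set" where
  "arc H u s = {pt H u s x y | x y. 0 \<le> x \<and> 0 \<le> y \<and> quad x y = 1 / 4}"

definition open_arc :: "complex \<Rightarrow> complex \<Rightarrow> complex \<Rightarrow> complex set" where
  "open_arc H u s = {pt H u s x y | x y. 0 < x \<and> 0 < y \<and> quad x y = 1 / 4}"

lemma arc_on_circle: "z \<in> arc H u s \<Longrightarrow> u \<in> dirs \<Longrightarrow> turn s \<Longrightarrow> dist z (vertex H u s) = r"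
  by (auto simp: arc_def on_circle_iff)

lemma open_arc_arc: "open_arc H u s \<subseteq> arc H u s"
  by (force simp: arc_def open_arc_def)

text \<open>The lines \<open>2 * x - y = 1\<close> and \<open>2 * y - x = 1\<close> are the tangents
  to the circle at the two ends of the link.\<close>

lemma quad_less: "0 < y \<Longrightarrow> quad x y = 1 / 4 \<Longrightarrow> 2 * x - y < 1"
  "0 < x \<Longrightarrow> quad x y = 1 / 4 \<Longrightarrow> 2 * y - x < 1"
proof -
  assume "0 < y" "quad x y = 1 / 4"
  then have "(2 * x - y)\<^sup>2 + 3 * y\<^sup>2 = 1" "y\<^sup>2 > 0" unfolding quad_alt(1) by simp_all
  then have "(2 * x - y)\<^sup>2 < 1" by linarith
  then show "2 * x - y < 1" by (simp add: abs_square_less_1)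
next
  assume "0 < x" "quad x y = 1 / 4"
  then have "(2 * y - x)\<^sup>2 + 3 * x\<^sup>2 = 1" "x\<^sup>2 > 0" unfolding quad_alt(2) by simp_all
  then have "(2 * y - x)\<^sup>2 < 1" by linarith
  then show "2 * y - x < 1" by (simp add: abs_square_less_1)
qed

lemma open_arc_kite: "open_arc H u s \<subseteq> kite H u s"
  unfolding open_arc_def kite_def using quad_less by blast

lemma arc_cases:
  assumes "z \<in> arc H u s"
  shows "z \<in> open_arc H u s \<or> z = H - u / 2 \<or> z = H + u * s / 2"
proof -
  obtain x y where z: "z = pt H u s x y" "0 \<le> x" "0 \<le> y" "quad x y = 1 / 4"
    using assms unfolding arc_def by blast
  have sq: "t = 1 / 2" if "t\<^sup>2 = 1 / 4" "0 \<le> t" for t :: real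
    using that power2_eq_iff_nonneg[of t "1/2"] by (simp add: power2_eq_square)
  consider "x = 0" | "y = 0" | "0 < x" "0 < y" using z by linarith
  then show ?thesis
  proof cases
    case 1
    then have "y = 1 / 2" using z sq by (simp add: quad_def)
    then have "z = H + u * s / 2" unfolding z 1 by (simp only: pt_end)
    then show ?thesis by simp
  next
    case 2
    then have "x = 1 / 2" using z sq by (simp add: quad_def)
    then have "z = H - u / 2" unfolding z 2 by (simp only: pt_start)
    then show ?thesis by simp
  next
    case 3
    then show ?thesis using z unfolding open_arc_def by blast
  qed
qed

lemma arc_ends: "H - u / 2 \<in> arc H u s" "H + u * s / 2 \<in> arc H u s"
proof -
  have "quad (1/2) 0 = 1 / 4" "quad 0 (1/2) = 1 / 4"
    by (simp_all add: quad_def power2_eq_square)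
  then show "H - u / 2 \<in> arc H u s" "H + u * s / 2 \<in> arc H u s"
    unfolding pt_start[symmetric, of H u s] pt_end[symmetric, of H u s] arc_def
    by (force, force)
qed

text \<open>Centres and vertices together form a lattice in which \<open>a mod 3\<close> separates
  three classes: 0 the vertices of the same kind, 2 those of the other kind, and 1 the hexagon
  centres. The two kinds are the colour classes of the tiling as a bipartite graph.\<close>

lemma vertex_offset:
  assumes "is_corner H u s" "is_corner H' u' s'"
  obtains a b :: int where "vertex H' u' s' = vertex H u s + u / 3 * (of_int a + of_int b * s)"
    "3 dvd a + b" "a mod 3 = (if s' = s then 0 else 2)"
proof -
  note result = that
  obtain m n where mn: "H' - H = u * (of_int m + of_int n * s)"
    using centers_rep[of H H' u s] assms by blast
  have H': "H' = H + u * (of_int m + of_int n * s)" using mn by (simp add: algebra_simps)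
  have s: "turn s" using assms by blast
  have u': "u' = u \<or> u' = u * s \<or> u' = u * s * s" using dirs_quot assms by blast
  have s': "s' = s \<or> s' = s * s" using turn_cases assms by blast
  have ss: "- 1 - s \<noteq> s" "- 1 \<noteq> s * 2" "- 1 \<noteq> 2 * s"
    using turn_sq_neq[OF s] by (auto simp: turn_sq[OF s] algebra_simps)
  have key: "vertex H' u' s' = vertex H u s + u / 3 * (of_int (3 * m + k) + of_int (3 * n + l) * s)"
    if "u' * (s' - 1) = u * (s - 1) + u * (of_int k + of_int l * s)" for k l :: int
    unfolding H' vertex_def that by (simp add: field_simps)
  have fin: thesis if "u' * (s' - 1) = u * (s - 1) + u * (of_int k + of_int l * s)"
    "3 dvd k + l" "k mod 3 = (if s' = s then 0 else 2)" for k l :: int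
  proof (rule result[OF key[OF that(1)]])
    show "3 dvd 3 * m + k + (3 * n + l)" using that(2) by presburger
    show "(3 * m + k) mod 3 = (if s' = s then 0 else 2)" using that(3) by simp
  qed
  note alg = algebra_simps turn_sq[OF s] turn_sq_left[OF s]
  consider "u' = u" "s' = s" | "u' = u" "s' = s * s" | "u' = u * s" "s' = s" | "u' = u * s" "s' = s * s"
    | "u' = u * s * s" "s' = s" | "u' = u * s * s" "s' = s * s"
    using u' s' by blast
  then show ?thesis
  proof cases
    case 1 show ?thesis by (rule fin[of 0 0]) (simp_all add: alg 1)
  next
    case 2 show ?thesis by (rule fin[of "-1" "-2"]) (simp_all add: alg 2 ss)
  next
    case 3 show ?thesis by (rule fin[of 0 "-3"]) (simp_all add: alg 3)
  next
    case 4 show ?thesis by (rule fin[of 2 "-2"]) (simp_all add: alg 4 ss)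
  next
    case 5 show ?thesis by (rule fin[of 3 0]) (simp_all add: alg 5)
  next
    case 6 show ?thesis by (rule fin[of 2 1]) (simp_all add: alg 6 ss)
  qed
qed

lemma vertex_offset':
  assumes "is_corner H u s" "w \<in> vertices"
  obtains a b :: int where "w = vertex H u s + u / 3 * (of_int a + of_int b * s)"
    "3 dvd a + b" "a mod 3 \<noteq> 1"
proof -
  obtain H' u' s' where "w = vertex H' u' s'" "is_corner H' u' s'"
    using assms(2) unfolding vertices_def by blast
  then show thesis
    using vertex_offset[OF assms(1), of H' u' s'] that by (metis one_neq_zero numeral_eq_one_iff semiring_norm(85))
qed

text \<open>The cube root of a corner is the colour of its vertex, so the links of one circle all
  turn the same way.\<close>

lemma vertex_turn_eq:
  assumes "is_corner H u s" "is_corner H' u' s'" "vertex H u s = vertex H' u' s'"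
  shows "s' = s"
proof (rule ccontr)
  assume ne: "s' \<noteq> s"
  obtain a b :: int where "vertex H' u' s' = vertex H u s + u / 3 * (of_int a + of_int b * s)"
    "a mod 3 = (if s' = s then 0 else 2)"
    using vertex_offset[OF assms(1,2)] .
  then have a: "of_real (of_int a) + of_real (of_int b) * s = 0" "a mod 3 = 2"
    using assms dirs_nz ne by auto
  then show False using turn_comb_eq_0[OF _ a(1)] assms(1) by auto
qed

lemma quad_gt:
  assumes "1 < (2 * y - x)\<^sup>2 \<or> 1 < (2 * x - y)\<^sup>2 \<or> 1 < (x + y)\<^sup>2"
  shows "quad x y > 1 / 4"
proof -
  have "quad x y \<ge> (2 * y - x)\<^sup>2 / 4" "quad x y \<ge> (2 * x - y)\<^sup>2 / 4" "quad x y \<ge> (x + y)\<^sup>2 / 4"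
    by (subst quad_alt(2), simp, subst quad_alt(1), simp, subst quad_alt(3), simp)
  with assms show ?thesis by (elim disjE) linarith+
qed

text \<open>The inequalities describe the open triangle spanned by the three hexagon centres around
  the vertex; its sides are the tangents to the circle at its three tangency points.\<close>

lemma vertex_far:
  assumes "is_corner H u s" "w \<in> vertices" "w \<noteq> vertex H u s"
    and "- 1 < x + y" "2 * x - y < 1" "2 * y - x < 1"
  shows "dist (pt H u s x y) w > r"
proof -
  obtain a b :: int where w: "w = vertex H u s + u / 3 * (of_int a + of_int b * s)"
    and ab: "3 dvd a + b" "a mod 3 \<noteq> 1"
    using vertex_offset'[OF assms(1,2)] .
  define x' y' where "x' = (of_int a - 2 * of_int b :: real) / 3" "y' = (2 * of_int a - of_int b :: real) / 3"
  have e: "2 * y' - x' = of_int a" "y' - 2 * x' = of_int b"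
    by (simp_all add: x'_y'_def field_simps)
  have w': "w = pt H u s x' y'" unfolding pt_alt e w by simp
  have "a \<noteq> 0 \<or> b \<noteq> 0" using assms(3) w by auto
  \<comment> \<open>The congruences rule out small offsets: along one of the three edges at the
    vertex, \<open>w\<close> is displaced by at least 2, a full edge length, whereas the point stays
    below 1, half of it.\<close>
  then have "a \<ge> 2 \<or> - b \<ge> 2 \<or> b - a \<ge> 2" using ab by presburger
  then have "of_int a \<ge> (2::real) \<or> - of_int b \<ge> (2::real) \<or> of_int b - of_int a \<ge> (2::real)"
    by linarith
  then have "1 < (2 * y' - x') - (2 * y - x) \<or> 1 < (2 * x' - y') - (2 * x - y) \<or>
      1 < (x + y) - (x' + y')"
    using e assms(4-6) by linarith
  then have "1 < (2 * (y - y') - (x - x'))\<^sup>2 \<or> 1 < (2 * (x - x') - (y - y'))\<^sup>2 \<or>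
      1 < ((x - x') + (y - y'))\<^sup>2"
  proof (elim disjE)
    assume "1 < (2 * y' - x') - (2 * y - x)"
    then have "2 * (y - y') - (x - x') < - 1" by argo
    then show ?thesis using square_gt_1 by blast
  next
    assume "1 < (2 * x' - y') - (2 * x - y)"
    then have "2 * (x - x') - (y - y') < - 1" by argo
    then show ?thesis using square_gt_1 by blast
  next
    assume "1 < (x + y) - (x' + y')"
    then have "1 < (x - x') + (y - y')" by argo
    then show ?thesis using square_gt_1 by blast
  qed
  then have "quad (x - x') (y - y') > 1 / 4" using quad_gt by blast
  then have "r\<^sup>2 * 1 < r\<^sup>2 * (4 * quad (x - x') (y - y'))"
    using r_pos by (subst mult_less_cancel_left_pos) simp_all
  then have "r\<^sup>2 < (dist (pt H u s x y) w)\<^sup>2"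
    unfolding w' using pt_dist[of u s H x y x' y'] assms(1) by (simp add: mult_ac)
  then show ?thesis by (rule power2_less_imp_less) simp
qed

lemma kite_far:
  assumes "is_corner H u s" "w \<in> vertices" "w \<noteq> vertex H u s" "z \<in> kite H u s"
  shows "dist z w > r"
proof -
  obtain x y where z: "z = pt H u s x y" and *: "0 < x" "0 < y" "2 * x - y < 1" "2 * y - x < 1"
    using assms(4) unfolding kite_def by blast
  show ?thesis unfolding z using * by (intro vertex_far[OF assms(1-3)]) auto
qed

lemma center_far:
  assumes "H \<in> centers" "w \<in> vertices"
  shows "dist H w > r"
proof -
  let ?s = "cis (2 * pi / 3)"
  have a: "is_corner H \<delta> ?s" using assms dirs_\<delta> turn_cis by simp
  obtain a b :: int where w: "w = vertex H \<delta> ?s + \<delta> / 3 * (of_int a + of_int b * ?s)"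
    and ab: "3 dvd a + b" "a mod 3 \<noteq> 1"
    using vertex_offset'[OF a assms(2)] .
  \<comment> \<open>Shifting the origin from the vertex to \<open>H\<close>. The class
    \<open>a mod 3 = 1\<close> of the centres becomes the class of \<open>k = 0\<close>, so
    \<open>k\<close> is nonzero.\<close>
  define k l where "k = a - 1" "l = b + 1"
  have "w - H = \<delta> / 3 * (of_int k + of_int l * ?s)"
    unfolding w vertex_def k_l_def by (simp add: field_simps)
  then have "dist H w = cmod \<delta> / 3 * cmod (of_real (of_int k) + of_real (of_int l) * ?s)"
    by (simp only: dist_norm norm_minus_commute[of H w] norm_mult norm_divide) simp
  then have "(dist H w)\<^sup>2 = (cmod \<delta> / 3)\<^sup>2 * ((of_int k)\<^sup>2 - of_int k * of_int l + (of_int l)\<^sup>2)"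
    by (simp only: power_mult_distrib cmod_turn_comb[OF turn_cis])
  also have "(of_int k)\<^sup>2 - of_int k * of_int l + (of_int l)\<^sup>2 = (of_int (k\<^sup>2 - k * l + l\<^sup>2) :: real)"
    by simp
  also have "(cmod \<delta> / 3)\<^sup>2 = 4 / 3 * r\<^sup>2"
    by (simp add: norm_\<delta> power_divide power_mult_distrib)
  finally have d: "(dist H w)\<^sup>2 = 4 / 3 * r\<^sup>2 * of_int (k\<^sup>2 - k * l + l\<^sup>2)" .
  have "k \<noteq> 0" using ab unfolding k_l_def by auto
  then have "k * k > 0" by (simp add: zero_less_mult_iff neq_iff disj_commute)
  moreover have "4 * (k\<^sup>2 - k * l + l\<^sup>2) = (2 * l - k)\<^sup>2 + 3 * (k * k)"
    by (simp add: power2_eq_square algebra_simps)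
  moreover have "(2 * l - k)\<^sup>2 \<ge> 0" by simp
  ultimately have "4 * (k\<^sup>2 - k * l + l\<^sup>2) > 0" by linarith
  \<comment> \<open>The least positive integer already suffices, since 4 / 3 > 1.\<close>
  then have "k\<^sup>2 - k * l + l\<^sup>2 \<ge> 1" by simp
  then have "(of_int (k\<^sup>2 - k * l + l\<^sup>2) :: real) \<ge> 1" by (simp only: of_int_1_le_iff)
  then have "(dist H w)\<^sup>2 \<ge> 4 / 3 * r\<^sup>2 * 1"
    unfolding d by (intro mult_left_mono) auto
  moreover have "r\<^sup>2 > 0" using r_pos by simp
  ultimately have "r\<^sup>2 < (dist H w)\<^sup>2" by linarith
  then show ?thesis by (rule power2_less_imp_less) simp
qed

end

lemma third_eq: "3 * x + a = 3 * y + b \<Longrightarrow> x + a / 3 = y + b / (3 :: complex)"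
  by (simp add: field_simps)

context hexgrid
begin

lemma vertex_in [simp]: "is_corner H u s \<Longrightarrow> vertex H u s \<in> vertices"
  unfolding vertices_def by blast

text \<open>The vertex is the centroid of the centres \<open>H - u\<close>, \<open>H\<close> and
  \<open>H + u * s\<close>; passing to the next link of the same circle permutes them
  cyclically.\<close>

lemma vertex_next: "turn s \<Longrightarrow> vertex (H + u * s) (u * s) s = vertex H u s"
  unfolding vertex_def by (rule third_eq) (simp add: algebra_simps turn_sq turn_sq_left)

lemma vertex_prev: "turn s \<Longrightarrow> vertex (H - u) (u * s * s) s = vertex H u s"
  unfolding vertex_def by (rule third_eq) (simp add: algebra_simps turn_sq turn_sq_left)

lemma radial_mult: "radial (u * k) s = radial u s * k"
  by (simp add: radial_def)

text \<open>A point of the kite is too far from every other vertex, so both links lie on one circle.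
  In the coordinates of the first link the other two thirds of that circle have a coordinate that is
  not positive.\<close>

lemma open_arc_disjoint:
  assumes "is_corner H u s" "is_corner H' u' s'" "z \<in> open_arc H u s" "z \<in> arc H' u' s'"
  shows "H' = H \<and> u' = u \<and> s' = s"
proof -
  have s: "turn s" using assms by blast
  have "z \<in> kite H u s" using assms(3) open_arc_kite by blast
  moreover have "dist z (vertex H' u' s') = r" using arc_on_circle assms by blast
  ultimately have v: "vertex H u s = vertex H' u' s'"
    using kite_far[OF assms(1), of "vertex H' u' s'" z] assms(2) vertex_in by force
  have s': "s' = s" using vertex_turn_eq[OF assms(1,2) v] .
  obtain x y where z: "z = pt H u s x y" "0 < x" "0 < y" using assms(3) unfolding open_arc_def by blast
  obtain x' y' where z': "z = pt H' u' s x' y'" "0 \<le> x'" "0 \<le> y'"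
    using assms(4) unfolding arc_def s' by blast
  note alg = algebra_simps turn_sq[OF s] turn_sq_left[OF s]
  have nz: "radial u s \<noteq> 0" using radial_nz assms by blast
  have eq: "radial u s * (of_real x + of_real y * s) = radial u' s * (of_real x' + of_real y' * s)"
    using z(1) z'(1) v s' by (simp add: pt_radial[OF s])
  consider "u' = u" | "u' = u * s" | "u' = u * s * s" using dirs_quot assms by blast
  then show ?thesis
  proof cases
    case 1
    then show ?thesis using v s' by (simp add: vertex_def)
  next
    case 2
    have "of_real x + of_real y * s = s * (of_real x' + of_real y' * s)"
      using eq nz by (simp add: 2 radial_mult)
    then have "of_real (x + y') + of_real (y - x' + y') * s = 0" by (simp add: alg)
    from turn_comb_eq_0[OF s this] show ?thesis using z z' by linarith
  next
    case 3
    have "of_real x + of_real y * s = s * s * (of_real x' + of_real y' * s)"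
      using eq nz by (simp add: 3 radial_mult mult.assoc)
    then have "of_real (x + x' - y') + of_real (y + x') * s = 0" by (simp add: alg)
    from turn_comb_eq_0[OF s this] show ?thesis using z z' by linarith
  qed
qed

section \<open>Edges\<close>

definition edges :: "(complex \<times> complex) set" where
  "edges = centers \<times> dirs"

definition mid :: "complex \<times> complex \<Rightarrow> complex" where
  "mid e = fst e + snd e / 2"

lemma edge_corner: "(P, u) \<in> edges \<Longrightarrow> turn s \<Longrightarrow> is_corner (P + u) u s"
  by (simp add: edges_def centers_add)

lemma edge_corner': "(P, u) \<in> edges \<Longrightarrow> turn s \<Longrightarrow> is_corner P (u * s * s) s"
  by (simp add: edges_def dirs_turn)

lemma corner_edge: "is_corner H u s \<Longrightarrow> (H - u, u) \<in> edges"
  by (simp add: edges_def centers_diff)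

lemma corner_edge': "is_corner H u s \<Longrightarrow> (H, u * s) \<in> edges"
  by (simp add: edges_def dirs_turn)

text \<open>The midpoint is an end of two links, one for each cube root. If it were interior to a
  third one, disjointness would identify that link with both.\<close>

lemma mid_not_open_arc:
  assumes "e \<in> edges" "is_corner H u s"
  shows "mid e \<notin> open_arc H u s"
proof
  assume a: "mid e \<in> open_arc H u s"
  obtain P v where e: "e = (P, v)" by force
  have c: "is_corner (P + v) v k" if "turn k" for k using edge_corner assms(1) that unfolding e by blast
  have m: "mid e \<in> arc (P + v) v k" for k using arc_ends(1)[of "P + v" v k] by (simp add: mid_def e add.commute)
  have "k = s" if "turn k" for k
    using open_arc_disjoint[OF assms(2) c[OF that] a m] by blast
  from this[OF turn_cis] this[OF turn_square[OF turn_cis]] show False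
    using turn_sq_neq[OF turn_cis] by simp
qed

text \<open>Equal midpoints give u - u' = 2 (P' - P). For distinct directions the left-hand side is
  u times 1 - s or 1 - s * s, which is not divisible by 2 among the Eisenstein integers.\<close>

lemma mid_inj:
  assumes "e \<in> edges" "e' \<in> edges" "mid e = mid e'"
  shows "e = e'"
proof -
  obtain s where s: "turn s" using turn_cis by blast
  obtain P u P' u' where e: "e = (P, u)" "e' = (P', u')" by force
  have *: "P \<in> centers" "P' \<in> centers" "u \<in> dirs" "u' \<in> dirs" using assms e by (auto simp: edges_def)
  obtain m n where mn: "P' - P = u * (of_int m + of_int n * s)"
    using centers_rep[OF *(1,2,3) s] .
  have "(P + u / 2) * 2 = (P' + u' / 2) * 2" using assms(3) by (simp add: mid_def e)
  then have eq: "u - u' = 2 * (P' - P)" by (simp add: algebra_simps)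
  note alg = algebra_simps turn_sq[OF s] turn_sq_left[OF s]
  have nz: "u \<noteq> 0" using * dirs_nz by blast
  consider "u' = u" | "u' = u * s" | "u' = u * s * s" using dirs_quot[OF *(3,4) s] by blast
  then show ?thesis
  proof cases
    case 1
    then show ?thesis using eq e by simp
  next
    case 2
    have "u * (1 - s) = u * (2 * (of_int m + of_int n * s))"
      using eq unfolding mn 2 by (simp add: algebra_simps)
    then have "1 - s = 2 * (of_int m + of_int n * s)" using nz by simp
    then have "of_real (1 - 2 * of_int m) + of_real (- 1 - 2 * of_int n) * s = 0" by (simp add: alg)
    from turn_comb_eq_0[OF s this] have "of_int (2 * m) = (1::real)" by simp
    then have "2 * m = 1" by (metis of_int_1 of_int_eq_iff)
    then have False by presburger
    then show ?thesis ..
  next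
    case 3
    have "u * (1 - s * s) = u * (2 * (of_int m + of_int n * s))"
      using eq unfolding mn 3 by (simp add: algebra_simps)
    then have "1 - s * s = 2 * (of_int m + of_int n * s)" using nz by simp
    then have "of_real (2 - 2 * of_int m) + of_real (1 - 2 * of_int n) * s = 0"
      by (simp add: alg)
    from turn_comb_eq_0[OF s this] have "of_int (2 * n) = (1::real)" by simp
    then have "2 * n = 1" by (metis of_int_1 of_int_eq_iff)
    then have False by presburger
    then show ?thesis ..
  qed
qed

lemma mid_in_arc:
  assumes "e \<in> edges" "is_corner H u s" "mid e \<in> arc H u s"
  shows "e = (H - u, u) \<or> e = (H, u * s)"
proof -
  have "mid e = mid (H - u, u) \<or> mid e = mid (H, u * s)"
    using arc_cases[OF assms(3)] mid_not_open_arc[OF assms(1,2)] by (auto simp: mid_def field_simps)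
  then show ?thesis using mid_inj assms corner_edge corner_edge' by blast
qed

section \<open>Links\<close>

text \<open>A link in the sense of \<open>is_link\<close> starts at its counterclockwise first end.
  For the other cube root the corner runs clockwise, so this end is its final one and the neighbour
  beyond that end, reached by \<open>radial u s * s\<close>, is recorded.\<close>

definition lnk :: "complex \<Rightarrow> complex \<Rightarrow> complex \<Rightarrow> link" where
  "lnk H u s = (vertex H u s,
     vertex H u s + radial u s * (if s = cis (2 * pi / 3) then 1 else s))"

lemma arc_param:
  assumes "turn s"
  shows "arc H u s = (\<lambda>\<tau>. vertex H u s + radial u s / 2 * cis (ang s * \<tau>)) ` {0..1}"
proof
  show "(\<lambda>\<tau>. vertex H u s + radial u s / 2 * cis (ang s * \<tau>)) ` {0..1} \<subseteq> arc H u s"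
  proof clarify
    fix \<tau> :: real assume t: "\<tau> \<in> {0..1}"
    define x y where "x = sin (2 * pi / 3 * (1 - \<tau>)) / sqrt 3" "y = sin (2 * pi / 3 * \<tau>) / sqrt 3"
    have c: "cis (ang s * \<tau>) / 2 = of_real x + of_real y * s"
      unfolding x_y_def by (rule ang_arc_comb[OF assms])
    have "sin (2 * pi / 3 * a) \<ge> 0" if "0 \<le> a" "a \<le> 1" for a
    proof (rule sin_ge_zero)
      have "2 * pi / 3 * a \<le> 2 * pi / 3 * 1" using that by (intro mult_left_mono) auto
      also have "\<dots> \<le> pi" by simp
      finally show "2 * pi / 3 * a \<le> pi" .
    qed (use that in auto)
    from this[of "1 - \<tau>"] this[of \<tau>] have xy: "x \<ge> 0" "y \<ge> 0" unfolding x_y_def using t by auto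
    have "quad x y = (cmod (of_real x + of_real y * s))\<^sup>2"
      by (simp add: cmod_turn_comb[OF assms] quad_def)
    also have "\<dots> = 1 / 4" unfolding c[symmetric] by (simp add: norm_divide power_divide)
    finally have "vertex H u s + radial u s * (cis (ang s * \<tau>) / 2) \<in> arc H u s"
      unfolding c arc_def pt_radial[OF assms] using xy by blast
    then show "vertex H u s + radial u s / 2 * cis (ang s * \<tau>) \<in> arc H u s" by simp
  qed
  show "arc H u s \<subseteq> (\<lambda>\<tau>. vertex H u s + radial u s / 2 * cis (ang s * \<tau>)) ` {0..1}"
  proof
    fix z assume "z \<in> arc H u s"
    then obtain x y where z: "z = pt H u s x y" "0 \<le> x" "0 \<le> y" "quad x y = 1 / 4"
      unfolding arc_def by blast
    have norm: "cmod (of_real x + of_real y * k) = 1 / 2" if "turn k" for k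
    proof -
      have "(cmod (of_real x + of_real y * k))\<^sup>2 = (1 / 2)\<^sup>2"
        using z(4) by (simp add: cmod_turn_comb[OF that] quad_def power_divide)
      then show ?thesis by (rule power2_eq_imp_eq) auto
    qed
    obtain \<theta> where th: "\<theta> \<in> {0..2 * pi / 3}" "of_real x + of_real y * cis (2 * pi / 3) = cis \<theta> / 2"
      using cis_in_sector[OF norm[OF turn_cis] z(2,3)] by blast
    define \<tau> where "\<tau> = \<theta> / (2 * pi / 3)"
    have \<tau>: "\<tau> \<in> {0..1}" using th(1) by (auto simp: \<tau>_def divide_le_eq_1_pos simp del: divide_divide_eq_right)
    have \<theta>: "\<theta> = 2 * pi / 3 * \<tau>" by (simp add: \<tau>_def)
    have "of_real x + of_real y * s = cis (ang s * \<tau>) / 2"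
    proof (cases "s = cis (2 * pi / 3)")
      case True
      then show ?thesis using th(2) by (simp add: ang_def \<theta>)
    next
      case False
      then have a: "ang s = - (2 * pi / 3)" by (simp add: ang_def)
      then have "s = cnj (cis (2 * pi / 3))" using turn_ang[OF assms] by (simp add: cis_cnj)
      then have "of_real x + of_real y * s = cnj (cis \<theta> / 2)" unfolding th(2)[symmetric] by simp
      then show ?thesis by (simp add: a \<theta> cis_cnj)
    qed
    then have "z = vertex H u s + radial u s / 2 * cis (ang s * \<tau>)"
      unfolding z(1) pt_radial[OF assms] by simp
    then show "z \<in> (\<lambda>\<tau>. vertex H u s + radial u s / 2 * cis (ang s * \<tau>)) ` {0..1}" using \<tau> by blast
  qed
qed

lemma ang_cases: "ang s = 2 * pi / 3 \<or> ang s = - (2 * pi / 3)"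
  by (simp add: ang_def)

lemma lnk_point:
  assumes "turn s"
  shows "link_point (lnk H u s) (2 * pi / 3 * \<tau>) = vertex H u s + radial u s / 2 *
     cis (ang s * (if s = cis (2 * pi / 3) then \<tau> else 1 - \<tau>))"
proof (cases "s = cis (2 * pi / 3)")
  case True
  then show ?thesis by (simp add: link_point_def lnk_def ang_def)
next
  case False
  then have a: "ang s = - (2 * pi / 3)" by (simp add: ang_def)
  then have s: "s = cis (- (2 * pi / 3))" using turn_ang[OF assms] by simp
  have "s * cis (2 * pi / 3 * \<tau>) = cis (ang s * (1 - \<tau>))"
    unfolding a by (subst s) (simp add: cis_mult right_diff_distrib add.commute)
  then show ?thesis using False by (simp add: link_point_def lnk_def mult.assoc)
qed

lemma link_arc_lnk:
  assumes "turn s"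
  shows "link_arc (lnk H u s) = arc H u s"
proof -
  have 1: "{0..2 * pi / 3} = (\<lambda>\<tau>. 2 * pi / 3 * \<tau>) ` {0..1::real}"
    using image_mult_atLeastAtMost[of "2 * pi / 3" 0 1] by simp
  have 2: "(\<lambda>\<tau>. 1 - \<tau>) ` {0..1::real} = {0..1}" using image_diff_atLeastAtMost[of 1 0 "1::real"] by simp
  show ?thesis
  proof (cases "s = cis (2 * pi / 3)")
    case True
    then show ?thesis
      unfolding link_arc_def arc_param[OF assms] 1 image_image lnk_point[OF assms] by simp
  next
    case False
    have "arc H u s = (\<lambda>\<tau>. vertex H u s + radial u s / 2 * cis (ang s * \<tau>)) ` (\<lambda>\<tau>. 1 - \<tau>) ` {0..1}"
      unfolding 2 by (rule arc_param[OF assms])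
    then show ?thesis
      unfolding link_arc_def 1 image_image lnk_point[OF assms] using False by simp
  qed
qed

lemma arc_param_ends:
  assumes "turn s"
  shows "vertex H u s + radial u s / 2 = H - u / 2"
    and "vertex H u s + radial u s / 2 * s = H + u * s / 2"
  using pt_start[of H u s] pt_end[of H u s] by (simp_all add: pt_radial[OF assms])

lemma link_ends_lnk:
  assumes "turn s"
  shows "link_ends (lnk H u s) = {H - u / 2, H + u * s / 2}"
  using lnk_point[OF assms, of H u 0] lnk_point[OF assms, of H u 1] arc_param_ends[OF assms, of H u]
    turn_ang[OF assms, symmetric]
  by (auto simp: link_ends_def)

lemma open_arc_nonempty: "pt H u s (1/2) (1/2) \<in> open_arc H u s"
  by (force simp: open_arc_def quad_def power2_eq_square)

lemma lnk_inj:
  assumes "is_corner H u s" "is_corner H' u' s'" "lnk H u s = lnk H' u' s'"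
  shows "H' = H \<and> u' = u \<and> s' = s"
  using open_arc_disjoint[OF assms(1,2) open_arc_nonempty] open_arc_nonempty[of H u s]
    open_arc_arc[of H u s] link_arc_lnk[of s H u] link_arc_lnk[of s' H' u'] assms by auto

lemma vertex_plus_radial:
  assumes "is_corner H u s"
  shows "vertex H u s + radial u s \<in> vertices" "vertex H u s + radial u s * s \<in> vertices"
proof -
  have s: "turn s" using assms by blast
  have 1: "vertex H u s + radial u s = vertex H u (s * s)"
  proof -
    have "u * (s - 1) - u * (1 + 2 * s) = u * (s * s - 1)" by (simp add: algebra_simps turn_sq[OF s])
    then have "H + (u * (s - 1) - u * (1 + 2 * s)) / 3 = H + u * (s * s - 1) / 3" by simp
    then show ?thesis by (simp add: vertex_def radial_def diff_divide_distrib)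
  qed
  have 2: "vertex H u s + radial u s * s = vertex (H + u * s) (u * s) (s * s)"
  proof -
    have "H + (u * (s - 1) + u * (2 + s)) / 3 = H + u * s + u * s * (s * s - 1) / 3"
    proof -
      have "3 * H + (u * (s - 1) + u * (2 + s)) = 3 * (H + u * s) + u * s * (s * s - 1)"
        by (simp add: algebra_simps turn_sq[OF s] turn_sq_left[OF s])
      then show ?thesis using third_eq[of H "u * (s - 1) + u * (2 + s)" "H + u * s"] by simp
    qed
    then show ?thesis unfolding radial_turn[OF s] vertex_def by (simp add: add_divide_distrib)
  qed
  have "is_corner H u (s * s)" "is_corner (H + u * s) (u * s) (s * s)"
    using assms by (auto simp: centers_add dirs_turn)
  then show "vertex H u s + radial u s \<in> vertices" "vertex H u s + radial u s * s \<in> vertices"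
    unfolding 1 2 using vertex_in by blast+
qed

lemma radial_norm: "u \<in> dirs \<Longrightarrow> turn s \<Longrightarrow> norm (radial u s) = 2 * r"
proof -
  assume a: "u \<in> dirs" "turn s"
  have "(dist (pt H u s 1 0) (vertex H u s))\<^sup>2 = (2 * r)\<^sup>2"
    using pt_dist[OF a, of H 1 0 0 0] by (simp add: quad_def power_mult_distrib)
  then have "dist (pt H u s 1 0) (vertex H u s) = 2 * r"
    by (rule power2_eq_imp_eq) (use r_pos in auto)
  then show ?thesis unfolding pt_radial[OF a(2)] dist_norm by simp
qed

lemma is_link_lnk:
  assumes "is_corner H u s"
  shows "is_link r vertices (lnk H u s)"
proof -
  have "norm (radial u s) = 2 * r" "norm (radial u s * s) = 2 * r" "vertex H u s \<in> vertices"
    using assms radial_norm[of u s] turn_norm[of s] vertex_in[OF assms] unfolding norm_mult by simp_all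
  then show ?thesis
    using vertex_plus_radial[OF assms] unfolding is_link_def lnk_def dist_norm by auto
qed

text \<open>Adjacency at distance \<open>2 * r\<close> becomes the value 3 of the norm form. With
  the congruences there are only three solutions, the three neighbours of the vertex, and each is
  the recorded neighbour of one corner there.\<close>

lemma is_link_cases:
  assumes "is_link r vertices L"
  obtains H u s where "is_corner H u s" "L = lnk H u s"
proof -
  obtain v w where L: "L = (v, w)" by force
  have vw: "v \<in> vertices" "w \<in> vertices" "dist v w = 2 * r"
    using assms by (auto simp: is_link_def L)
  obtain H u s where c: "is_corner H u s" and v: "v = vertex H u s"
    using vw(1) unfolding vertices_def by blast
  have s: "turn s" using c by blast
  obtain a b :: int where w: "w = v + u / 3 * (of_int a + of_int b * s)"
    and ab: "3 dvd a + b" "a mod 3 \<noteq> 1"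
    using vertex_offset'[OF c vw(2)] v by blast
  have "dist v w = norm u / 3 * cmod (of_real (of_int a) + of_real (of_int b) * s)"
    unfolding w by (simp add: dist_norm norm_mult norm_divide)
  then have "(2 * r)\<^sup>2 = (norm u / 3)\<^sup>2 * ((of_int a)\<^sup>2 - of_int a * of_int b + (of_int b)\<^sup>2)"
    unfolding vw(3) by (simp only: power_mult_distrib cmod_turn_comb[OF s])
  also have "(norm u / 3)\<^sup>2 = 4 / 3 * r\<^sup>2"
    using c dirs_norm[of u] by (simp add: power_divide power_mult_distrib)
  also have "((of_int a)\<^sup>2 - of_int a * of_int b + (of_int b)\<^sup>2) = (of_int (a\<^sup>2 - a * b + b\<^sup>2) :: real)"
    by simp
  finally have "4 / 3 * (r\<^sup>2 * of_int (a\<^sup>2 - a * b + b\<^sup>2)) = 4 / 3 * (r\<^sup>2 * 3)"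
    by (simp only: power_mult_distrib mult_ac) simp
  then have "r\<^sup>2 * of_int (a\<^sup>2 - a * b + b\<^sup>2) = r\<^sup>2 * 3" by (simp only: mult_cancel_left) simp
  then have "(of_int (a\<^sup>2 - a * b + b\<^sup>2) :: real) = of_int 3" using r_pos by simp
  then have q: "a\<^sup>2 - a * b + b\<^sup>2 = 3" by (simp only: of_int_eq_iff)
  \<comment> \<open>Completing the square bounds both coordinates by 2, leaving finitely many
    cases.\<close>
  have 12: "(2 * a - b)\<^sup>2 + 3 * b\<^sup>2 = 12" "(2 * b - a)\<^sup>2 + 3 * a\<^sup>2 = 12"
    using q by (simp_all add: power2_eq_square algebra_simps)
  have le: "y \<le> c" if "x + y = c" "0 \<le> x" for x y c :: int using that by simp
  have "3 * a\<^sup>2 \<le> 12" "3 * b\<^sup>2 \<le> 12"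
    by (rule le[OF 12(2)], simp, rule le[OF 12(1)], simp)
  then have "\<bar>a\<bar> \<le> 2" "\<bar>b\<bar> \<le> 2"
    using abs_le_square_iff[of a 2] abs_le_square_iff[of b 2] by simp_all
  then have "a \<in> {-2,-1,0,1,2}" "b \<in> {-2,-1,0,1,2}" by auto
  then have "a = - 1 \<and> b = - 2 \<or> a = 2 \<and> b = 1 \<or> a = - 1 \<and> b = 1"
    using q ab by (auto simp: power2_eq_square)
  then have w3: "w = v + radial u s \<or> w = v + radial u s * s \<or> w = v + radial u s * s * s"
  proof (elim disjE conjE)
    assume "a = - 1" "b = - 2"
    then have "u / 3 * (of_int a + of_int b * s) = radial u s"
      unfolding radial_def times_divide_eq_left minus_divide_left by (simp add: algebra_simps)
    then show ?thesis using w by simp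
  next
    assume "a = 2" "b = 1"
    then show ?thesis using w unfolding radial_turn[OF s] by simp
  next
    assume "a = - 1" "b = 1"
    then have "u / 3 * (of_int a + of_int b * s) = u * (- 1 + s) / 3" by simp
    also have "u * (- 1 + s) = u * (2 + s) * s"
      by (simp add: algebra_simps turn_sq[OF s] turn_sq_left[OF s])
    also have "u * (2 + s) * s / 3 = radial u s * s * s" unfolding radial_turn[OF s] by simp
    finally have "u / 3 * (of_int a + of_int b * s) = radial u s * s * s" .
    then show ?thesis using w by simp
  qed
  have turned: "is_corner (H + u * s) (u * s) s" "vertex (H + u * s) (u * s) s = v"
    "is_corner (H - u) (u * s * s) s" "vertex (H - u) (u * s * s) s = v"
    using c v by (auto simp: centers_add centers_diff dirs_turn vertex_next vertex_prev)
  \<comment> \<open>The three corners at one vertex have the \<open>radial\<close> vectors of the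
    first one turned by the powers of \<open>s\<close>, so any neighbour can be moved to the
    position prescribed by \<open>k\<close>.\<close>
  have key: "\<exists>H u. is_corner H u s \<and> vertex H u s = v \<and> w = v + radial u s * k"
    if "k = 1 \<or> k = s" for k
  proof -
    have "radial u s * s * s * s = radial u s" using turn_cube[OF s] by (simp add: mult.assoc)
    then have "w = v + radial u s * k \<or> w = v + radial (u * s) s * k \<or> w = v + radial (u * s * s) s * k"
      using that w3 by (auto simp: radial_mult)
    then show ?thesis using c v turned by blast
  qed
  have "(if s = cis (2 * pi / 3) then 1 else s) = 1 \<or> (if s = cis (2 * pi / 3) then 1 else s) = s"
    by simp
  from key[OF this] obtain H' u' where "is_corner H' u' s" "vertex H' u' s = v"
      "w = v + radial u' s * (if s = cis (2 * pi / 3) then 1 else s)"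
    by blast
  then show thesis using that[of H' u' s] by (simp add: L lnk_def)
qed

end

section \<open>Identification of the lattice vertices with those of the given tiling\<close>

lemma tiling_vertices_hexgrid:
  assumes "hexgrid (of_real (sqrt 3) * d * cis (pi / 6)) r"
  shows "tiling_vertices p d = hexgrid.vertices p (of_real (sqrt 3) * d * cis (pi / 6))"
proof -
  define \<delta> where "\<delta> = of_real (sqrt 3) * d * cis (pi / 6)"
  interpret hexgrid p \<delta> r using assms unfolding \<delta>_def .
  define w where "w = cis (2 * pi / 3)"
  have w: "turn w" using turn_cis by (simp add: w_def)
  note alg = algebra_simps turn_sq[OF w] turn_sq_left[OF w]
  have c3: "cis (pi / 3) = 1 + w"
    unfolding w_def by (rule complex_eqI) (simp_all add: sin_60 cos_60 sin_120 cos_120)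
  have c2: "cis (pi / 2) = cis (pi / 6) * (1 + w)"
    unfolding c3[symmetric] cis_mult by simp
  \<comment> \<open>Both sides are 3/2 + i \<open>sqrt 3\<close> / 2. This turns the trigonometric
    description of the tiling into Eisenstein arithmetic with \<delta> = d (2 + w).\<close>
  have c6: "of_real (sqrt 3) * cis (pi / 6) = 2 + w"
    unfolding w_def by (rule complex_eqI) (simp_all add: sin_30 cos_30 sin_120 cos_120)
  have \<delta>: "\<delta> = d * (2 + w)" unfolding \<delta>_def c6[symmetric] by simp
  have C: "hexagon_centers p d = centers"
  proof -
    have "p + of_real (sqrt 3) * d * (of_int m * cis (pi / 6) + of_int n * cis (pi / 2)) =
      p + \<delta> * (of_int (m + n) + of_int n * w)" for m n
      unfolding c2 \<delta>_def by (simp add: algebra_simps)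
    then have "hexagon_centers p d = {p + \<delta> * (of_int (m + n) + of_int n * w) | m n. True}"
      unfolding hexagon_centers_def by simp
    also have "\<dots> = {p + \<delta> * (of_int m + of_int n * w) | m n. True}"
    proof (intro equalityI subsetI)
      fix z assume "z \<in> {p + \<delta> * (of_int m + of_int n * w) | m n. True}"
      then obtain m n where "z = p + \<delta> * (of_int m + of_int n * w)" by blast
      then have "z = p + \<delta> * (of_int ((m - n) + n) + of_int n * w)" by simp
      then show "z \<in> {p + \<delta> * (of_int (m + n) + of_int n * w) | m n. True}" by blast
    qed blast
    also have "\<dots> = centers" unfolding centers_def eis_alt[OF w] by blast
    finally show ?thesis .
  qed
  have k6: "{k. k < (6::nat)} = {0,1,2,3,4,5}" by auto
  have pw: "cis (of_nat k * pi / 3) = (1 + w) ^ k" for k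
    unfolding c3[symmetric] using Complex.DeMoivre[of "pi / 3" k] by simp
  have K: "hexagon_corners c d = (\<lambda>k. c + d * k) ` {1, 1 + w, w, - 1, - 1 - w, - w}" for c
  proof -
    have "hexagon_corners c d = (\<lambda>k. c + d * (1 + w) ^ k) ` {k. k < 6}"
      unfolding hexagon_corners_def pw by blast
    then show ?thesis unfolding k6
      by (simp add: eval_nat_numeral alg)
  qed
  have V: "{vertex H u s | u s. u \<in> dirs \<and> turn s} = (\<lambda>k. H + d * k) ` {1, 1 + w, w, - 1, - 1 - w, - w}" for H
  proof -
    have "{s. turn s} = {w, w * w}" using turn_cases[OF _ w] w turn_square[OF w] by blast
    moreover have "{vertex H u s | u s. u \<in> dirs \<and> turn s} = (\<Union>u\<in>dirs. vertex H u ` {s. turn s})"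
      by blast
    ultimately have 1: "{vertex H u s | u s. u \<in> dirs \<and> turn s} =
      {vertex H \<delta> w, vertex H \<delta> (w * w)} \<union> ({vertex H (\<delta> * w) w, vertex H (\<delta> * w) (w * w)} \<union>
      {vertex H (\<delta> * w * w) w, vertex H (\<delta> * w * w) (w * w)})"
      unfolding dirs_eq[OF w dirs_\<delta>] by auto
    have 2: "vertex H (\<delta> * j) k = H + d * l" if "(2 + w) * (j * (k - 1)) = 3 * l" for j k l
    proof -
      have "\<delta> * j * (k - 1) = d * ((2 + w) * (j * (k - 1)))" by (simp add: \<delta> mult_ac)
      then show ?thesis unfolding vertex_def that by simp
    qed
    have "vertex H (\<delta> * 1) w = H + d * (- 1)" "vertex H (\<delta> * 1) (w * w) = H + d * (- 1 - w)"
      "vertex H (\<delta> * w) w = H + d * (- w)" "vertex H (\<delta> * w) (w * w) = H + d * 1"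
      "vertex H (\<delta> * (w * w)) w = H + d * (1 + w)" "vertex H (\<delta> * (w * w)) (w * w) = H + d * w"
      by (rule 2, simp add: alg)+
    then show ?thesis
      unfolding 1 mult.assoc mult_1_right by (simp only: image_insert image_empty) auto
  qed
  have "tiling_vertices p d = (\<Union>H\<in>centers. {vertex H u s | u s. u \<in> dirs \<and> turn s})"
    unfolding tiling_vertices_def C K V ..
  also have "\<dots> = vertices" unfolding vertices_def by blast
  finally show ?thesis unfolding \<delta>_def .
qed

section \<open>Gluing functions on unit intervals\<close>

text \<open>At an integer, \<open>floor\<close> selects the piece on the right; because the pieces
  match, the one on the left may be used as well, hence a single piece on each closed unit
  interval.\<close>

lemma glue_eq:
  fixes G :: "int \<Rightarrow> real \<Rightarrow> 'a"
  assumes "\<And>i. G i (of_int (i + 1)) = G (i + 1) (of_int (i + 1))"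
    and "t \<in> {of_int i..of_int (i + 1)}"
  shows "G \<lfloor>t\<rfloor> t = G i t"
proof (cases "t = of_int (i + 1)")
  case True
  then show ?thesis using assms(1)[of i] by simp
next
  case False
  then have "\<lfloor>t\<rfloor> = i" using assms(2) by (intro floor_unique) auto
  then show ?thesis by simp
qed

lemma glue_continuous:
  fixes G :: "int \<Rightarrow> real \<Rightarrow> 'a::topological_space"
  assumes "\<And>i. continuous_on {of_int i..of_int (i + 1)} (G i)"
    and "\<And>i. G i (of_int (i + 1)) = G (i + 1) (of_int (i + 1))"
  shows "continuous_on UNIV (\<lambda>t. G \<lfloor>t\<rfloor> t)"
proof -
  let ?f = "\<lambda>t. G \<lfloor>t\<rfloor> t"
  have c: "continuous_on {of_int i..of_int (i + 1)} ?f" for i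
    using assms(1)[of i] glue_eq[of G, OF assms(2)] by (subst continuous_on_cong[OF refl]) auto
  have "isCont ?f t" for t
  proof -
    define i where "i = \<lfloor>t\<rfloor>"
    have "continuous_on ({of_int (i - 1)..of_int i} \<union> {of_int i..of_int (i + 1)}) ?f"
      using c[of "i - 1"] c[of i] by (intro continuous_on_closed_Un) simp_all
    then have "continuous_on {of_int (i - 1)<..<of_int (i + 1)} ?f"
      by (rule continuous_on_subset) auto
    moreover have "t \<in> {of_int (i - 1)<..<of_int (i + 1)}"
      unfolding i_def by simp linarith
    ultimately show ?thesis
      using continuous_on_eq_continuous_at[OF open_greaterThanLessThan] by blast
  qed
  then show ?thesis by (simp add: continuous_at_imp_continuous_on)
qed

lemma has_vector_derivative_within_Un:
  assumes "(f has_vector_derivative D) (at x within S)" "(f has_vector_derivative D) (at x within T)"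
  shows "(f has_vector_derivative D) (at x within (S \<union> T))"
  using assms unfolding has_vector_derivative_def has_derivative_within by (auto intro: Lim_Un)

text \<open>At an integer the two one-sided derivatives exist and agree, which gives a derivative on
  the union of both sides.\<close>

lemma glue_derivative:
  fixes G G' :: "int \<Rightarrow> real \<Rightarrow> 'a::real_normed_vector"
  assumes D: "\<And>i t. t \<in> {of_int i..of_int (i + 1)} \<Longrightarrow>
      (G i has_vector_derivative G' i t) (at t within {of_int i..of_int (i + 1)})"
    and G: "\<And>i. G i (of_int (i + 1)) = G (i + 1) (of_int (i + 1))"
    and G': "\<And>i. G' i (of_int (i + 1)) = G' (i + 1) (of_int (i + 1))"
  shows "((\<lambda>t. G \<lfloor>t\<rfloor> t) has_vector_derivative G' \<lfloor>t\<rfloor> t) (at t)"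
proof -
  let ?f = "\<lambda>t. G \<lfloor>t\<rfloor> t"
  have d: "(?f has_vector_derivative G' \<lfloor>t\<rfloor> t) (at t within {of_int i..of_int (i + 1)})"
    if t: "t \<in> {of_int i..of_int (i + 1)}" for i t
  proof -
    have "G' \<lfloor>t\<rfloor> t = G' i t" by (rule glue_eq[of G', OF G' t])
    then show ?thesis
      using has_vector_derivative_transform[OF t glue_eq[of G, OF G] D[OF t]] by simp
  qed
  define i where "i = \<lfloor>t\<rfloor>"
  have i: "of_int i \<le> t" "t < of_int (i + 1)" unfolding i_def by linarith+
  show ?thesis
  proof (cases "t = of_int i")
    case False
    then have "t \<in> interior {of_int i..of_int (i + 1)}" using i by (simp add: interior_atLeastAtMost_real)
    moreover have "t \<in> {of_int i..of_int (i + 1)}" using i by simp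
    ultimately show ?thesis using d[of t i] by (metis at_within_interior)
  next
    case True
    have t: "t \<in> {of_int (i - 1)..of_int (i - 1 + 1)}" "t \<in> {of_int i..of_int (i + 1)}"
      unfolding True by simp_all
    have "{of_int (i - 1)..of_int (i - 1 + 1)} \<union> {of_int i..of_int (i + 1)} = {of_int (i - 1)..of_int (i + 1) :: real}"
      by auto
    then have "(?f has_vector_derivative G' \<lfloor>t\<rfloor> t) (at t within {of_int (i - 1)..of_int (i + 1)})"
      using has_vector_derivative_within_Un[OF d[OF t(1)] d[OF t(2)]] by (simp only:)
    moreover have "t \<in> interior {of_int (i - 1)..of_int (i + 1)}"
      unfolding True by (simp add: interior_atLeastAtMost_real)
    ultimately show ?thesis by (metis at_within_interior)
  qed
qed

context hexgrid
begin

section \<open>Parametrisation of closed tours\<close>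

lemma arc_point:
  assumes "is_corner H u s"
  shows "vertex H u s + radial u s / 2 * cis (ang s * \<tau>) =
      pt H u s (sin (2 * pi / 3 * (1 - \<tau>)) / sqrt 3) (sin (2 * pi / 3 * \<tau>) / sqrt 3)"
    and "quad (sin (2 * pi / 3 * (1 - \<tau>)) / sqrt 3) (sin (2 * pi / 3 * \<tau>) / sqrt 3) = 1 / 4"
proof -
  have s: "turn s" using assms by blast
  note c = ang_arc_comb[OF s, of \<tau>]
  show "vertex H u s + radial u s / 2 * cis (ang s * \<tau>) =
      pt H u s (sin (2 * pi / 3 * (1 - \<tau>)) / sqrt 3) (sin (2 * pi / 3 * \<tau>) / sqrt 3)"
    unfolding pt_radial[OF s] c[symmetric] by simp
  have "(cmod (cis (ang s * \<tau>) / 2))\<^sup>2 = 1 / 4" by (simp add: norm_divide power_divide)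
  then show "quad (sin (2 * pi / 3 * (1 - \<tau>)) / sqrt 3) (sin (2 * pi / 3 * \<tau>) / sqrt 3) = 1 / 4"
    unfolding c cmod_turn_comb[OF s] quad_def .
qed

lemma open_arc_point:
  assumes "is_corner H u s" "0 < \<tau>" "\<tau> < 1"
  shows "vertex H u s + radial u s / 2 * cis (ang s * \<tau>) \<in> open_arc H u s"
proof -
  have "sin (2 * pi / 3 * a) > 0" if "0 < a" "a < 1" for a
  proof (rule sin_gt_zero)
    have "2 * pi / 3 * a < 2 * pi / 3 * 1" using that by (intro mult_strict_left_mono) auto
    also have "\<dots> < pi" by simp
    finally show "2 * pi / 3 * a < pi" .
  qed (use that in auto)
  then have "sin (2 * pi / 3 * (1 - \<tau>)) / sqrt 3 > 0" "sin (2 * pi / 3 * \<tau>) / sqrt 3 > 0"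
    using assms(2,3) by simp_all
  then show ?thesis
    unfolding arc_point(1)[OF assms(1)] open_arc_def using arc_point(2)[OF assms(1)] by blast
qed

text \<open>A link has length 2\<pi>r/3 and is run through in unit time, while vectors in
  \<open>dirs\<close> have length 2 \<open>sqrt 3\<close> r; this constant is the quotient.\<close>

definition speed :: real where "speed = pi * sqrt 3 / 9"

lemma speed_pos: "speed > 0"
  by (simp add: speed_def)

text \<open>The initial velocity of a link is the same multiple of \<open>u\<close> for both cube
  roots. This is why consecutive links join smoothly whichever way the next one turns.\<close>

lemma radial_velocity:
  assumes "turn s"
  shows "radial u s / 2 * (\<i> * of_real (ang s)) = of_real speed * u"
proof -
  have "Im s = sin (ang s)" using arg_cong[OF turn_ang[OF assms], of Im] by simp
  then have q: "Im s * ang s = sqrt 3 / 2 * (2 * pi / 3)"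
    using ang_cases[of s] by (elim disjE) (simp_all only: sin_minus sin_120 minus_mult_minus)
  have m: "- (2 * (Im s * ang s)) / 6 = - speed" unfolding q by (simp add: speed_def)
  have "1 + 2 * s = \<i> * of_real (2 * Im s)"
    using turn_Re_Im(1)[OF assms] by (simp add: complex_eq_iff)
  then have k: "(1 + 2 * s) * (\<i> * of_real (ang s)) = of_real (- (2 * (Im s * ang s)))"
    by (simp add: complex_eq_iff)
  have "radial u s / 2 * (\<i> * of_real (ang s)) = - u * (((1 + 2 * s) * (\<i> * of_real (ang s))) / 6)"
    by (simp add: radial_def)
  also have "\<dots> = - u * of_real (- (2 * (Im s * ang s)) / 6)" unfolding k by (simp only: of_real_divide of_real_numeral)
  also have "\<dots> = of_real speed * u" unfolding m by simp
  finally show ?thesis .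
qed

definition step :: "complex \<times> complex \<Rightarrow> complex \<times> complex \<Rightarrow> bool" where
  "step e e' \<longleftrightarrow> (\<exists>s. turn s \<and> e' = (fst e + snd e, snd e * s))"

definition corner_of :: "complex \<times> complex \<Rightarrow> complex \<times> complex \<Rightarrow> complex \<times> complex \<times> complex" where
  "corner_of e e' = (fst e', snd e, snd e' / snd e)"

definition corners :: "(complex \<times> complex \<times> complex) set" where
  "corners = {(H, u, s). is_corner H u s}"

abbreviation "arcc \<equiv> \<lambda>(H, u, s). arc H u s"
abbreviation "lnkc \<equiv> \<lambda>(H, u, s). lnk H u s"

lemma corner_of_step:
  assumes "step e e'" "e \<in> edges"
  obtains s where "turn s" "e' = (fst e + snd e, snd e * s)" "corner_of e e' = (fst e + snd e, snd e, s)"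
    "is_corner (fst e + snd e) (snd e) s"
proof -
  obtain s where s: "turn s" "e' = (fst e + snd e, snd e * s)" using assms(1) unfolding step_def by blast
  have "(fst e, snd e) \<in> edges" using assms(2) by simp
  from edge_corner[OF this s(1)] have c: "is_corner (fst e + snd e) (snd e) s" .
  then have "corner_of e e' = (fst e + snd e, snd e, s)"
    using s(2) dirs_nz by (simp add: corner_of_def)
  then show thesis using that s c by blast
qed

end

text \<open>Edges are indexed periodically by all integers, so neighbours and inductions in both
  directions need no case for the place where the cycle closes.\<close>

locale hex_cycle = hexgrid +
  fixes E :: "int \<Rightarrow> complex \<times> complex" and n :: int
  assumes n_pos: "n > 0"
    and E_edges: "E i \<in> edges"
    and E_step: "step (E i) (E (i + 1))"
    and E_periodic: "E (i + n) = E i"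
    and E_inj: "E i = E j \<Longrightarrow> i mod n = j mod n"
begin

definition Hc :: "int \<Rightarrow> complex" where "Hc i = fst (E (i + 1))"
definition Uc :: "int \<Rightarrow> complex" where "Uc i = snd (E i)"
definition Sc :: "int \<Rightarrow> complex" where "Sc i = snd (E (i + 1)) / snd (E i)"

lemma corner_of_E: "corner_of (E i) (E (i + 1)) = (Hc i, Uc i, Sc i)"
  by (simp add: corner_of_def Hc_def Uc_def Sc_def)

lemma cyc_corner: "is_corner (Hc i) (Uc i) (Sc i)"
  and E_eq: "E i = (Hc i - Uc i, Uc i)"
  and E_next: "E (i + 1) = (Hc i, Uc i * Sc i)"
proof -
  obtain s where s: "E (i + 1) = (fst (E i) + snd (E i), snd (E i) * s)"
    "corner_of (E i) (E (i + 1)) = (fst (E i) + snd (E i), snd (E i), s)"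
    "is_corner (fst (E i) + snd (E i)) (snd (E i)) s"
    using corner_of_step[OF E_step E_edges] by blast
  then have e: "Hc i = fst (E i) + snd (E i)" "Uc i = snd (E i)" "Sc i = s"
    unfolding corner_of_E by auto
  show "is_corner (Hc i) (Uc i) (Sc i)" using s(3) e by simp
  show "E i = (Hc i - Uc i, Uc i)" using e by (simp add: prod_eq_iff)
  show "E (i + 1) = (Hc i, Uc i * Sc i)" using s(1) e by simp
qed

lemma Sc_turn: "turn (Sc i)"
  using cyc_corner by blast

lemma Uc_dirs: "Uc i \<in> dirs"
  using cyc_corner by blast

lemma Uc_Suc: "Uc (i + 1) = Uc i * Sc i"
  unfolding Uc_def[of "i + 1"] E_next by simp

lemma cyc_periodic: "Hc (i + n) = Hc i" "Uc (i + n) = Uc i" "Sc (i + n) = Sc i"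
  unfolding Hc_def Uc_def Sc_def using E_periodic[of i] E_periodic[of "i + 1"] by (simp_all add: add_ac)

lemma E_periodic_mult: "E (i + n * k) = E i"
proof (induction k rule: int_induct[where k = 0])
  case base then show ?case by simp
next
  case (step1 k) then show ?case using E_periodic[of "i + n * k"] by (simp add: algebra_simps)
next
  case (step2 k) then show ?case using E_periodic[of "i + n * (k - 1)"] by (simp add: algebra_simps)
qed

definition piece :: "int \<Rightarrow> real \<Rightarrow> complex" where
  "piece i t = vertex (Hc i) (Uc i) (Sc i) + radial (Uc i) (Sc i) / 2 * cis (ang (Sc i) * (t - of_int i))"

definition piece_vel :: "int \<Rightarrow> real \<Rightarrow> complex" where
  "piece_vel i t = of_real speed * Uc i * cis (ang (Sc i) * (t - of_int i))"

definition g :: "real \<Rightarrow> complex" where "g t = piece \<lfloor>t\<rfloor> t"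
definition g' :: "real \<Rightarrow> complex" where "g' t = piece_vel \<lfloor>t\<rfloor> t"

lemma piece_start: "piece i (of_int i) = mid (E i)"
  by (simp add: piece_def arc_param_ends(1)[OF Sc_turn] mid_def E_eq)

lemma piece_end: "piece i (of_int (i + 1)) = mid (E (i + 1))"
  using arc_param_ends(2)[OF Sc_turn, of "Hc i" "Uc i" i] turn_ang[OF Sc_turn, symmetric, of i]
  by (simp add: piece_def mid_def E_next)

lemma piece_match: "piece i (of_int (i + 1)) = piece (i + 1) (of_int (i + 1))"
  by (simp only: piece_start piece_end)

lemma piece_vel_match: "piece_vel i (of_int (i + 1)) = piece_vel (i + 1) (of_int (i + 1))"
  using turn_ang[OF Sc_turn, symmetric, of i] by (simp add: piece_vel_def Uc_Suc)

lemma cis_vector_derivative: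
  "((\<lambda>t. c + d * cis (a * (t - b))) has_vector_derivative (d * (\<i> * of_real a) * cis (a * (t - b)))) (at t within S)"
proof -
  have "((\<lambda>z. c + d * exp (\<i> * (of_real a * (z - of_real b)))) has_field_derivative
     d * (exp (\<i> * (of_real a * (of_real t - of_real b))) * (\<i> * of_real a))) (at (of_real t))"
    by (auto intro!: derivative_eq_intros)
  from has_vector_derivative_real_field[OF this, of S] show ?thesis
    by (simp add: cis_conv_exp mult_ac)
qed

lemma g_deriv: "(g has_vector_derivative g' t) (at t)"
proof -
  have "((\<lambda>t. piece \<lfloor>t\<rfloor> t) has_vector_derivative piece_vel \<lfloor>t\<rfloor> t) (at t)"
  proof (rule glue_derivative)
    fix i t
    have "piece_vel i t = radial (Uc i) (Sc i) / 2 * (\<i> * of_real (ang (Sc i))) *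
        cis (ang (Sc i) * (t - of_int i))"
      unfolding piece_vel_def radial_velocity[OF Sc_turn] ..
    then show "(piece i has_vector_derivative piece_vel i t) (at t within {of_int i..of_int (i + 1)})"
      unfolding piece_def by (simp only: cis_vector_derivative)
  qed (fact piece_match piece_vel_match)+
  then show ?thesis unfolding g_def g'_def .
qed

lemma g_vel_cont: "continuous_on UNIV g'"
proof -
  have "continuous_on UNIV (\<lambda>t. piece_vel \<lfloor>t\<rfloor> t)"
    by (rule glue_continuous) (auto simp: piece_vel_def piece_vel_match[unfolded piece_vel_def, simplified]
        intro!: continuous_intros)
  then show ?thesis unfolding g'_def .
qed

lemma g_cont: "continuous_on S g"
  using g_deriv by (meson continuous_at_imp_continuous_on has_vector_derivative_continuous)

lemma g_piece: "t \<in> {of_int i..of_int (i + 1)} \<Longrightarrow> g t = piece i t"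
  unfolding g_def by (rule glue_eq[of piece, OF piece_match])

lemma g'_piece: "t \<in> {of_int i..of_int (i + 1)} \<Longrightarrow> g' t = piece_vel i t"
  unfolding g'_def by (rule glue_eq[of piece_vel, OF piece_vel_match])

lemma g_periodic: "g (t + of_int n) = g t" and g'_periodic: "g' (t + of_int n) = g' t"
  by (simp_all add: g_def g'_def piece_def piece_vel_def cyc_periodic)

lemma g_periodic_mult: "g (t + of_int n * of_int k) = g t"
proof (induction k rule: int_induct[where k = 0])
  case base then show ?case by simp
next
  case (step1 k) then show ?case using g_periodic[of "t + of_int n * of_int k"] by (simp add: algebra_simps)
next
  case (step2 k) then show ?case using g_periodic[of "t + of_int n * of_int (k - 1)"] by (simp add: algebra_simps)
qed

lemma g'_nz: "g' t \<noteq> 0"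
  using speed_pos dirs_nz[OF Uc_dirs] by (simp add: g'_def piece_vel_def)

lemma g_open: "of_int i < t \<Longrightarrow> t < of_int (i + 1) \<Longrightarrow> g t \<in> open_arc (Hc i) (Uc i) (Sc i)"
  using open_arc_point[OF cyc_corner, of "t - of_int i" i] g_piece[of t i] by (simp add: piece_def)

lemma g_int: "g (of_int i) = mid (E i)"
  using g_piece[of "of_int i" i] by (simp add: piece_start)

text \<open>Integer parameters are sent to midpoints and all others to open links. Midpoints are not
  on open links, open links are disjoint, and on one link the angle determines the
  parameter.\<close>

lemma g_inj:
  assumes "g a = g b"
  obtains k where "a = b + of_int n * of_int k"
proof -
  define i j where "i = \<lfloor>a\<rfloor>" "j = \<lfloor>b\<rfloor>"
  have i: "of_int i \<le> a" "a < of_int (i + 1)" and j: "of_int j \<le> b" "b < of_int (j + 1)"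
    unfolding i_j_def by linarith+
  have finish: thesis if "E i = E j" "a - of_int i = b - of_int j"
  proof -
    have "n dvd i - j" using E_inj[OF that(1)] by (simp add: mod_eq_dvd_iff)
    then obtain k where "i - j = n * k" by (rule dvdE)
    then have "i = j + n * k" by simp
    then show thesis using that(2) \<open>\<And>k. a = b + of_int n * of_int k \<Longrightarrow> thesis\<close>[of k] by simp
  qed
  consider "a = of_int i" "b = of_int j" | "a = of_int i" "of_int j < b" | "of_int i < a" "b = of_int j"
    | "of_int i < a" "of_int j < b"
    using i j by linarith
  then show thesis
  proof cases
    case 1
    then have "E i = E j" using assms mid_inj[OF E_edges E_edges] by (simp add: g_int)
    then show thesis using 1 by (intro finish) auto
  next
    case 2
    then have "g b = mid (E i)" "g b \<in> open_arc (Hc j) (Uc j) (Sc j)"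
      using assms g_open[of j b] j g_int[of i] by simp_all
    then show thesis using mid_not_open_arc[OF E_edges cyc_corner, of i j] by simp
  next
    case 3
    then have "g a = mid (E j)" "g a \<in> open_arc (Hc i) (Uc i) (Sc i)"
      using assms g_open[of i a] i g_int[of j] by simp_all
    then show thesis using mid_not_open_arc[OF E_edges cyc_corner, of j i] by simp
  next
    case 4
    have o: "g a \<in> open_arc (Hc i) (Uc i) (Sc i)" "g a \<in> open_arc (Hc j) (Uc j) (Sc j)"
      using g_open[of i a] g_open[of j b] assms 4 i j by auto
    then have eq: "Hc j = Hc i \<and> Uc j = Uc i \<and> Sc j = Sc i"
      using open_arc_disjoint[OF cyc_corner cyc_corner] open_arc_arc by blast
    then have E: "E i = E j" by (simp add: E_eq)
    have nz: "radial (Uc i) (Sc i) \<noteq> 0" using radial_nz cyc_corner by blast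
    have "piece i a = piece j b" using assms g_piece[of a i] g_piece[of b j] i j by simp
    then have c: "cis (ang (Sc i) * (a - of_int i)) = cis (ang (Sc i) * (b - of_int j))"
      using eq nz by (simp add: piece_def)
    \<comment> \<open>The angles stay in the principal range, so \<open>Arg\<close> recovers them
      from their \<open>cis\<close>.\<close>
    have rng: "- pi < ang (Sc i) * x \<and> ang (Sc i) * x \<le> pi" if "0 \<le> x" "x < 1" for x
    proof -
      have "\<bar>ang (Sc i) * x\<bar> \<le> 2 * pi / 3 * 1"
      proof -
        have "\<bar>ang (Sc i)\<bar> = 2 * pi / 3" by (simp add: ang_def)
        then show ?thesis unfolding abs_mult using that by (intro mult_mono) auto
      qed
      moreover have "2 * pi / 3 * 1 < pi" by simp
      ultimately show ?thesis unfolding abs_le_iff by linarith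
    qed
    have "ang (Sc i) * (a - of_int i) = ang (Sc i) * (b - of_int j)"
      using arg_cong[OF c, of Arg] rng[of "a - of_int i"] rng[of "b - of_int j"] i j by (simp add: Arg_cis)
    then have "a - of_int i = b - of_int j" using ang_cases[of "Sc i"] by auto
    then show thesis using finish E by blast
  qed
qed

definition cyc_corners :: "(complex \<times> complex \<times> complex) set" where
  "cyc_corners = range (\<lambda>i. (Hc i, Uc i, Sc i))"

lemma cyc_mod: "Hc (i mod n) = Hc i" "Uc (i mod n) = Uc i" "Sc (i mod n) = Sc i"
proof -
  have m: "i mod n = i + n * (- (i div n))" "i mod n + 1 = (i + 1) + n * (- (i div n))"
    by (simp_all add: minus_mult_div_eq_mod[symmetric])
  have "E (i mod n) = E i" unfolding m(1) by (rule E_periodic_mult)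
  moreover have "E (i mod n + 1) = E (i + 1)" unfolding m(2) by (rule E_periodic_mult)
  ultimately show "Hc (i mod n) = Hc i" "Uc (i mod n) = Uc i" "Sc (i mod n) = Sc i"
    by (simp_all add: Hc_def Uc_def Sc_def)
qed

lemma cyc_corners_eq: "cyc_corners = (\<lambda>i. (Hc i, Uc i, Sc i)) ` {0..<n}"
proof -
  have "(Hc i, Uc i, Sc i) \<in> (\<lambda>i. (Hc i, Uc i, Sc i)) ` {0..<n}" for i
    using n_pos cyc_mod[of i] by (intro image_eqI[of _ _ "i mod n"]) auto
  then show ?thesis unfolding cyc_corners_def by blast
qed

lemma finite_cyc_corners: "finite cyc_corners"
  unfolding cyc_corners_eq by simp

definition curve :: "complex set" where
  "curve = (\<Union>c\<in>cyc_corners. arcc c)"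

lemma g_image_piece: "g ` {of_int i..of_int (i + 1)} = arc (Hc i) (Uc i) (Sc i)"
proof -
  have "g ` {of_int i..of_int (i + 1)} = piece i ` {of_int i..of_int (i + 1)}"
    using g_piece by (intro image_cong) auto
  also have "\<dots> = piece i ` (\<lambda>\<tau>. \<tau> + of_int i) ` {0..1}"
    by (simp add: image_add_atLeastAtMost' add.commute)
  also have "\<dots> = arc (Hc i) (Uc i) (Sc i)"
    unfolding image_image arc_param[OF Sc_turn] piece_def by simp
  finally show ?thesis .
qed

lemma curve_range: "curve = range g"
proof -
  have "t \<in> {of_int \<lfloor>t\<rfloor>..of_int (\<lfloor>t\<rfloor> + 1)}" for t :: real by simp
  then have "range g = (\<Union>i. g ` {of_int i..of_int (i + 1)})" by blast
  then show ?thesis unfolding curve_def cyc_corners_def g_image_piece by simp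
qed

lemma range_period: "range g = g ` {a..a + of_int n}"
proof -
  have "g t \<in> g ` {a..a + of_int n}" for t
  proof -
    define k where "k = \<lfloor>(t - a) / of_int n\<rfloor>"
    have n: "(of_int n :: real) > 0" using n_pos by simp
    have "of_int k \<le> (t - a) / of_int n" "(t - a) / of_int n < of_int k + 1"
      unfolding k_def by linarith+
    then have "of_int k * of_int n \<le> t - a" "t - a < (of_int k + 1) * of_int n"
      using n by (simp_all add: field_simps)
    then have "t + of_int n * of_int (- k) \<in> {a..a + of_int n}" by (simp add: algebra_simps)
    from imageI[OF this, of g] show ?thesis unfolding g_periodic_mult .
  qed
  then show ?thesis by blast
qed

definition loop :: "real \<Rightarrow> complex" where "loop x = g (of_int n * x)"

lemma loop_deriv: "(loop has_vector_derivative of_int n * g' (of_int n * x)) (at x)"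
proof -
  have "((g \<circ> (\<lambda>x. of_int n * x)) has_vector_derivative of_int n *\<^sub>R g' (of_int n * x)) (at x)"
    by (rule vector_diff_chain_at) (auto intro!: derivative_eq_intros g_deriv)
  then show ?thesis unfolding loop_def[abs_def] by (simp add: o_def scaleR_conv_of_real)
qed

lemma loop_simple: "simple_path loop" "pathfinish loop = pathstart loop" "path_image loop = curve"
proof -
  have n: "(of_int n :: real) > 0" using n_pos by simp
  show "pathfinish loop = pathstart loop"
    using g_periodic[of 0] by (simp add: pathfinish_def pathstart_def loop_def)
  have "(\<lambda>x. of_int n * x) ` {0..1::real} = {0..0 + of_int n}"
    using image_mult_atLeastAtMost[OF n, of 0 1] by simp
  then have "g ` (\<lambda>x. of_int n * x) ` {0..1} = range g" unfolding range_period[of 0] by (rule arg_cong)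
  then show "path_image loop = curve"
    unfolding path_image_def loop_def curve_range image_image .
  have "continuous_on {0..1} loop"
    using loop_deriv by (meson continuous_at_imp_continuous_on has_vector_derivative_continuous)
  moreover have "x = y \<or> x = 0 \<and> y = 1 \<or> x = 1 \<and> y = 0"
    if xy: "x \<in> {0..1}" "y \<in> {0..1}" "loop x = loop y" for x y
  proof -
    obtain k where "of_int n * x = of_int n * y + of_int n * of_int k"
      using g_inj xy(3) unfolding loop_def by blast
    then have "of_int n * x = of_int n * (y + of_int k)" by (simp only: distrib_left)
    then have k: "x = y + of_int k" using n by simp
    then have "k \<in> {-1, 0, 1}" using xy(1,2) by (auto simp: abs_le_iff)
    then show ?thesis using k xy by auto
  qed
  ultimately show "simple_path loop"
    unfolding simple_path_def loop_free_def path_def by blast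
qed

lemma curve_smooth: "smooth_simple_closed_curve curve"
proof -
  have vd: "vector_derivative loop (at x) = of_int n * g' (of_int n * x)" for x
    using loop_deriv by (rule vector_derivative_at)
  have "continuous_on {0..1} (\<lambda>x. of_int n * g' (of_int n * x))"
    by (intro continuous_intros continuous_on_compose2[OF g_vel_cont]) auto
  then have "loop C1_differentiable_on {0..1}"
    unfolding C1_differentiable_on_def using loop_deriv
    by (intro exI[of _ "\<lambda>x. of_int n * g' (of_int n * x)"]) simp
  moreover have "vector_derivative loop (at 0) = vector_derivative loop (at 1)"
    unfolding vd using g'_periodic[of 0] by simp
  ultimately show ?thesis
    unfolding smooth_simple_closed_curve_def using loop_simple n_pos g'_nz
    by (intro exI[of _ loop]) (simp add: vd)
qed

lemma curve_tangle: "hexagonal_tangle r vertices curve"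
proof -
  have "curve = (\<Union>L\<in>lnkc ` cyc_corners. link_arc L)"
    unfolding curve_def cyc_corners_def using link_arc_lnk[OF Sc_turn] by auto
  moreover have "\<forall>L\<in>lnkc ` cyc_corners. is_link r vertices L"
    unfolding cyc_corners_def using is_link_lnk[OF cyc_corner] by auto
  ultimately show ?thesis
    unfolding hexagonal_tangle_def using curve_smooth finite_cyc_corners by blast
qed

lemma cyc_corners_corners: "cyc_corners \<subseteq> corners"
  unfolding cyc_corners_def corners_def using cyc_corner by auto

lemma open_arc_in_curve:
  assumes "is_corner H u s" "z \<in> open_arc H u s" "z \<in> curve"
  shows "(H, u, s) \<in> cyc_corners"
proof -
  obtain H' u' s' where c: "(H', u', s') \<in> cyc_corners" "z \<in> arc H' u' s'"
    using assms(3) unfolding curve_def by auto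
  then have "is_corner H' u' s'" using cyc_corners_corners by (auto simp: corners_def)
  from open_arc_disjoint[OF assms(1) this assms(2) c(2)] c(1) show ?thesis by simp
qed

text \<open>A single interior point of a link, here its middle, identifies the link among those of
  the curve.\<close>

lemma links_of_curve: "links_of r vertices curve = lnkc ` cyc_corners"
proof (intro equalityI subsetI)
  fix L assume "L \<in> links_of r vertices curve"
  then have L: "is_link r vertices L" "link_arc L \<subseteq> curve" by (auto simp: links_of_def)
  obtain H u s where c: "is_corner H u s" "L = lnk H u s" using is_link_cases[OF L(1)] .
  have "pt H u s (1/2) (1/2) \<in> curve"
    using L(2) open_arc_nonempty open_arc_arc link_arc_lnk c by blast
  then have "(H, u, s) \<in> cyc_corners" using open_arc_in_curve[OF c(1) open_arc_nonempty] by blast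
  then show "L \<in> lnkc ` cyc_corners" using c(2) by force
next
  fix L assume "L \<in> lnkc ` cyc_corners"
  then obtain i where "L = lnk (Hc i) (Uc i) (Sc i)" unfolding cyc_corners_def by auto
  moreover have "arc (Hc i) (Uc i) (Sc i) \<subseteq> curve" unfolding curve_def cyc_corners_def by auto
  ultimately show "L \<in> links_of r vertices curve"
    using is_link_lnk[OF cyc_corner] link_arc_lnk[OF Sc_turn] by (auto simp: links_of_def)
qed

end

section \<open>Hopf's theorem on turning tangents\<close>

lemma exp_eq_1_dist:
  fixes z w :: complex
  assumes "exp z = 1" "exp w = 1" "z \<noteq> w"
  shows "2 * pi \<le> norm (z - w)"
proof -
  have "exp (z - w) = 1" using assms by (simp add: exp_diff)
  then obtain k :: int where k: "Re (z - w) = 0" "Im (z - w) = of_int (2 * k) * pi"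
    unfolding exp_eq_1 by blast
  then have "k \<noteq> 0" using assms(3) by (auto simp: complex_eq_iff)
  then have "1 \<le> \<bar>real_of_int k\<bar>" by linarith
  then have "2 * pi * 1 \<le> 2 * pi * \<bar>real_of_int k\<bar>" by (intro mult_left_mono) auto
  then have "2 * pi \<le> \<bar>Im (z - w)\<bar>" unfolding k by (simp add: abs_mult)
  then show ?thesis using abs_Im_le_cmod[of "z - w"] by linarith
qed

text \<open>Two continuous logarithms of one function differ by values in a discrete set, hence by a
  constant.\<close>

lemma log_lift_unique:
  fixes \<phi> \<psi> :: "real \<Rightarrow> complex"
  assumes "continuous_on {a..b} \<phi>" "continuous_on {a..b} \<psi>" "a \<le> b"
    and "\<And>t. t \<in> {a..b} \<Longrightarrow> exp (\<phi> t) = exp (\<psi> t)"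
  shows "\<phi> b - \<phi> a = \<psi> b - \<psi> a"
proof -
  have 1: "exp (\<phi> t - \<psi> t) = 1" if "t \<in> {a..b}" for t
    using assms(4)[OF that] by (simp add: exp_diff)
  have "(\<lambda>t. \<phi> t - \<psi> t) constant_on {a..b}"
  proof (rule continuous_discrete_range_constant)
    show "\<exists>e>0. \<forall>y. y \<in> {a..b} \<and> \<phi> y - \<psi> y \<noteq> \<phi> x - \<psi> x \<longrightarrow> e \<le> norm (\<phi> y - \<psi> y - (\<phi> x - \<psi> x))"
      if "x \<in> {a..b}" for x
      using exp_eq_1_dist[OF 1 1[OF that]] by (intro exI[of _ "2 * pi"]) auto
  qed (use assms in \<open>auto intro!: continuous_intros\<close>)
  then obtain c where c: "\<And>t. t \<in> {a..b} \<Longrightarrow> \<phi> t - \<psi> t = c" unfolding constant_on_def by blast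
  have "\<phi> a - \<psi> a = \<phi> b - \<psi> b" using c[of a] c[of b] assms(3) by simp
  then show ?thesis by (simp add: algebra_simps)
qed

lemma half_plane_Ln:
  assumes "Re z \<ge> 0" "z \<noteq> 0"
  shows "z \<notin> \<real>\<^sub>\<le>\<^sub>0"
  using assms by (auto simp: complex_nonpos_Reals_iff complex_eq_iff)

text \<open>On the closed right half-plane without 0 the principal logarithm is continuous, so the
  change of any continuous logarithm can be read off at the end points.\<close>

lemma log_half_plane:
  fixes \<phi> f :: "real \<Rightarrow> complex"
  assumes "continuous_on {a..b} \<phi>" "continuous_on {a..b} f" "a \<le> b"
    and "\<And>t. t \<in> {a..b} \<Longrightarrow> exp (\<phi> t) = f t" "\<And>t. t \<in> {a..b} \<Longrightarrow> Re (f t) \<ge> 0"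
    and "\<And>t. t \<in> {a..b} \<Longrightarrow> f t \<noteq> 0"
  shows "\<phi> b - \<phi> a = Ln (f b) - Ln (f a)"
proof (rule log_lift_unique[OF assms(1) _ assms(3)])
  show "continuous_on {a..b} (\<lambda>t. Ln (f t))"
    using assms half_plane_Ln by (intro continuous_intros) auto
  show "exp (\<phi> t) = exp (Ln (f t))" if "t \<in> {a..b}" for t
    using assms(4,6)[OF that] by simp
qed

lemma Ln_imaginary:
  assumes "c > 0" "\<sigma> = 1 \<or> \<sigma> = - 1"
  shows "Ln (\<i> * of_real \<sigma> * of_real c) = of_real (ln c) + \<i> * of_real (\<sigma> * pi / 2)"
proof -
  have s: "sin (\<sigma> * pi / 2) = \<sigma>" "cos (\<sigma> * pi / 2) = 0" using assms(2) by auto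
  have "exp (of_real (ln c) + \<i> * of_real (\<sigma> * pi / 2)) = \<i> * of_real \<sigma> * of_real c"
    using assms(1) s by (auto simp: complex_eq_iff Re_exp Im_exp exp_add)
  then have "Ln (\<i> * of_real \<sigma> * of_real c) = Ln (exp (of_real (ln c) + \<i> * of_real (\<sigma> * pi / 2)))" by simp
  also have "\<dots> = of_real (ln c) + \<i> * of_real (\<sigma> * pi / 2)"
    using assms(2) by (intro Ln_exp) auto
  finally show ?thesis .
qed

text \<open>For \<open>0 < t - s < N\<close> the integrals below are the secant slopes over \<open>[s, t]\<close> and \<open>[s, t - N]\<close>,
  so f is a positive multiple of \<open>G t - G s\<close>; on the boundary of the triangle of pairs \<open>s \<le> t\<close> it
  becomes the tangent at \<open>t = s\<close> and the negative of the tangent at \<open>t = s + N\<close>. Being continuous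
  and nonzero on the triangle, f has a logarithm there.\<close>

theorem turning_tangents:
  fixes G G' :: "real \<Rightarrow> complex" and N t0 c \<sigma> :: real
  assumes N: "N > 0"
    and der: "\<And>t. (G has_vector_derivative G' t) (at t)"
    and cont: "continuous_on UNIV G'"
    and nz: "\<And>t. G' t \<noteq> 0"
    and per: "\<And>t. G (t + N) = G t" "\<And>t. G' (t + N) = G' t"
    and inj: "\<And>s t. s < t \<Longrightarrow> t < s + N \<Longrightarrow> G s \<noteq> G t"
    and low: "\<And>t. Re (G t0) \<le> Re (G t)"
    and dir: "G' t0 = - \<i> * of_real \<sigma> * of_real c" "c > 0" "\<sigma> = 1 \<or> \<sigma> = - 1"
  obtains \<phi> where "continuous_on {t0..t0 + N} \<phi>" "\<And>t. t \<in> {t0..t0 + N} \<Longrightarrow> exp (\<phi> t) = G' t"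
    "\<phi> (t0 + N) - \<phi> t0 = 2 * pi * \<i> * of_real \<sigma>"
proof -
  define h where "h = (\<lambda>p::real \<times> real. integral (cbox 0 1) (\<lambda>x. G' (fst p + x * (snd p - fst p))))"
  define f where "f = (\<lambda>p. h p - h (fst p, snd p - N))"
  have hc: "continuous_on UNIV h"
    unfolding h_def
    by (rule integral_continuous_on_param)
      (auto simp: case_prod_beta intro!: continuous_intros continuous_on_compose2[OF cont])
  have fc: "continuous_on S f" for S
    unfolding f_def
    by (intro continuous_intros continuous_on_subset[OF hc] continuous_on_compose2[OF hc]) auto
  have h: "(t - s) * h (s, t) = G t - G s" for s t
  proof -
    have "((\<lambda>x. G (s + x * (t - s))) has_vector_derivative (t - s) *\<^sub>R G' (s + x * (t - s))) (at x within {0..1})" for x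
    proof -
      have "((G \<circ> (\<lambda>x. s + x * (t - s))) has_vector_derivative (t - s) *\<^sub>R G' (s + x * (t - s))) (at x within {0..1})"
        by (rule vector_diff_chain_within)
          (auto intro!: derivative_eq_intros has_vector_derivative_at_within[OF der])
      then show ?thesis by (simp add: o_def)
    qed
    then have "((\<lambda>x. (t - s) *\<^sub>R G' (s + x * (t - s))) has_integral (G (s + 1 * (t - s)) - G (s + 0 * (t - s)))) {0..1}"
      by (intro fundamental_theorem_of_calculus) auto
    from integral_unique[OF this] show ?thesis by (simp add: h_def scaleR_conv_of_real)
  qed
  have hd: "h (s, s) = G' s" for s by (simp add: h_def)
  have hN: "h (s, s + N) = 0" "h (s, s - N) = 0" for s
    using h[of "s + N" s] h[of "s - N" s] per(1)[of s] per(1)[of "s - N"] N by simp_all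
  have f0: "f (s, s) = G' s" for s by (simp add: f_def hd hN)
  have fN: "f (s, s + N) = - G' s" for s by (simp add: f_def hd hN)
  have f1: "f (s, t) = of_real (N / ((t - s) * (N - (t - s)))) * (G t - G s)" if "s < t" "t < s + N" for s t
  proof -
    have a: "h (s, t) = of_real (1 / (t - s)) * (G t - G s)"
      using h[of t s] that by (simp add: field_simps flip: of_real_diff)
    have "of_real (N - (t - s)) * (- h (s, t - N)) = of_real (t - N - s) * h (s, t - N)"
      by (simp add: algebra_simps)
    also have "\<dots> = G t - G s" using h[of "t - N" s] per(1)[of "t - N"] by simp
    finally have "of_real (1 / (N - (t - s))) * (of_real (N - (t - s)) * (- h (s, t - N))) =
      of_real (1 / (N - (t - s))) * (G t - G s)" by (rule arg_cong)
    moreover have "1 / (N - (t - s)) * (N - (t - s)) = 1" using that by simp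
    ultimately have b: "- h (s, t - N) = of_real (1 / (N - (t - s))) * (G t - G s)"
      unfolding mult.assoc[symmetric] of_real_mult[symmetric] by simp
    have "f (s, t) = h (s, t) + (- h (s, t - N))" by (simp add: f_def)
    also have "\<dots> = of_real (1 / (t - s) + 1 / (N - (t - s))) * (G t - G s)"
      unfolding a b by (simp add: distrib_right)
    also have "1 / (t - s) + 1 / (N - (t - s)) = N / ((t - s) * (N - (t - s)))"
      using that by (simp add: field_simps)
    finally show ?thesis .
  qed
  have f1R: "Re (f (s, t)) = N / ((t - s) * (N - (t - s))) * (Re (G t) - Re (G s))"
    if "s < t" "t < s + N" for s t
    unfolding f1[OF that] times_complex.sel Re_complex_of_real Im_complex_of_real
    by (simp only: mult_zero_left diff_zero minus_complex.sel)
  have pos: "N / ((t - s) * (N - (t - s))) > 0" if "s < t" "t < s + N" for s t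
    using that N by simp
  define T where "T = {p::real \<times> real. t0 \<le> fst p \<and> fst p \<le> snd p \<and> snd p \<le> t0 + N}"
  have fnz: "f p \<noteq> 0" if "p \<in> T" for p
  proof -
    obtain s t where p: "p = (s, t)" by force
    have "s \<le> t" "t \<le> s + N" using that by (auto simp: T_def p)
    then consider "t = s" | "s < t" "t < s + N" | "t = s + N" by linarith
    then show ?thesis
    proof cases
      case 1 then show ?thesis by (simp add: p f0 nz)
    next
      case 2
      have "of_real (N / ((t - s) * (N - (t - s)))) \<noteq> (0 :: complex)"
        using pos[OF 2] unfolding of_real_eq_0_iff by linarith
      then show ?thesis using inj[OF 2] unfolding p f1[OF 2] mult_eq_0_iff by simp
    next
      case 3 then show ?thesis by (simp add: p fN nz)
    qed
  qed
  have "convex T"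
  proof (rule convexI)
    fix x y :: "real \<times> real" and a b :: real
    assume xy: "x \<in> T" "y \<in> T" and ab: "0 \<le> a" "0 \<le> b" "a + b = 1"
    have q: "a * q + b * q = q" for q using ab(3) by (metis distrib_right mult_1)
    have "a * t0 + b * t0 \<le> a * fst x + b * fst y" "a * fst x + b * fst y \<le> a * snd x + b * snd y"
      "a * snd x + b * snd y \<le> a * (t0 + N) + b * (t0 + N)"
      using xy ab unfolding T_def by (auto intro!: add_mono mult_left_mono)
    then show "a *\<^sub>R x + b *\<^sub>R y \<in> T" unfolding q T_def by simp
  qed
  then obtain L where L: "continuous_on T L" "\<And>p. p \<in> T \<Longrightarrow> f p = exp (L p)"
    using continuous_logarithm_on_contractible[OF fc convex_imp_contractible fnz] by blast
  have Lc: "continuous_on S (\<lambda>t. L (a t, b t))"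
    if "continuous_on S a" "continuous_on S b" "\<And>t. t \<in> S \<Longrightarrow> (a t, b t) \<in> T" for a b :: "real \<Rightarrow> real" and S
    by (rule continuous_on_compose2[OF L(1) continuous_on_Pair]) (use that in auto)
  have fc': "continuous_on S (\<lambda>t. f (a t, b t))"
    if "continuous_on S a" "continuous_on S b" for a b :: "real \<Rightarrow> real" and S
    by (rule continuous_on_compose2[OF fc[of UNIV] continuous_on_Pair]) (use that in auto)
  have LnD: "Ln (\<i> * of_real \<sigma> * of_real c) - Ln (- \<i> * of_real \<sigma> * of_real c) = pi * \<i> * of_real \<sigma>"
  proof -
    have "- \<sigma> = 1 \<or> - \<sigma> = - 1" using dir(3) by auto
    from Ln_imaginary[OF dir(2) this] have "Ln (- \<i> * of_real \<sigma> * of_real c) = of_real (ln c) - \<i> * of_real (\<sigma> * pi / 2)"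
      by simp
    then show ?thesis unfolding Ln_imaginary[OF dir(2,3)] by (simp add: complex_eq_iff)
  qed
  \<comment> \<open>With the first parameter fixed at \<open>t0\<close>, \<open>f\<close> points
    from the leftmost point of the curve to the others and stays in the right half-plane, between
    two opposite vertical directions: half a turn.\<close>
  have E1: "L (t0, t0 + N) - L (t0, t0) = pi * \<i> * of_real \<sigma>"
  proof -
    have "L (t0, t0 + N) - L (t0, t0) = Ln (f (t0, t0 + N)) - Ln (f (t0, t0))"
    proof (rule log_half_plane[where \<phi> = "\<lambda>t. L (t0, t)" and f = "\<lambda>t. f (t0, t)"])
      show "Re (f (t0, t)) \<ge> 0" if "t \<in> {t0..t0 + N}" for t
      proof -
        have "t0 \<le> t" "t \<le> t0 + N" using that by auto
        then consider "t = t0" | "t0 < t" "t < t0 + N" | "t = t0 + N" by linarith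
        then show ?thesis
        proof cases
          case 2
          show ?thesis unfolding f1R[OF 2] using less_imp_le[OF pos[OF 2]] low[of t]
            by (intro mult_nonneg_nonneg) auto
        qed (simp_all add: f0 fN dir)
      qed
    next
      fix t assume "t \<in> {t0..t0 + N}"
      then have "(t0, t) \<in> T" by (simp add: T_def)
      then show "exp (L (t0, t)) = f (t0, t)" "f (t0, t) \<noteq> 0" using L(2) fnz by simp_all
    next
      show "continuous_on {t0..t0 + N} (\<lambda>t. L (t0, t))"
        by (rule Lc) (auto simp: T_def intro!: continuous_intros)
      show "continuous_on {t0..t0 + N} (\<lambda>t. f (t0, t))"
        by (rule fc') (auto intro!: continuous_intros)
    qed (use N in simp)
    then show ?thesis using LnD by (simp add: f0 fN dir)
  qed
  \<comment> \<open>With the second parameter fixed at \<open>t0 + N\<close>, \<open>f\<close>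
    points towards the leftmost point. Its negative lies in the right half-plane, and adding i \<pi>
    makes \<open>L\<close> a logarithm of that negative.\<close>
  have E2: "L (t0 + N, t0 + N) - L (t0, t0 + N) = pi * \<i> * of_real \<sigma>"
  proof -
    have "(L (t0 + N, t0 + N) + \<i> * pi) - (L (t0, t0 + N) + \<i> * pi) = Ln (- f (t0 + N, t0 + N)) - Ln (- f (t0, t0 + N))"
    proof (rule log_half_plane[where \<phi> = "\<lambda>s. L (s, t0 + N) + \<i> * pi" and f = "\<lambda>s. - f (s, t0 + N)"])
      show "Re (- f (s, t0 + N)) \<ge> 0" if "s \<in> {t0..t0 + N}" for s
      proof -
        have "t0 \<le> s" "s \<le> t0 + N" using that by auto
        then consider "s = t0" | "s < t0 + N" "t0 + N < s + N" | "s = t0 + N" by linarith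
        then show ?thesis
        proof cases
          case 2
          show ?thesis unfolding uminus_complex.sel f1R[OF 2] neg_0_le_iff_le per(1)
            using less_imp_le[OF pos[OF 2]] low[of s] by (intro mult_nonneg_nonpos) auto
        next
          case 3 then show ?thesis by (simp add: f0 per dir)
        qed (simp_all add: f0 fN dir)
      qed
    next
      fix s assume "s \<in> {t0..t0 + N}"
      then have "(s, t0 + N) \<in> T" by (simp add: T_def)
      then have "exp (L (s, t0 + N)) = f (s, t0 + N)" "f (s, t0 + N) \<noteq> 0" using L(2) fnz by simp_all
      then show "exp (L (s, t0 + N) + \<i> * pi) = - f (s, t0 + N)" "- f (s, t0 + N) \<noteq> 0"
        by (simp_all add: exp_add mult.commute)
    next
      show "continuous_on {t0..t0 + N} (\<lambda>s. L (s, t0 + N) + \<i> * pi)"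
        by (intro continuous_on_add Lc) (auto simp: T_def intro!: continuous_intros)
      show "continuous_on {t0..t0 + N} (\<lambda>s. - f (s, t0 + N))"
        by (intro continuous_on_minus fc') (auto intro!: continuous_intros)
    qed (use N in simp)
    then show ?thesis using LnD by (simp add: f0 fN dir per)
  qed
  show thesis
  proof (rule that[of "\<lambda>t. L (t, t)"])
    show "continuous_on {t0..t0 + N} (\<lambda>t. L (t, t))"
      by (rule Lc) (auto simp: T_def intro!: continuous_intros)
    show "exp (L (t, t)) = G' t" if "t \<in> {t0..t0 + N}" for t
      using L(2)[of "(t, t)"] that by (simp add: T_def f0)
    \<comment> \<open>\<open>L\<close> is single-valued on the triangle, so its change along the
      diagonal, where \<open>f\<close> is the tangent, is the sum of its changes along the two
      legs.\<close>
    have "L (t0 + N, t0 + N) - L (t0, t0) = pi * \<i> * of_real \<sigma> + pi * \<i> * of_real \<sigma>"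
      using arg_cong2[OF E1 E2, of "(+)"] by simp
    then show "L (t0 + N, t0 + N) - L (t0, t0) = 2 * pi * \<i> * of_real \<sigma>" by (simp add: algebra_simps)
  qed
qed

section \<open>The explicit argument of the velocity\<close>

context hex_cycle
begin

text \<open>The accumulated turning angle at the start of link \<open>i\<close>, as an oriented sum:
  at least one of the two ranges is always empty.\<close>

definition heading :: "int \<Rightarrow> real" where
  "heading i = (\<Sum>k\<in>{0..<i}. ang (Sc k)) - (\<Sum>k\<in>{i..<0}. ang (Sc k))"

lemma heading_Suc: "heading (i + 1) = heading i + ang (Sc i)"
proof (cases "i \<ge> 0")
  case True
  then have "{0..<i + 1} = insert i {0..<i}" "{i + 1..<0} = {}" "{i..<0} = {}" by auto
  then show ?thesis by (simp add: heading_def)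
next
  case False
  then have "{i..<0} = insert i {i + 1..<0}" "{0..<i + 1} = {}" "{0..<i} = {}" by auto
  then show ?thesis by (simp add: heading_def)
qed

lemma heading_periodic: "heading (i + n) = heading i + (\<Sum>k\<in>{0..<n}. ang (Sc k))"
proof (induction i rule: int_induct[where k = 0])
  case base
  have "{n..<0} = {}" using n_pos by auto
  then show ?case by (simp add: heading_def)
next
  case (step1 i)
  have "heading (i + 1 + n) = heading (i + n + 1)" by (simp add: add_ac)
  then show ?case using step1 unfolding heading_Suc cyc_periodic by simp
next
  case (step2 i)
  have "heading (i + n) = heading (i - 1 + n) + ang (Sc (i - 1))"
    using heading_Suc[of "i - 1 + n"] cyc_periodic(3)[of "i - 1"] by simp
  moreover have "heading i = heading (i - 1) + ang (Sc (i - 1))" using heading_Suc[of "i - 1"] by simp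
  ultimately show ?case using step2 by simp
qed

lemma Uc_heading: "Uc i = Uc 0 * cis (heading i)"
proof (induction i rule: int_induct[where k = 0])
  case base
  then show ?case by (simp add: heading_def)
next
  case (step1 i)
  have "Uc (i + 1) = Uc 0 * (cis (heading i) * cis (ang (Sc i)))"
    using step1 Uc_Suc[of i] turn_ang[OF Sc_turn[of i]] by (metis mult.assoc)
  then show ?case by (simp add: heading_Suc cis_mult)
next
  case (step2 i)
  have "Uc i = Uc (i - 1) * cis (ang (Sc (i - 1)))"
    using Uc_Suc[of "i - 1"] turn_ang[OF Sc_turn[of "i - 1"]] by (metis diff_add_cancel)
  then have "Uc (i - 1) * cis (ang (Sc (i - 1))) = Uc 0 * cis (heading (i - 1)) * cis (ang (Sc (i - 1)))"
    using step2 heading_Suc[of "i - 1"] by (simp add: cis_mult[symmetric] mult.assoc)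
  then show ?case by simp
qed

text \<open>On a link the velocity rotates uniformly, so linear interpolation of the headings is a
  continuous argument of the velocity relative to its value at 0.\<close>

definition angle :: "real \<Rightarrow> real" where
  "angle t = heading \<lfloor>t\<rfloor> + ang (Sc \<lfloor>t\<rfloor>) * (t - of_int \<lfloor>t\<rfloor>)"

lemma angle_cont: "continuous_on S angle"
proof -
  have "continuous_on UNIV (\<lambda>t. (\<lambda>i t. heading i + ang (Sc i) * (t - of_int i)) \<lfloor>t\<rfloor> t)"
    by (rule glue_continuous) (auto simp: heading_Suc intro!: continuous_intros)
  then show ?thesis unfolding angle_def[abs_def] by (rule continuous_on_subset) simp
qed

lemma angle_periodic: "angle (t + of_int n) = angle t + (\<Sum>k\<in>{0..<n}. ang (Sc k))"
  by (simp add: angle_def heading_periodic cyc_periodic)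

lemma g'_angle: "g' t = of_real speed * Uc 0 * cis (angle t)"
  unfolding g'_def piece_vel_def angle_def Uc_heading[of "\<lfloor>t\<rfloor>"] by (simp add: cis_mult[symmetric] mult.assoc)

end

context hexgrid
begin

section \<open>Separation by links\<close>

lemma kite_open:
  assumes "u \<in> dirs" "turn s"
  shows "open (kite H u s)"
proof -
  define \<zeta> where "\<zeta> = (\<lambda>z. (z - vertex H u s) / radial u s)"
  define y where "y = (\<lambda>z. Im (\<zeta> z) / Im s)"
  define x where "x = (\<lambda>z. Re (\<zeta> z) - y z * Re s)"
  have nz: "Im s \<noteq> 0" "radial u s \<noteq> 0" using turn_Im_nz radial_nz assms by auto
  have z: "pt H u s (x z) (y z) = z" for z
  proof -
    have "\<zeta> z = of_real (x z) + of_real (y z) * s"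
      using nz by (simp add: complex_eq_iff x_def y_def)
    then have "pt H u s (x z) (y z) = vertex H u s + radial u s * \<zeta> z"
      unfolding pt_radial[OF assms(2)] by simp
    then show ?thesis using nz by (simp add: \<zeta>_def)
  qed
  have "z \<in> kite H u s \<longleftrightarrow> 0 < x z \<and> 0 < y z \<and> 2 * x z - y z < 1 \<and> 2 * y z - x z < 1" for z
  proof
    assume "z \<in> kite H u s"
    then obtain a b where ab: "z = pt H u s a b" "0 < a \<and> 0 < b \<and> 2 * a - b < 1 \<and> 2 * b - a < 1"
      unfolding kite_def by blast
    have "x z = a \<and> y z = b" 
      using pt_inj[OF assms, of H "x z" "y z" a b] z[of z] ab(1) by simp
    then show "0 < x z \<and> 0 < y z \<and> 2 * x z - y z < 1 \<and> 2 * y z - x z < 1" using ab(2) by simp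
  next
    assume "0 < x z \<and> 0 < y z \<and> 2 * x z - y z < 1 \<and> 2 * y z - x z < 1"
    then show "z \<in> kite H u s" unfolding kite_def using z[of z, symmetric] by blast
  qed
  then have "kite H u s = {z. 0 < x z} \<inter> {z. 0 < y z} \<inter> {z. 2 * x z - y z < 1} \<inter> {z. 2 * y z - x z < 1}"
    by blast
  moreover have "continuous_on UNIV x" "continuous_on UNIV y"
    unfolding x_def y_def \<zeta>_def using nz by (auto intro!: continuous_intros)
  ultimately show ?thesis
    by (auto intro!: open_Int open_Collect_less continuous_intros)
qed

text \<open>The congruence \<open>3 dvd a + b\<close> makes the norm form of an offset a multiple of
  3, hence at least 3 when it is positive.\<close>

lemma vertices_dist:
  assumes "v \<in> vertices" "w \<in> vertices" "v \<noteq> w"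
  shows "dist v w \<ge> 2 * r"
proof -
  obtain H u s where c: "is_corner H u s" and v: "v = vertex H u s"
    using assms(1) unfolding vertices_def by blast
  have s: "turn s" using c by blast
  obtain a b :: int where w: "w = v + u / 3 * (of_int a + of_int b * s)"
    and ab: "3 dvd a + b"
    using vertex_offset'[OF c assms(2)] v by blast
  have "dist v w = norm u / 3 * cmod (of_real (of_int a) + of_real (of_int b) * s)"
    unfolding w by (simp add: dist_norm norm_mult norm_divide)
  then have "(dist v w)\<^sup>2 = (norm u / 3)\<^sup>2 * ((of_int a)\<^sup>2 - of_int a * of_int b + (of_int b)\<^sup>2)"
    by (simp only: power_mult_distrib cmod_turn_comb[OF s])
  also have "(norm u / 3)\<^sup>2 = 4 / 3 * r\<^sup>2"
    using c dirs_norm[of u] by (simp add: power_divide power_mult_distrib)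
  also have "((of_int a)\<^sup>2 - of_int a * of_int b + (of_int b)\<^sup>2) = (of_int (a\<^sup>2 - a * b + b\<^sup>2) :: real)"
    by simp
  finally have d: "(dist v w)\<^sup>2 = 4 / 3 * r\<^sup>2 * of_int (a\<^sup>2 - a * b + b\<^sup>2)" .
  obtain k where k: "a + b = 3 * k" using ab by (rule dvdE)
  have b: "b = 3 * k - a" using k by simp
  define K where "K = a\<^sup>2 - 3 * a * k + 3 * k\<^sup>2"
  have q: "a\<^sup>2 - a * b + b\<^sup>2 = 3 * K"
    unfolding b K_def by (simp add: power2_eq_square algebra_simps)
  have "a \<noteq> 0 \<or> b \<noteq> 0" using assms(3) w by auto
  then have "of_real (of_int a) + of_real (of_int b) * s \<noteq> 0"
    using turn_comb_eq_0[OF s] by (metis of_int_eq_0_iff)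
  then have "dist v w > 0" using assms(3) by simp
  then have "(dist v w)\<^sup>2 > 0" by simp
  then have "(of_int (a\<^sup>2 - a * b + b\<^sup>2) :: real) > 0"
    unfolding d using r_pos by (simp only: zero_less_mult_iff) auto
  then have "a\<^sup>2 - a * b + b\<^sup>2 > 0" by (simp only: of_int_0_less_iff)
  then have "a\<^sup>2 - a * b + b\<^sup>2 \<ge> 3" unfolding q by presburger
  then have "(of_int (a\<^sup>2 - a * b + b\<^sup>2) :: real) \<ge> of_int 3" by (simp only: of_int_le_iff)
  then have "4 / 3 * r\<^sup>2 * of_int (a\<^sup>2 - a * b + b\<^sup>2) \<ge> 4 / 3 * r\<^sup>2 * of_int 3" by (intro mult_left_mono) auto
  then have "(2 * r)\<^sup>2 \<le> (dist v w)\<^sup>2" unfolding d by (simp add: power_mult_distrib)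
  then show ?thesis by (rule power2_le_imp_le) simp
qed

lemma pt_convex_comb:
  "(1 - of_real t) * pt H u s x y + of_real t * pt H u s x' y' = pt H u s ((1 - t) * x + t * x') ((1 - t) * y + t * y')"
proof -
  have "(1 - c) * (v + A * (a * k + b * l)) + c * (v + A * (a' * k + b' * l)) =
    v + A * (((1 - c) * a + c * a') * k + ((1 - c) * b + c * b') * l)" for v A a b a' b' k l c :: complex
    by (simp add: algebra_simps)
  then show ?thesis unfolding pt_def of_real_add of_real_mult of_real_diff of_real_1 .
qed

text \<open>The kite lies in the disc with diameter from the vertex to H (Thales), so seen from H the
  distance to the vertex decreases along a segment only inside the kite's part of the vertex disc.\<close>

lemma kite_outer_segment:
  assumes "is_corner H u s" "q \<in> kite H u s" "dist q (vertex H u s) > r" "z \<in> closed_segment q H" "z \<noteq> H"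
  shows "z \<in> kite H u s \<and> dist z (vertex H u s) > r"
proof -
  have us: "u \<in> dirs" "turn s" using assms by auto
  obtain x y where q: "q = pt H u s x y" and k: "0 < x" "0 < y" "2 * x - y < 1" "2 * y - x < 1"
    using assms(2) unfolding kite_def by blast
  have out: "dist (pt H u s x y) (vertex H u s) > r \<longleftrightarrow> quad x y > 1 / 4" for x y
    using on_circle_iff[OF us, of H x y] by linarith
  have q4: "quad x y > 1 / 4" using assms(3) out unfolding q by blast
  obtain t where t: "0 \<le> t" "t \<le> 1" "z = (1 - t) *\<^sub>R q + t *\<^sub>R H"
    using assms(4) unfolding closed_segment_def by blast
  have "t \<noteq> 1" using t assms(5) by auto
  then have t1: "t < 1" using t by simp
  define x' y' where "x' = (1 - t) * x + t" "y' = (1 - t) * y + t"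
  have "z = (1 - of_real t) * pt H u s x y + of_real t * pt H u s 1 1"
    using t(3) q pt_center[OF us(2), of H u] by (simp add: scaleR_conv_of_real)
  then have z: "z = pt H u s x' y'" unfolding pt_convex_comb x'_y'_def by simp
  have pos: "0 < x'" "0 < y'" unfolding x'_y'_def using k t t1 by (simp_all add: add_pos_nonneg)
  have "2 * x' - y' = (1 - t) * (2 * x - y) + t" "2 * y' - x' = (1 - t) * (2 * y - x) + t"
    unfolding x'_y'_def by (simp_all add: algebra_simps)
  moreover have "(1 - t) * (2 * x - y) < (1 - t) * 1" "(1 - t) * (2 * y - x) < (1 - t) * 1"
    using k t1 by (intro mult_strict_left_mono; simp)+
  ultimately have lt: "2 * x' - y' < 1" "2 * y' - x' < 1" by simp_all
  have "x * (2 * x - y) \<le> x * 1" "y * (2 * y - x) \<le> y * 1"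
    using k by (intro mult_left_mono; simp)+
  moreover have "2 * quad x y = x * (2 * x - y) + y * (2 * y - x)"
    by (simp add: quad_def power2_eq_square algebra_simps)
  \<comment> \<open>This is the condition of Thales: in the inner product belonging to
    \<open>quad\<close>, the product of q and q - H is not positive, where q = (x, y) and H = (1,
    1).\<close>
  ultimately have b: "quad x y \<le> (x + y) / 2" by simp
  have e: "quad x' y' = (1 - t)\<^sup>2 * quad x y + t * (1 - t) * (x + y) + t\<^sup>2"
    unfolding x'_y'_def quad_def by (simp add: power2_eq_square algebra_simps)
  have "t * (1 - t) * (2 * quad x y) \<le> t * (1 - t) * (x + y)"
    using b t by (intro mult_left_mono) auto
  then have "(1 - t)\<^sup>2 * quad x y + t * (1 - t) * (2 * quad x y) + t\<^sup>2 \<le> quad x' y'" unfolding e by simp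
  moreover have "(1 - t)\<^sup>2 * quad x y + t * (1 - t) * (2 * quad x y) + t\<^sup>2 = (1 - t\<^sup>2) * quad x y + t\<^sup>2"
    by (simp add: power2_eq_square algebra_simps)
  ultimately have "quad x' y' \<ge> (1 - t\<^sup>2) * quad x y + t\<^sup>2" by simp
  moreover have "1 - t\<^sup>2 > 0" using t(1) t1 by (simp add: abs_square_less_1)
  then have "(1 - t\<^sup>2) * quad x y > (1 - t\<^sup>2) * (1 / 4)" using q4 by (intro mult_strict_left_mono) auto
  ultimately have "quad x' y' > (1 - t\<^sup>2) * (1 / 4) + t\<^sup>2" by linarith
  moreover have "(1 - t\<^sup>2) * (1 / 4) + t\<^sup>2 \<ge> 1 / 4" by (simp add: algebra_simps)
  ultimately have "quad x' y' > 1 / 4" by linarith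
  then show ?thesis unfolding z using out pos lt unfolding kite_def by blast
qed

end

context hex_cycle
begin

lemma same_side:
  assumes "connected A" "A \<inter> curve = {}" "x \<in> A" "y \<in> A"
  shows "x \<in> inside curve \<longleftrightarrow> y \<in> inside curve"
proof -
  have "connected_component (- curve) x y" "connected_component (- curve) y x"
    using assms unfolding connected_component_def by blast+
  then show ?thesis using inside_same_component by blast
qed

lemma Jordan:
  "open (inside curve)" "bounded (inside curve)" "inside curve \<inter> outside curve = {}"
  "inside curve \<union> outside curve = - curve" "frontier (inside curve) = curve" "frontier (outside curve) = curve"
  using Jordan_inside_outside[OF loop_simple(1,2)] unfolding loop_simple(3) by blast+

text \<open>Each point of the curve has distance \<open>r\<close> from some vertex, and any other
  vertex is at least \<open>2 * r\<close> away from that one.\<close>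

lemma curve_vertex_dist:
  assumes "w \<in> vertices" "z \<in> curve"
  shows "dist z w \<ge> r"
proof -
  obtain i where z: "z \<in> arc (Hc i) (Uc i) (Sc i)"
    using assms(2) unfolding curve_def cyc_corners_def by auto
  define v where "v = vertex (Hc i) (Uc i) (Sc i)"
  have d: "dist z v = r" using arc_on_circle[OF z Uc_dirs Sc_turn] by (simp add: v_def)
  show ?thesis
  proof (cases "w = v")
    case False
    then have "dist v w \<ge> 2 * r"
      using vertices_dist[of v w] assms(1) vertex_in[OF cyc_corner[of i]] by (auto simp: v_def)
    moreover have "dist v w \<le> dist z v + dist z w" using dist_triangle2[of v w z] by (simp add: dist_commute)
    ultimately show ?thesis using d by linarith
  qed (use d in simp)
qed

lemma ball_side:
  assumes "w \<in> vertices" "dist z w < r"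
  shows "z \<in> inside curve \<longleftrightarrow> w \<in> inside curve"
proof (rule same_side[of "ball w r"])
  show "ball w r \<inter> curve = {}"
    using curve_vertex_dist[OF assms(1)] by (force simp: dist_commute)
qed (use assms r_pos in \<open>auto simp: dist_commute\<close>)

lemma kite_curve:
  assumes "is_corner H u s" "z \<in> kite H u s" "z \<in> curve"
  shows "z \<in> open_arc H u s" "(H, u, s) \<in> cyc_corners" "dist z (vertex H u s) = r"
proof -
  have us: "u \<in> dirs" "turn s" using assms by auto
  obtain i where z: "z \<in> arc (Hc i) (Uc i) (Sc i)"
    using assms(3) unfolding curve_def cyc_corners_def by auto
  have d: "dist z (vertex (Hc i) (Uc i) (Sc i)) = r" using arc_on_circle[OF z Uc_dirs Sc_turn] .
  then have v: "vertex (Hc i) (Uc i) (Sc i) = vertex H u s"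
    using kite_far[OF assms(1) vertex_in[OF cyc_corner] _ assms(2), of i] by fastforce
  then show dv: "dist z (vertex H u s) = r" using d by simp
  obtain x y where xy: "z = pt H u s x y" "0 < x" "0 < y" using assms(2) unfolding kite_def by blast
  then have "quad x y = 1 / 4" using dv on_circle_iff(1)[OF us] by simp
  then show o: "z \<in> open_arc H u s" using xy unfolding open_arc_def by blast
  show "(H, u, s) \<in> cyc_corners" by (rule open_arc_in_curve[OF assms(1) o assms(3)])
qed

lemma center_notin_curve: "H \<in> centers \<Longrightarrow> H \<notin> curve"
proof
  assume H: "H \<in> centers" "H \<in> curve"
  then obtain i where z: "H \<in> arc (Hc i) (Uc i) (Sc i)"
    unfolding curve_def cyc_corners_def by auto
  then show False
    using arc_on_circle[OF z Uc_dirs Sc_turn] center_far[OF H(1) vertex_in[OF cyc_corner[of i]]] by simp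
qed

text \<open>The segment from the vertex to the centre is the diagonal x = y of the kite, and the
  only link that could cross it is the one of this corner.\<close>

lemma non_corner_side:
  assumes "is_corner H u s" "(H, u, s) \<notin> cyc_corners"
  shows "vertex H u s \<in> inside curve \<longleftrightarrow> H \<in> inside curve"
proof (rule same_side[of "closed_segment (vertex H u s) H"])
  have us: "u \<in> dirs" "turn s" using assms by auto
  show "closed_segment (vertex H u s) H \<inter> curve = {}"
  proof (intro equals0I)
    fix z assume "z \<in> closed_segment (vertex H u s) H \<inter> curve"
    then obtain t where t: "0 \<le> t" "t \<le> 1" "z = (1 - t) *\<^sub>R vertex H u s + t *\<^sub>R H" and zc: "z \<in> curve"
      unfolding closed_segment_def by blast
    have "z = (1 - of_real t) * pt H u s 0 0 + of_real t * pt H u s 1 1"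
      using t(3) pt_center[OF us(2), of H u] by (simp add: scaleR_conv_of_real)
    then have z: "z = pt H u s t t" unfolding pt_convex_comb by simp
    consider "t = 0" | "t = 1" | "0 < t" "t < 1" using t by linarith
    then show False
    proof cases
      case 1
      then show False using zc z curve_vertex_dist[OF vertex_in[OF assms(1)] zc] r_pos by simp
    next
      case 2
      then show False using zc z pt_center[OF us(2), of H u] center_notin_curve assms(1) by simp
    next
      case 3
      then have "z \<in> kite H u s" unfolding kite_def z by force
      then show False using kite_curve(2)[OF assms(1) _ zc] assms(2) by blast
    qed
  qed
qed auto

lemma outer_side:
  assumes "is_corner H u s" "q \<in> kite H u s" "dist q (vertex H u s) > r"
  shows "q \<in> inside curve \<longleftrightarrow> H \<in> inside curve"
proof (rule same_side[of "closed_segment q H"])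
  show "closed_segment q H \<inter> curve = {}"
  proof (intro equals0I)
    fix z assume z: "z \<in> closed_segment q H \<inter> curve"
    then have "z \<noteq> H" using center_notin_curve assms(1) by blast
    then have "z \<in> kite H u s" "dist z (vertex H u s) > r"
      using kite_outer_segment[OF assms] z by blast+
    then show False using kite_curve(3)[OF assms(1)] z by force
  qed
qed auto

lemma corner_local:
  assumes "(H, u, s) \<in> cyc_corners" "q \<in> kite H u s"
  shows "q \<in> inside curve \<longleftrightarrow> dist q (vertex H u s) < r \<and> vertex H u s \<in> inside curve \<or>
     dist q (vertex H u s) > r \<and> H \<in> inside curve"
proof -
  have c: "is_corner H u s" using assms(1) cyc_corners_corners by (auto simp: corners_def)
  have us: "u \<in> dirs" "turn s" using c by auto
  consider "dist q (vertex H u s) < r" | "dist q (vertex H u s) > r" | "dist q (vertex H u s) = r" by linarith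
  then show ?thesis
  proof cases
    case 1
    then show ?thesis using ball_side[OF vertex_in[OF c]] by simp
  next
    case 2
    then show ?thesis using outer_side[OF c assms(2)] by simp
  next
    case 3
    obtain x y where xy: "q = pt H u s x y" "0 < x" "0 < y" using assms(2) unfolding kite_def by blast
    then have "quad x y = 1 / 4" using 3 on_circle_iff(1)[OF us] by simp
    then have "q \<in> arc H u s" using xy unfolding arc_def by force
    then have "q \<in> curve" using assms(1) unfolding curve_def by force
    then have "q \<notin> inside curve" using Jordan(4) by blast
    then show ?thesis using 3 by simp
  qed
qed

text \<open>By the Jordan curve theorem both components of the complement come arbitrarily close to
  the middle of the link. The kite offers only two sides there, that of the vertex and that of
  \<open>H\<close>, so these belong to different components.\<close>

lemma corner_sides:
  assumes "(H, u, s) \<in> cyc_corners"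
  shows "H \<in> inside curve \<longleftrightarrow> vertex H u s \<notin> inside curve"
proof -
  have c: "is_corner H u s" using assms(1) cyc_corners_corners by (auto simp: corners_def)
  define p0 where "p0 = pt H u s (1/2) (1/2)"
  have p: "p0 \<in> open_arc H u s" unfolding p0_def by (rule open_arc_nonempty)
  then have pk: "p0 \<in> kite H u s" using open_arc_kite by blast
  have pc: "p0 \<in> curve" using assms p open_arc_arc unfolding curve_def by fastforce
  have near: "\<exists>q\<in>S. q \<in> kite H u s" if "frontier S = curve" for S
  proof -
    have "p0 \<in> closure S" using pc that by (auto simp: frontier_def)
    then have "kite H u s \<inter> S \<noteq> {}"
      using kite_open c pk open_Int_closure_eq_empty[of "kite H u s" S] by blast
    then show ?thesis by blast
  qed
  obtain q where q: "q \<in> inside curve" "q \<in> kite H u s" using near Jordan(5) by blast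
  obtain q' where q': "q' \<in> outside curve" "q' \<in> kite H u s" using near Jordan(6) by blast
  have "H \<in> inside curve \<or> vertex H u s \<in> inside curve"
    using corner_local[OF assms q(2)] q(1) by blast
  moreover have "\<not> (H \<in> inside curve \<and> vertex H u s \<in> inside curve)"
  proof
    assume a: "H \<in> inside curve \<and> vertex H u s \<in> inside curve"
    have "q' \<notin> inside curve" "q' \<notin> curve" using q'(1) Jordan(3,4) by blast+
    then have d: "dist q' (vertex H u s) = r" using corner_local[OF assms q'(2)] a by auto
    have us: "u \<in> dirs" "turn s" using c by auto
    obtain x y where xy: "q' = pt H u s x y" "0 < x" "0 < y" using q'(2) unfolding kite_def by blast
    then have "quad x y = 1 / 4" using d on_circle_iff(1)[OF us] by simp
    then have "q' \<in> arc H u s" using xy unfolding arc_def by force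
    then show False using assms \<open>q' \<notin> curve\<close> unfolding curve_def by force
  qed
  ultimately show ?thesis by blast
qed

lemma lnk_point_open:
  assumes "is_corner H u s" "t \<in> {0<..<2 * pi / 3}"
  shows "link_point (lnk H u s) t \<in> open_arc H u s"
proof -
  define \<tau> where "\<tau> = t / (2 * pi / 3)"
  have t: "t = 2 * pi / 3 * \<tau>" by (simp add: \<tau>_def)
  have "t / (2 * pi / 3) < 1" using assms(2) by (subst divide_less_eq_1_pos) auto
  moreover have "0 < t / (2 * pi / 3)" using assms(2) by (intro divide_pos_pos) auto
  ultimately have \<tau>: "0 < \<tau>" "\<tau> < 1" unfolding \<tau>_def by blast+
  have "turn s" using assms(1) by blast
  show ?thesis unfolding t lnk_point[OF \<open>turn s\<close>] by (rule open_arc_point[OF assms(1)]) (use \<tau> in auto)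
qed

text \<open>In the kite the enclosed region is either the part in the disc or the part beyond the
  circle, so testing the centre of the disc decides convexity at every point of the link.\<close>

lemma corner_convex:
  assumes "(H, u, s) \<in> cyc_corners"
  shows "convex_link r curve (lnk H u s) \<longleftrightarrow> vertex H u s \<in> inside curve"
proof
  have c: "is_corner H u s" using assms(1) cyc_corners_corners by (auto simp: corners_def)
  have f: "fst (lnk H u s) = vertex H u s" by (simp add: lnk_def)
  { assume cv: "convex_link r curve (lnk H u s)"
    define p0 where "p0 = link_point (lnk H u s) (pi / 3)"
    have t: "pi / 3 \<in> {0<..<2 * pi / 3}" using pi_gt_zero by simp
    then obtain e where e: "e > 0" "\<And>z. z \<in> ball p0 e \<Longrightarrow> z \<in> inside curve \<longleftrightarrow> z \<in> ball (vertex H u s) r"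
      using cv unfolding convex_link_def f p0_def by blast
    have "p0 \<in> open_arc H u s" unfolding p0_def by (rule lnk_point_open[OF c t])
    then have "dist p0 (vertex H u s) = r" using arc_on_circle open_arc_arc c by blast
    then have d: "p0 \<in> closure (ball (vertex H u s) r)" using r_pos by (simp add: dist_commute)
    have "ball p0 e \<inter> ball (vertex H u s) r \<noteq> {}"
      using open_Int_closure_eq_empty[of "ball p0 e" "ball (vertex H u s) r"] d e(1) by force
    then obtain q where "q \<in> ball p0 e" "q \<in> ball (vertex H u s) r" by blast
    then have "q \<in> inside curve" "dist q (vertex H u s) < r" using e(2) by (auto simp: dist_commute)
    then show "vertex H u s \<in> inside curve" using ball_side[OF vertex_in[OF c]] by blast
  }
  assume v: "vertex H u s \<in> inside curve"
  then have H: "H \<notin> inside curve" using corner_sides[OF assms] by blast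
  show "convex_link r curve (lnk H u s)"
    unfolding convex_link_def f
  proof
    fix t :: real assume "t \<in> {0<..<2 * pi / 3}"
    then have "link_point (lnk H u s) t \<in> kite H u s" using lnk_point_open[OF c] open_arc_kite by blast
    then obtain e where e: "e > 0" "ball (link_point (lnk H u s) t) e \<subseteq> kite H u s"
      using kite_open[of u s H] c open_contains_ball by blast
    have "z \<in> inside curve \<longleftrightarrow> z \<in> ball (vertex H u s) r" if "z \<in> ball (link_point (lnk H u s) t) e" for z
      using corner_local[OF assms, of z] that e(2) v H by (auto simp: dist_commute)
    then show "\<exists>e>0. \<forall>z\<in>ball (link_point (lnk H u s) t) e. z \<in> inside curve \<longleftrightarrow> z \<in> ball (vertex H u s) r"
      using e(1) by blast
  qed
qed

section \<open>Orientation\<close>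

text \<open>An equal turn stays on the same circle. After an opposite turn, the new vertex is also a
  corner of the hexagon \<open>H\<close>; the link of \<open>H\<close> there would end in the same
  edge as link \<open>i\<close>, hence is not on the curve. So the new vertex lies on the side of
  \<open>H\<close>, opposite to the old one.\<close>

lemma next_side:
  "(vertex (Hc (i + 1)) (Uc (i + 1)) (Sc (i + 1)) \<in> inside curve \<longleftrightarrow> vertex (Hc i) (Uc i) (Sc i) \<in> inside curve)
    \<longleftrightarrow> Sc (i + 1) = Sc i"
proof -
  define H u s where "H = Hc i" "u = Uc i" "s = Sc i"
  have c: "is_corner H u s" using cyc_corner[of i] by (simp add: H_u_s_def)
  have s: "turn s" using c by blast
  have u': "Uc (i + 1) = u * s" by (simp add: Uc_Suc H_u_s_def)
  have H': "Hc (i + 1) = H + u * s"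
    using E_eq[of "i + 1"] E_next[of i] u' by (simp add: H_u_s_def algebra_simps)
  have side: "H \<in> inside curve \<longleftrightarrow> vertex H u s \<notin> inside curve"
    by (rule corner_sides) (auto simp: cyc_corners_def H_u_s_def)
  show ?thesis
  proof (cases "Sc (i + 1) = s")
    case True
    then show ?thesis unfolding H' u' True H_u_s_def(3)[symmetric] vertex_next[OF s]
      by (simp add: H_u_s_def)
  next
    case False
    then have s': "Sc (i + 1) = s * s" using turn_cases[OF Sc_turn s] by blast
    have us: "u * s * s * (s * s) = u * s" using turn_cube[OF s] by (simp add: mult.assoc)
    have v': "vertex (H + u * s) (u * s) (s * s) = vertex H (u * s * s) (s * s)"
      using vertex_next[OF turn_square[OF s], of H "u * s * s"] unfolding us .
    have c': "is_corner H (u * s * s) (s * s)" using c dirs_turn by auto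
    have "(H, u * s * s, s * s) \<notin> cyc_corners"
    proof
      assume "(H, u * s * s, s * s) \<in> cyc_corners"
      then obtain j where j: "Hc j = H" "Uc j = u * s * s" "Sc j = s * s" unfolding cyc_corners_def by auto
      then have "E (j + 1) = E (i + 1)" using E_next[of j] E_next[of i] us by (simp add: H_u_s_def)
      then have "(j + 1) mod n = (i + 1) mod n" by (rule E_inj)
      then have "j mod n = i mod n" by (simp add: mod_eq_dvd_iff)
      then have "Uc j = Uc i" using cyc_mod(2)[of i] cyc_mod(2)[of j] by simp
      then have "u * (s * s) = u" using j(2) by (simp add: H_u_s_def mult.assoc)
      then show False using turn_neq_1[OF turn_square[OF s]] c dirs_nz by auto
    qed
    from non_corner_side[OF c' this] side
    show ?thesis unfolding H' u' s' v' using turn_sq_neq[OF s] by (simp add: H_u_s_def)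
  qed
qed

text \<open>Height is measured by \<open>Re (z / \<delta>)\<close>. Where two links join, the
  tangent lies in \<open>dirs\<close> and its height component is nonzero, so the minimum is
  interior to a link, at one of the two extreme points of its circle. The upper one is excluded
  because nearby points of the link would be lower.\<close>

lemma lowest_point:
  obtains i t0 \<rho> where "of_int i < t0" "t0 < of_int (i + 1)" "\<rho> > 0"
    "g t0 = vertex (Hc i) (Uc i) (Sc i) - of_real \<rho> * \<delta>" "\<forall>t. Re (g t0 / \<delta>) \<le> Re (g t / \<delta>)"
proof -
  have "continuous_on {0..of_int n} (\<lambda>t. Re (g t / \<delta>))"
    using g_cont \<delta>_nz by (intro continuous_intros) auto
  moreover have "{0..of_int n :: real} \<noteq> {}" using n_pos by simp
  ultimately obtain t0 where t0: "t0 \<in> {0..of_int n}" "\<And>t. t \<in> {0..of_int n} \<Longrightarrow> Re (g t0 / \<delta>) \<le> Re (g t / \<delta>)"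
    using continuous_attains_inf[of "{0..of_int n}" "\<lambda>t. Re (g t / \<delta>)"] by auto
  have low: "Re (g t0 / \<delta>) \<le> Re (g t / \<delta>)" for t
  proof -
    have "g t \<in> g ` {0..0 + of_int n}" using range_period[of 0] by blast
    then show ?thesis using t0(2) by auto
  qed
  define i where "i = \<lfloor>t0\<rfloor>"
  define v where "v = vertex (Hc i) (Uc i) (Sc i)"
  define a where "a = ang (Sc i)"
  have i: "of_int i \<le> t0" "t0 < of_int (i + 1)" unfolding i_def by linarith+
  have a: "a \<noteq> 0" using ang_cases[of "Sc i"] by (auto simp: a_def)
  have "((\<lambda>t. Re (g t / \<delta>)) has_real_derivative Re (g' t0 / \<delta>)) (at t0)"
    using bounded_linear.has_vector_derivative[OF bounded_linear_compose[OF bounded_linear_Re bounded_linear_divide[of \<delta>]] g_deriv[of t0]]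
    by (simp add: o_def has_real_derivative_iff_has_vector_derivative)
  then have R0: "Re (g' t0 / \<delta>) = 0"
    by (rule DERIV_local_min[where d = 1]) (use low in auto)
  have i': "of_int i < t0"
  proof (rule ccontr)
    assume "\<not> ?thesis"
    then have "t0 = of_int i" using i by simp
    then have g0: "g' t0 = of_real speed * Uc i" using g'_piece[of t0 i] by (simp add: piece_vel_def)
    obtain w where w: "turn w" using turn_cis by blast
    have "Uc i / \<delta> = 1 \<or> Uc i / \<delta> = w \<or> Uc i / \<delta> = w * w"
      using dirs_quot[OF dirs_\<delta> Uc_dirs w, of i] \<delta>_nz by auto
    then have "Re (Uc i / \<delta>) \<noteq> 0"
      using turn_Re_Im(1)[OF w] turn_Re_Im(1)[OF turn_square[OF w]] by auto
    moreover have "Re (g' t0 / \<delta>) = speed * Re (Uc i / \<delta>)"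
      unfolding g0 times_divide_eq_right[symmetric] times_complex.sel Re_complex_of_real Im_complex_of_real
      by (simp only: mult_zero_left diff_zero)
    ultimately show False using R0 speed_pos by simp
  qed
  define w where "w = (\<lambda>t. (g t - v) / \<delta>)"
  define R where "R = cmod (radial (Uc i) (Sc i)) / 2 / cmod \<delta>"
  have gp: "g t = v + radial (Uc i) (Sc i) / 2 * cis (a * (t - of_int i))" if "t \<in> {of_int i..of_int (i + 1)}" for t
    using g_piece[OF that] by (simp add: piece_def v_def a_def)
  have wR: "cmod (w t) = R" if "t \<in> {of_int i..of_int (i + 1)}" for t
    unfolding w_def gp[OF that] R_def by (simp add: norm_mult norm_divide)
  have Rpos: "R > 0" unfolding R_def using radial_nz[OF Uc_dirs Sc_turn, of i i] \<delta>_nz by simp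
  have ti: "t0 \<in> {of_int i..of_int (i + 1)}" using i by simp
  have "g' t0 = \<i> * of_real a * (g t0 - v)"
  proof -
    have "g' t0 = of_real speed * Uc i * cis (a * (t0 - of_int i))"
      using g'_piece[OF ti] by (simp add: piece_vel_def a_def)
    also have "\<dots> = radial (Uc i) (Sc i) / 2 * (\<i> * of_real a) * cis (a * (t0 - of_int i))"
      using radial_velocity[OF Sc_turn, of "Uc i" i] by (simp add: a_def)
    finally show ?thesis unfolding gp[OF ti] by simp
  qed
  then have "g' t0 / \<delta> = \<i> * of_real a * w t0" by (simp add: w_def)
  then have Im0: "Im (w t0) = 0" using R0 a by simp
  have Re0: "Re (w t0) = R \<or> Re (w t0) = - R"
    using wR[OF ti] Im0 by (auto simp: cmod_def power2_eq_iff abs_if split: if_splits)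
  have wlow: "Re (w t0) \<le> Re (w t)" for t using low[of t] by (simp add: w_def diff_divide_distrib)
  have "Re (w t0) \<noteq> R"
  proof
    assume Rw: "Re (w t0) = R"
    \<comment> \<open>An earlier point on the same link. If the circle were at its top at
      \<open>t0\<close>, this point could not be lower and would have to coincide with
      \<open>g t0\<close>.\<close>
    define t1 where "t1 = (t0 + of_int i) / 2"
    have t1: "of_int i < t1" "t1 < t0" using i' by (simp_all add: t1_def)
    then have t1i: "t1 \<in> {of_int i..of_int (i + 1)}" using i by simp
    have "Re (w t1) \<ge> cmod (w t1)" using wlow[of t1] Rw wR[OF t1i] by simp
    then have "Re (w t1) = R" using complex_Re_le_cmod[of "w t1"] wR[OF t1i] by simp
    moreover have "(Re (w t1))\<^sup>2 + (Im (w t1))\<^sup>2 = R\<^sup>2" using wR[OF t1i] cmod_power2[of "w t1"] by simp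
    ultimately have "w t1 = w t0" using Rw Im0 by (simp add: complex_eq_iff)
    then have "g t0 = g t1" using \<delta>_nz by (simp add: w_def)
    then obtain k where k: "t0 = t1 + of_int n * of_int k" using g_inj by blast
    then have "0 < real_of_int (n * k)" "real_of_int (n * k) < 1" using t1 i by simp_all
    then have "0 < n * k" "n * k < 1" by (simp_all only: of_int_0_less_iff of_int_less_1_iff)
    then show False by linarith
  qed
  then have "w t0 = - of_real R" using Re0 Im0 by (simp add: complex_eq_iff)
  then have "g t0 = v - of_real R * \<delta>" using \<delta>_nz by (simp add: w_def field_simps)
  then show thesis using that[of i t0 R] i i' Rpos low unfolding v_def by blast
qed

text \<open>Hopf's theorem gives one full turn, whose sense is that of the link at the lowest point.
  Just below that point lies the outside, so the vertex of this link is enclosed. The same link thus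
  fixes the sign of the turning number and the side of the region.\<close>

lemma turning_number:
  obtains i where "(\<Sum>k\<in>{0..<n}. ang (Sc k)) = 3 * ang (Sc i)" "vertex (Hc i) (Uc i) (Sc i) \<in> inside curve"
proof -
  obtain i t0 \<rho> where i: "of_int i < t0" "t0 < of_int (i + 1)" and \<rho>: "\<rho> > 0"
    and g0: "g t0 = vertex (Hc i) (Uc i) (Sc i) - of_real \<rho> * \<delta>"
    and low': "\<forall>t. Re (g t0 / \<delta>) \<le> Re (g t / \<delta>)"
    using lowest_point .
  have low: "Re (g t0 / \<delta>) \<le> Re (g t / \<delta>)" for t using low' by blast
  define v where "v = vertex (Hc i) (Uc i) (Sc i)"
  define a where "a = ang (Sc i)"
  have a: "a = 2 * pi / 3 \<or> a = - (2 * pi / 3)" using ang_cases by (simp add: a_def)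
  have ti: "t0 \<in> {of_int i..of_int (i + 1)}" using i by simp
  have "g' t0 = of_real speed * Uc i * cis (a * (t0 - of_int i))"
    using g'_piece[OF ti] by (simp add: piece_vel_def a_def)
  also have "\<dots> = radial (Uc i) (Sc i) / 2 * (\<i> * of_real a) * cis (a * (t0 - of_int i))"
    using radial_velocity[OF Sc_turn, of "Uc i" i] by (simp add: a_def)
  also have "\<dots> = \<i> * of_real a * (g t0 - v)"
    using g_piece[OF ti] by (simp add: piece_def v_def a_def)
  also have "\<dots> = - \<i> * of_real (a * \<rho>) * \<delta>"
    unfolding g0 v_def by simp
  also have "a * \<rho> = sgn a * (\<bar>a\<bar> * \<rho>)" unfolding mult.assoc[symmetric] sgn_mult_abs ..
  also have "- \<i> * of_real (sgn a * (\<bar>a\<bar> * \<rho>)) * \<delta> = - \<i> * of_real (sgn a) * of_real (\<bar>a\<bar> * \<rho>) * \<delta>"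
    by simp
  finally have dir: "g' t0 / \<delta> = - \<i> * of_real (sgn a) * of_real (\<bar>a\<bar> * \<rho>)" using \<delta>_nz by simp
  have a0: "a \<noteq> 0" using a pi_gt_zero by linarith
  then have sg: "sgn a = 1 \<or> sgn a = - 1" by (auto simp: sgn_if)
  have n0: "(0::real) < of_int n" using n_pos by simp
  have der: "((\<lambda>t. g t / \<delta>) has_vector_derivative g' t / \<delta>) (at t)" for t
    using bounded_linear.has_vector_derivative[OF bounded_linear_divide g_deriv] .
  have cont: "continuous_on UNIV (\<lambda>t. g' t / \<delta>)" using g_vel_cont \<delta>_nz by (intro continuous_intros) auto
  have nz: "g' t / \<delta> \<noteq> 0" for t using g'_nz \<delta>_nz by simp
  have per: "g (t + of_int n) / \<delta> = g t / \<delta>" "g' (t + of_int n) / \<delta> = g' t / \<delta>" for t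
    by (simp_all only: g_periodic g'_periodic)
  have inj: "g s / \<delta> \<noteq> g t / \<delta>" if "s < t" "t < s + of_int n" for s t
  proof
    assume "g s / \<delta> = g t / \<delta>"
    then have "g t = g s" using \<delta>_nz by simp
    then obtain k where "t = s + of_int n * of_int k" using g_inj by blast
    then have "0 < real_of_int n * of_int k" "real_of_int n * of_int k < of_int n * 1" using that by simp_all
    then have "0 < real_of_int k" "real_of_int k < 1"
      using n0 by (simp_all only: zero_less_mult_iff mult_less_cancel_left_pos) auto
    then show False by simp
  qed
  have c0: "\<bar>a\<bar> * \<rho> > 0" using a0 \<rho> by simp
  obtain \<phi> where \<phi>: "continuous_on {t0..t0 + of_int n} \<phi>" "\<And>t. t \<in> {t0..t0 + of_int n} \<Longrightarrow> exp (\<phi> t) = g' t / \<delta>"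
    "\<phi> (t0 + of_int n) - \<phi> t0 = 2 * pi * \<i> * of_real (sgn a)"
    by (rule turning_tangents[OF n0 der cont nz per inj low dir c0 sg]) (blast intro: that)+
  \<comment> \<open>A second logarithm of the tangent, built from the accumulated angles. Comparing
    it with the abstract one turns the sum of the angles into one full turn.\<close>
  define \<psi> where "\<psi> t = Ln (of_real speed * Uc 0 / \<delta>) + \<i> * of_real (angle t)" for t
  have X: "of_real speed * Uc 0 / \<delta> \<noteq> 0" using speed_pos dirs_nz[OF Uc_dirs] \<delta>_nz by simp
  have \<psi>: "exp (\<psi> t) = g' t / \<delta>" for t
    unfolding \<psi>_def g'_angle exp_add exp_Ln[OF X] cis_conv_exp[symmetric] by simp
  have \<psi>c: "continuous_on {t0..t0 + of_int n} \<psi>"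
    unfolding \<psi>_def[abs_def] by (intro continuous_intros angle_cont)
  have "\<phi> (t0 + of_int n) - \<phi> t0 = \<psi> (t0 + of_int n) - \<psi> t0"
    by (rule log_lift_unique[OF \<phi>(1) \<psi>c]) (use n0 in simp, simp only: \<phi>(2) \<psi>)
  also have "\<dots> = \<i> * of_real (\<Sum>k\<in>{0..<n}. ang (Sc k))"
    unfolding \<psi>_def angle_periodic of_real_add distrib_left by (simp only: add_diff_cancel_left add_diff_cancel_left')
  finally have "\<i> * of_real (\<Sum>k\<in>{0..<n}. ang (Sc k)) = 2 * pi * \<i> * of_real (sgn a)"
    unfolding \<phi>(3) by (rule sym)
  also have "\<dots> = \<i> * of_real (2 * pi * sgn a)" by simp
  finally have "\<i> * of_real (\<Sum>k\<in>{0..<n}. ang (Sc k)) = \<i> * of_real (2 * pi * sgn a)" .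
  then have "(\<Sum>k\<in>{0..<n}. ang (Sc k)) = 2 * pi * sgn a"
    unfolding mult_cancel_left of_real_eq_iff by simp
  \<comment> \<open>Since \<bar>a\<bar> = 2\<pi>/3, a full turn with the sign of \<open>a\<close> is
    three times \<open>a\<close>.\<close>
  also have "\<dots> = 3 * a"
    using a
  proof
    assume "a = 2 * pi / 3"
    moreover from this have "a > 0" using pi_gt_zero by linarith
    ultimately show ?thesis by (simp add: sgn_if)
  next
    assume "a = - (2 * pi / 3)"
    moreover from this have "a < 0" using pi_gt_zero by linarith
    ultimately show ?thesis by (simp add: sgn_if)
  qed
  finally have sum: "(\<Sum>k\<in>{0..<n}. ang (Sc k)) = 3 * ang (Sc i)" by (simp add: a_def)
  have p: "g t0 \<in> open_arc (Hc i) (Uc i) (Sc i)" using g_open i by blast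
  then have "g t0 \<in> kite (Hc i) (Uc i) (Sc i)" using open_arc_kite by blast
  with kite_open[OF Uc_dirs Sc_turn, of "Hc i" i i] obtain e where
    e: "e > 0" "ball (g t0) e \<subseteq> kite (Hc i) (Uc i) (Sc i)"
    by (rule openE)
  define \<eta> where "\<eta> = e / (2 * cmod \<delta>)"
  have \<eta>: "\<eta> > 0" using e(1) \<delta>_nz by (simp add: \<eta>_def)
  define q where "q = g t0 - of_real \<eta> * \<delta>"
  have "dist (g t0) q = \<eta> * cmod \<delta>" using \<eta> by (simp add: q_def dist_norm norm_mult)
  also have "\<dots> < e" using e(1) \<delta>_nz by (simp add: \<eta>_def)
  finally have qk: "q \<in> kite (Hc i) (Uc i) (Sc i)" using e(2) by auto
  have "g t0 \<in> arc (Hc i) (Uc i) (Sc i)" using p open_arc_arc by blast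
  then have "dist (g t0) v = r" unfolding v_def by (rule arc_on_circle[OF _ Uc_dirs Sc_turn])
  then have "\<rho> * cmod \<delta> = r" using \<rho> unfolding g0 v_def by (simp add: dist_norm norm_mult)
  moreover have "dist q v = (\<rho> + \<eta>) * cmod \<delta>"
  proof -
    have "q - v = - (of_real (\<rho> + \<eta>) * \<delta>)" unfolding q_def g0 v_def by (simp add: algebra_simps)
    then have "dist q v = cmod (of_real (\<rho> + \<eta>)) * cmod \<delta>"
      by (simp only: dist_norm norm_minus_cancel norm_mult)
    then show ?thesis unfolding norm_of_real using \<rho> \<eta> by simp
  qed
  ultimately have qr: "dist q v > r" using \<eta> \<delta>_nz by (simp add: distrib_right)
  \<comment> \<open>The open half-plane below the curve. It is convex, unbounded and free of the
    curve, so none of its points is enclosed; \<open>q\<close> lies in it and, within the kite,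
    beyond the circle.\<close>
  define A where "A = {z. Re (z / \<delta>) < Re (g t0 / \<delta>)}"
  have A: "A \<inter> curve = {}"
  proof (rule equals0I)
    fix z assume "z \<in> A \<inter> curve"
    then obtain t where "z = g t" "Re (z / \<delta>) < Re (g t0 / \<delta>)" unfolding A_def curve_range by blast
    then show False using low[of t] by simp
  qed
  have q: "q \<in> A" unfolding A_def q_def using \<eta> \<delta>_nz by (simp add: diff_divide_distrib)
  have "q \<notin> inside curve"
  proof
    assume qi: "q \<in> inside curve"
    have "q - of_real x * \<delta> \<in> inside curve" if "x \<ge> 0" for x
    proof -
      have "convex A"
      proof (rule convexI)
        fix y z and a b :: real
        assume "y \<in> A" "z \<in> A" and ab: "0 \<le> a" "0 \<le> b" "a + b = 1"
        moreover have "Re ((a *\<^sub>R y + b *\<^sub>R z) / \<delta>) = a * Re (y / \<delta>) + b * Re (z / \<delta>)"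
          unfolding add_divide_distrib plus_complex.sel scaleR_conv_of_real times_divide_eq_right[symmetric]
            times_complex.sel Re_complex_of_real Im_complex_of_real
          by (simp only: mult_zero_left diff_zero)
        ultimately show "a *\<^sub>R y + b *\<^sub>R z \<in> A"
          unfolding A_def mem_Collect_eq using convex_bound_lt[of "Re (y / \<delta>)" _ "Re (z / \<delta>)" a b] ab by simp
      qed
      moreover have "q - of_real x * \<delta> \<in> A" using q that \<delta>_nz unfolding A_def by (simp add: diff_divide_distrib)
      ultimately show ?thesis using same_side[OF convex_connected A q] qi by blast
    qed
    moreover obtain B where B: "\<And>z. z \<in> inside curve \<Longrightarrow> norm z \<le> B" using Jordan(2) unfolding bounded_iff by blast
    ultimately have *: "norm (q - of_real x * \<delta>) \<le> B" if "x \<ge> 0" for x using that by blast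
    define x where "x = (norm q + \<bar>B\<bar> + 1) / cmod \<delta>"
    have x0: "x \<ge> 0" "x * cmod \<delta> = norm q + \<bar>B\<bar> + 1" using \<delta>_nz by (simp_all add: x_def)
    have "norm (of_real x * \<delta>) \<le> norm q + norm (q - of_real x * \<delta>)"
      using norm_triangle_ineq4[of q "q - of_real x * \<delta>"] by simp
    then show False using *[OF x0(1)] x0 by (simp add: norm_mult)
  qed
  then have "Hc i \<notin> inside curve" using outer_side[OF cyc_corner qk] qr unfolding v_def by blast
  moreover have "(Hc i, Uc i, Sc i) \<in> cyc_corners" unfolding cyc_corners_def by blast
  ultimately have "v \<in> inside curve" using corner_sides unfolding v_def by blast
  then show thesis using that sum unfolding v_def by blast
qed

text \<open>The angles are plus or minus that of \<open>w\<close>, so the turning number becomes a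
  count. By \<open>next_side\<close> the vertex of a link changes sides exactly when the turn
  changes, which spreads the correspondence from one link to all.\<close>

theorem orientation:
  obtains w where "turn w" "(\<Sum>k\<in>{0..<n}. if Sc k = w then 1 else - 1 :: int) = 3"
    "\<And>H u s. (H, u, s) \<in> cyc_corners \<Longrightarrow> vertex H u s \<in> inside curve \<longleftrightarrow> s = w"
proof -
  obtain i0 where i0: "(\<Sum>k\<in>{0..<n}. ang (Sc k)) = 3 * ang (Sc i0)"
    "vertex (Hc i0) (Uc i0) (Sc i0) \<in> inside curve" using turning_number by blast
  define w where "w = Sc i0"
  have w: "turn w" using Sc_turn by (simp add: w_def)
  let ?v = "\<lambda>i. vertex (Hc i) (Uc i) (Sc i)"
  have two: "Sc i = w \<or> Sc i = w * w" for i using turn_cases[OF Sc_turn w] .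
  have in_iff: "?v i \<in> inside curve \<longleftrightarrow> Sc i = w" for i
  proof (induction i rule: int_induct[where k = i0])
    case base then show ?case using i0(2) by (simp add: w_def)
  next
    case (step1 i)
    have "Sc (i + 1) = Sc i \<longleftrightarrow> (Sc (i + 1) = w \<longleftrightarrow> Sc i = w)"
      using two[of i] two[of "i + 1"] by metis
    then show ?case using next_side[of i] step1 by blast
  next
    case (step2 i)
    have "Sc i = Sc (i - 1) \<longleftrightarrow> (Sc i = w \<longleftrightarrow> Sc (i - 1) = w)"
      using two[of i] two[of "i - 1"] by metis
    then show ?case using next_side[of "i - 1"] step2 unfolding diff_add_cancel by blast
  qed
  have "ang (Sc k) = ang w * of_int (if Sc k = w then 1 else - 1)" for k
    using two[of k]
  proof
    assume "Sc k = w" then show ?thesis by simp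
  next
    assume "Sc k = w * w"
    then show ?thesis using ang_turn_sq[OF w] turn_sq_neq[OF w] by simp
  qed
  then have "(\<Sum>k\<in>{0..<n}. ang (Sc k)) = ang w * of_int (\<Sum>k\<in>{0..<n}. if Sc k = w then 1 else - 1)"
    by (simp only: of_int_sum sum_distrib_left)
  then have "ang w * of_int (\<Sum>k\<in>{0..<n}. if Sc k = w then 1 else - 1) = ang w * of_int 3"
    using i0(1) by (simp add: w_def)
  moreover have "ang w \<noteq> 0" using ang_cases[of w] by auto
  ultimately have "(\<Sum>k\<in>{0..<n}. if Sc k = w then 1 else - 1 :: int) = 3"
    by (simp only: mult_cancel_left of_int_eq_iff) simp
  moreover have "vertex H u s \<in> inside curve \<longleftrightarrow> s = w" if "(H, u, s) \<in> cyc_corners" for H u s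
    using that in_iff unfolding cyc_corners_def by auto
  ultimately show thesis using that w by blast
qed

end

section \<open>From smooth curves to cycles of edges\<close>

text \<open>The agreement of the derivatives at 0 and 1 gives differentiability at the integers, so
  the closing point of the parametrisation is no longer special and a curve point may be studied
  wherever its parameter lies.\<close>

lemma periodic_extension:
  assumes "smooth_simple_closed_curve S"
  obtains f f' :: "real \<Rightarrow> complex" where "\<forall>t. (f has_vector_derivative f' t) (at t)" "\<forall>t. f' t \<noteq> 0"
    "range f = S" "\<forall>t. f (t + 1) = f t" "\<forall>a b. f a = f b \<longrightarrow> (\<exists>k::int. a = b + of_int k)"
proof -
  obtain \<gamma> where \<gamma>: "simple_path \<gamma>" "pathfinish \<gamma> = pathstart \<gamma>" "path_image \<gamma> = S"
    "\<gamma> C1_differentiable_on {0..1}" "\<forall>t\<in>{0..1}. vector_derivative \<gamma> (at t) \<noteq> 0"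
    "vector_derivative \<gamma> (at 0) = vector_derivative \<gamma> (at 1)"
    using assms unfolding smooth_simple_closed_curve_def by blast
  define D where "D t = vector_derivative \<gamma> (at t)" for t
  have d: "(\<gamma> has_vector_derivative D t) (at t)" if "t \<in> {0..1}" for t
    using \<gamma>(4) that unfolding C1_differentiable_on_eq D_def by (simp add: vector_derivative_works)
  define G where "G = (\<lambda>(i::int) t. \<gamma> (t - of_int i))"
  define G' where "G' = (\<lambda>(i::int) t. D (t - of_int i))"
  have end_match: "\<gamma> 1 = \<gamma> 0" using \<gamma>(2) by (simp add: pathfinish_def pathstart_def)
  have der: "((\<lambda>t. G \<lfloor>t\<rfloor> t) has_vector_derivative G' \<lfloor>t\<rfloor> t) (at t)" for t
  proof (rule glue_derivative)
    fix i :: int and t :: real assume t: "t \<in> {of_int i..of_int (i + 1)}"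
    have "((\<gamma> \<circ> (\<lambda>t. t - of_int i)) has_vector_derivative 1 *\<^sub>R D (t - of_int i)) (at t within {of_int i..of_int (i + 1)})"
    proof (rule vector_diff_chain_within)
      show "((\<lambda>t. t - of_int i) has_vector_derivative 1) (at t within {of_int i..of_int (i + 1)})"
        by (auto intro!: derivative_eq_intros)
      show "(\<gamma> has_vector_derivative D (t - of_int i)) (at (t - of_int i) within (\<lambda>t. t - of_int i) ` {of_int i..of_int (i + 1)})"
        by (rule has_vector_derivative_at_within[OF d]) (use t in auto)
    qed
    then show "(G i has_vector_derivative G' i t) (at t within {of_int i..of_int (i + 1)})"
      unfolding G_def G'_def o_def by simp
  next
    show "G i (of_int (i + 1)) = G (i + 1) (of_int (i + 1))" for i
      by (simp add: G_def end_match)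
    show "G' i (of_int (i + 1)) = G' (i + 1) (of_int (i + 1))" for i
      by (simp add: G'_def D_def \<gamma>(6))
  qed
  define f where "f = (\<lambda>t. G \<lfloor>t\<rfloor> t)"
  have f: "f t = \<gamma> (frac t)" for t by (simp add: f_def G_def frac_def)
  have fr: "frac t \<in> {0..<1}" for t :: real using frac_lt_1[of t] by simp
  show thesis
  proof (rule that[of f "\<lambda>t. G' \<lfloor>t\<rfloor> t"])
    show "\<forall>t. (f has_vector_derivative G' \<lfloor>t\<rfloor> t) (at t)" unfolding f_def using der by blast
    show "\<forall>t. G' \<lfloor>t\<rfloor> t \<noteq> 0"
    proof
      fix t :: real
      have "t - of_int \<lfloor>t\<rfloor> \<in> {0..1}" by simp linarith
      then show "G' \<lfloor>t\<rfloor> t \<noteq> 0" using \<gamma>(5) unfolding G'_def D_def by blast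
    qed
    show "\<forall>t. f (t + 1) = f t" unfolding f by (simp add: frac_def)
    show "range f = S"
    proof -
      have "\<gamma> x \<in> range f" if x: "x \<in> {0..1}" for x
      proof (cases "x = 1")
        case True
        then show ?thesis using f[of 0] end_match by (metis frac_of_int of_int_0 rangeI)
      next
        case False
        then have "frac x = x" using x by (simp add: frac_eq)
        then show ?thesis using f[of x] by (metis rangeI)
      qed
      moreover have "f t \<in> \<gamma> ` {0..1}" for t using f[of t] fr[of t] by auto
      ultimately show ?thesis using \<gamma>(3) unfolding path_image_def by blast
    qed
    show "\<forall>a b. f a = f b \<longrightarrow> (\<exists>k::int. a = b + of_int k)"
    proof (intro allI impI)
      fix a b assume "f a = f b"
      then have "\<gamma> (frac a) = \<gamma> (frac b)" by (simp add: f)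
      then have "frac a = frac b"
        using \<gamma>(1) fr[of a] fr[of b] unfolding simple_path_def loop_free_def by fastforce
      then have "a = b + of_int (\<lfloor>a\<rfloor> - \<lfloor>b\<rfloor>)" by (simp add: frac_def)
      then show "\<exists>k::int. a = b + of_int k" by blast
    qed
  qed
qed

text \<open>Excludes that a remote stretch of the curve returns near a given point: the image of the
  remaining parameters is compact and misses the point.\<close>

lemma curve_near_point:
  fixes f :: "real \<Rightarrow> complex"
  assumes cont: "continuous_on UNIV f" and per: "\<forall>t. f (t + 1) = f t"
    and inj: "\<forall>a b. f a = f b \<longrightarrow> (\<exists>k::int. a = b + of_int k)" and "\<epsilon> > 0"
  obtains \<eta> where "\<eta> > 0" "\<forall>z\<in>range f. dist z (f t0) < \<eta> \<longrightarrow> (\<exists>t. t0 - \<epsilon> < t \<and> t < t0 + \<epsilon> \<and> f t = z)"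
proof -
  \<comment> \<open>One period centred at \<open>t0\<close>, without the \<epsilon>-neighbourhood of
    \<open>t0\<close>.\<close>
  define J where "J = {t0 - 1/2..t0 + 1/2} - {t0 - \<epsilon><..<t0 + \<epsilon>}"
  have "compact J" unfolding J_def by (intro compact_diff) auto
  then have "compact (f ` J)" using compact_continuous_image continuous_on_subset[OF cont] by blast
  then have "closed (f ` J)" by (rule compact_imp_closed)
  have "f t0 \<notin> f ` J"
  proof
    assume "f t0 \<in> f ` J"
    then obtain t where t: "t \<in> J" "f t0 = f t" by blast
    then obtain k :: int where k: "t0 = t + of_int k" using inj by blast
    have "t \<in> {t0 - 1/2..t0 + 1/2}" using t(1) unfolding J_def by blast
    then have "real_of_int k < 1" "- 1 < real_of_int k" using k by simp_all
    then have "k = 0" by linarith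
    then show False using t(1) k \<open>\<epsilon> > 0\<close> unfolding J_def by simp
  qed
  then obtain \<eta> where \<eta>: "\<eta> > 0" "\<forall>y\<in>f ` J. \<eta> \<le> dist (f t0) y"
    using separate_point_closed[OF \<open>closed (f ` J)\<close>, of "f t0"] by auto
  have per': "f (t + of_int k) = f t" for t and k :: int
  proof (induction k rule: int_induct[where k = 0])
    case base then show ?case by simp
  next
    case (step1 k)
    have "f (t + of_int (k + 1)) = f ((t + of_int k) + 1)" by (simp add: add.assoc)
    then show ?case using step1 per by simp
  next
    case (step2 k)
    have "f (t + of_int k) = f ((t + of_int (k - 1)) + 1)" by simp
    also have "\<dots> = f (t + of_int (k - 1))" using per by blast
    finally show ?case using step2 by simp
  qed
  have "\<exists>t. t0 - \<epsilon> < t \<and> t < t0 + \<epsilon> \<and> f t = z" if z: "z \<in> range f" "dist z (f t0) < \<eta>" for z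
  proof -
    obtain a where a: "z = f a" using z(1) by blast
    define k where "k = \<lfloor>t0 + 1/2 - a\<rfloor>"
    have k: "of_int k \<le> t0 + 1/2 - a" "t0 + 1/2 - a < of_int k + 1" unfolding k_def by linarith+
    define t where "t = a + of_int k"
    have t: "t \<in> {t0 - 1/2..t0 + 1/2}" using k unfolding t_def by simp
    have ft: "f t = z" unfolding t_def per' a ..
    have "t \<notin> J"
    proof
      assume "t \<in> J"
      then have "z \<in> f ` J" using ft by blast
      then have "\<eta> \<le> dist (f t0) z" using \<eta>(2) by (rule bspec[rotated])
      then show False using z(2) by (simp add: dist_commute)
    qed
    then have "t \<in> {t0 - \<epsilon><..<t0 + \<epsilon>}" using t unfolding J_def by blast
    then show ?thesis using ft by (intro exI[of _ t]) simp
  qed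
  then show thesis using that \<eta>(1) by blast
qed

context hexgrid
begin

section \<open>The links near the midpoint of an edge\<close>

lemma arc_closed: "turn s \<Longrightarrow> closed (arc H u s)"
  unfolding arc_param
  by (intro compact_imp_closed compact_continuous_image continuous_intros) auto

text \<open>Coordinates centred at the midpoint of the edge: the crossing direction is the positive
  real axis and the edge itself lies on the imaginary axis.\<close>

definition at_mid :: "complex \<Rightarrow> complex \<Rightarrow> complex \<Rightarrow> complex" where
  "at_mid P u z = (z - (P + u / 2)) / u"

lemma turn_Im_sq: "turn s \<Longrightarrow> Im s * Im s = 3 / 4"
  using turn_Re_Im(2) by (simp add: power2_eq_square)

text \<open>The circles around the two ends of the edge touch the real axis at 0 from opposite
  sides, and the sign of \<open>Im s\<close> tells which one is meant.\<close>

lemma at_mid_circle: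
  assumes "(P, u) \<in> edges" "turn s" "dist z (vertex (P + u) u s) = r"
  shows "(Re (at_mid P u z))\<^sup>2 + (Im (at_mid P u z))\<^sup>2 = 2 * Im s / 3 * Im (at_mid P u z)"
proof -
  have u: "u \<in> dirs" "u \<noteq> 0" using assms(1) dirs_nz by (auto simp: edges_def)
  define \<zeta> where "\<zeta> = at_mid P u z"
  have v: "vertex (P + u) u s = P + u / 2 + u * ((1 + 2 * s) / 6)"
    unfolding vertex_def by (simp add: field_simps)
  have "z = P + u / 2 + u * \<zeta>" using u by (simp add: \<zeta>_def at_mid_def)
  then have "dist z (vertex (P + u) u s) = cmod (u * (\<zeta> - (1 + 2 * s) / 6))"
    unfolding v dist_norm by (simp add: right_diff_distrib)
  then have "r = 2 * sqrt 3 * r * cmod (\<zeta> - (1 + 2 * s) / 6)"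
    unfolding assms(3) norm_mult dirs_norm[OF u(1)] .
  then have "r\<^sup>2 = (2 * sqrt 3 * r * cmod (\<zeta> - (1 + 2 * s) / 6))\<^sup>2" by (rule arg_cong)
  moreover have "(2 * sqrt 3)\<^sup>2 = (12::real)" by (simp add: power_mult_distrib)
  moreover have "(2 * sqrt 3 * r * C)\<^sup>2 = (2 * sqrt 3)\<^sup>2 * (r\<^sup>2 * C\<^sup>2)" for C
    by (simp only: power_mult_distrib mult_ac)
  ultimately have "r\<^sup>2 = 12 * (r\<^sup>2 * (cmod (\<zeta> - (1 + 2 * s) / 6))\<^sup>2)" by (simp only:)
  then have "r\<^sup>2 * 1 = r\<^sup>2 * (12 * (cmod (\<zeta> - (1 + 2 * s) / 6))\<^sup>2)" by (simp only: mult_ac)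
  then have n: "12 * (cmod (\<zeta> - (1 + 2 * s) / 6))\<^sup>2 = 1" using r_pos by simp
  have "Re ((1 + 2 * s) / 6) = 0" "Im ((1 + 2 * s) / 6) = Im s / 3"
    using turn_Re_Im(1)[OF assms(2)] by simp_all
  then have "(cmod (\<zeta> - (1 + 2 * s) / 6))\<^sup>2 = (Re \<zeta>)\<^sup>2 + (Im \<zeta> - Im s / 3)\<^sup>2"
    by (simp only: cmod_power2 minus_complex.sel diff_zero)
  also have "\<dots> = (Re \<zeta>)\<^sup>2 + (Im \<zeta>)\<^sup>2 - 2 * Im s / 3 * Im \<zeta> + (Im s * Im s) / 9"
    by (simp add: power2_eq_square algebra_simps)
  finally show ?thesis using n turn_Im_sq[OF assms(2)] unfolding \<zeta>_def by simp
qed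

text \<open>The real part is half the second coordinate of the point on its link, hence vanishes
  only at the start.\<close>

lemma at_mid_after:
  assumes "(P, u) \<in> edges" "turn s" "z \<in> arc (P + u) u s"
  shows "dist z (vertex (P + u) u s) = r" "Re (at_mid P u z) \<ge> 0" "z \<noteq> P + u / 2 \<Longrightarrow> Re (at_mid P u z) > 0"
proof -
  have u: "u \<in> dirs" "u \<noteq> 0" using assms(1) dirs_nz by (auto simp: edges_def)
  show "dist z (vertex (P + u) u s) = r" using arc_on_circle[OF assms(3) u(1) assms(2)] .
  obtain a b where z: "z = pt (P + u) u s a b" "0 \<le> a" "0 \<le> b" "quad a b = 1 / 4"
    using assms(3) unfolding arc_def by blast
  have m: "P + u / 2 = pt (P + u) u s (1/2) 0" unfolding pt_start by simp
  have "z - (P + u / 2) = u * (- ((1 + 2 * s) / 3) * (of_real (a - 1/2) + of_real b * s))"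
    unfolding z(1) m pt_radial[OF assms(2)] radial_def by (simp add: algebra_simps)
  then have "at_mid P u z = - ((1 + 2 * s) / 3) * (of_real (a - 1/2) + of_real b * s)"
    using u by (simp add: at_mid_def)
  moreover have "Re ((1 + 2 * s) / 3) = 0" "Im ((1 + 2 * s) / 3) = 2 * Im s / 3"
    using turn_Re_Im(1)[OF assms(2)] by simp_all
  ultimately have "Re (at_mid P u z) = 2 / 3 * (Im s * Im s) * b" by simp
  then have R: "Re (at_mid P u z) = b / 2" using turn_Im_sq[OF assms(2)] by simp
  then show "Re (at_mid P u z) \<ge> 0" using z by simp
  show "Re (at_mid P u z) > 0" if ne: "z \<noteq> P + u / 2"
  proof (rule ccontr)
    assume "\<not> ?thesis"
    then have b: "b = 0" using R z by simp
    then have "a\<^sup>2 = (1/2)\<^sup>2" using z(4) by (simp add: quad_def power2_eq_square)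
    then have "a = 1/2" using z(2) by (simp only: power2_eq_iff_nonneg)
    with z(1) m b have "z = P + u / 2" by (simp only:)
    then show False using ne by simp
  qed
qed

text \<open>The mirror image of \<open>at_mid_after\<close>: the real part is minus half the first
  coordinate, and the link ends at the midpoint.\<close>

lemma at_mid_before:
  assumes "(P, u) \<in> edges" "turn s" "z \<in> arc P (u * s * s) s"
  shows "dist z (vertex (P + u) u s) = r" "Re (at_mid P u z) \<le> 0" "z \<noteq> P + u / 2 \<Longrightarrow> Re (at_mid P u z) < 0"
proof -
  have u: "u \<in> dirs" "u \<noteq> 0" "u * s * s \<in> dirs"
    using assms(1,2) dirs_nz dirs_turn by (auto simp: edges_def)
  have us: "u * s * s * s = u" using turn_cube[OF assms(2)] by (simp add: mult.assoc)
  have "vertex (P + u) u s = vertex P (u * s * s) s"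
    using vertex_next[OF assms(2), of P "u * s * s"] unfolding us .
  then show "dist z (vertex (P + u) u s) = r" using arc_on_circle[OF assms(3) u(3) assms(2)] by simp
  obtain a b where z: "z = pt P (u * s * s) s a b" "0 \<le> a" "0 \<le> b" "quad a b = 1 / 4"
    using assms(3) unfolding arc_def by blast
  have m: "P + u / 2 = pt P (u * s * s) s 0 (1/2)" unfolding pt_end us ..
  have "z - (P + u / 2) = radial (u * s * s) s * (of_real a + of_real (b - 1/2) * s)"
    unfolding z(1) m pt_radial[OF assms(2)] by (simp add: algebra_simps)
  also have "\<dots> = u * (- ((1 + 2 * s) / 3) * (s * s * (of_real a + of_real (b - 1/2) * s)))"
    unfolding radial_def by simp
  also have "s * s * (of_real a + of_real (b - 1/2) * s) = of_real (b - 1/2) - of_real a - of_real a * s"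
    by (simp add: algebra_simps turn_sq[OF assms(2)] turn_sq_left[OF assms(2)])
  finally have "at_mid P u z = - ((1 + 2 * s) / 3) * (of_real (b - 1/2) - of_real a - of_real a * s)"
    using u by (simp add: at_mid_def)
  moreover have "Re ((1 + 2 * s) / 3) = 0" "Im ((1 + 2 * s) / 3) = 2 * Im s / 3"
    using turn_Re_Im(1)[OF assms(2)] by simp_all
  ultimately have "Re (at_mid P u z) = - (2 / 3 * (Im s * Im s) * a)" by simp
  then have R: "Re (at_mid P u z) = - (a / 2)" using turn_Im_sq[OF assms(2)] by simp
  then show "Re (at_mid P u z) \<le> 0" using z by simp
  show "Re (at_mid P u z) < 0" if ne: "z \<noteq> P + u / 2"
  proof (rule ccontr)
    assume "\<not> ?thesis"
    then have a: "a = 0" using R z by simp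
    then have "b\<^sup>2 = (1/2)\<^sup>2" using z(4) by (simp add: quad_def power2_eq_square)
    then have "b = 1/2" using z(3) by (simp only: power2_eq_iff_nonneg)
    with z(1) m a have "z = P + u / 2" by (simp only:)
    then show False using ne by simp
  qed
qed

text \<open>The finitely many arcs that avoid the midpoint form a closed set at positive distance
  from it; the others start or end at this edge.\<close>

lemma near_mid:
  assumes K: "finite K" "K \<subseteq> corners" and e: "(P, u) \<in> edges"
  obtains \<eta> where "\<eta> > 0" "\<forall>z\<in>(\<Union>c\<in>K. arcc c). dist z (P + u / 2) < \<eta> \<longrightarrow>
    (\<exists>s. turn s \<and> ((P + u, u, s) \<in> K \<and> z \<in> arc (P + u) u s \<or> (P, u * s * s, s) \<in> K \<and> z \<in> arc P (u * s * s) s))"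
proof -
  define m where "m = P + u / 2"
  define R where "R = (\<Union>c\<in>{c\<in>K. m \<notin> arcc c}. arcc c)"
  have "closed R" unfolding R_def
    by (rule closed_UN) (use K arc_closed in \<open>auto simp: corners_def\<close>)
  moreover have "m \<notin> R" unfolding R_def by auto
  ultimately obtain \<eta> where \<eta>: "\<eta> > 0" "\<forall>y\<in>R. \<eta> \<le> dist m y"
    using separate_point_closed[of R m] by auto
  have "\<exists>s. turn s \<and> ((P + u, u, s) \<in> K \<and> z \<in> arc (P + u) u s \<or> (P, u * s * s, s) \<in> K \<and> z \<in> arc P (u * s * s) s)"
    if z: "z \<in> (\<Union>c\<in>K. arcc c)" "dist z m < \<eta>" for z
  proof -
    obtain H w s where c: "(H, w, s) \<in> K" "z \<in> arc H w s" using z(1) by auto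
    then have co: "is_corner H w s" using K by (auto simp: corners_def)
    have "m \<in> arc H w s"
    proof (rule ccontr)
      assume "m \<notin> arc H w s"
      then have "z \<in> R" using c unfolding R_def by force
      then have "\<eta> \<le> dist m z" using \<eta>(2) by (rule bspec[rotated])
      then show False using z(2) by (simp add: dist_commute)
    qed
    then have "(P, u) = (H - w, w) \<or> (P, u) = (H, w * s)"
      using mid_in_arc[OF e co] by (simp add: mid_def m_def)
    then show ?thesis
    proof
      assume "(P, u) = (H - w, w)"
      then show ?thesis using c co by (intro exI[of _ s]) simp
    next
      assume "(P, u) = (H, w * s)"
      moreover have "w * s * s * s = w" using turn_cube[of s] co by (simp add: mult.assoc)
      ultimately have "P = H" "u * s * s = w" by simp_all
      then have "(P, u * s * s, s) \<in> K \<and> z \<in> arc P (u * s * s) s" using c by (simp only: simp_thms)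
      then show ?thesis using co by blast
    qed
  qed
  then show thesis using that \<eta>(1) unfolding m_def by blast
qed

end

section \<open>A differentiable curve through the tangency point of two circles\<close>

lemma constant_sign:
  fixes Y :: "real \<Rightarrow> real"
  assumes "continuous_on {a<..<b} Y" "\<forall>t\<in>{a<..<b}. Y t \<noteq> 0"
  obtains \<sigma> where "\<forall>t\<in>{a<..<b}. \<sigma> * Y t > 0"
proof -
  have c: "connected (Y ` {a<..<b})" using assms(1) by (intro connected_continuous_image) auto
  have "0 \<notin> Y ` {a<..<b}" using assms(2) by auto
  then have no: "\<not> (\<exists>t1\<in>{a<..<b}. \<exists>t2\<in>{a<..<b}. Y t1 \<le> 0 \<and> 0 \<le> Y t2)"
    using connectedD_interval[OF c] by blast
  show thesis
  proof (cases "\<exists>t\<in>{a<..<b}. Y t \<le> 0")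
    case True
    then have "\<forall>t\<in>{a<..<b}. Y t < 0" using no by (meson not_le)
    then show thesis by (intro that[of "- 1"]) simp
  next
    case False
    then show thesis by (intro that[of 1]) (simp add: not_le)
  qed
qed

text \<open>X changes sign at \<open>t0\<close> because its derivative is nonzero, and Y keeps its
  sign on either side. The sign of X then distinguishes the two branches whichever way the parameter
  runs, and Y tells which circle each branch follows.\<close>

lemma branches:
  fixes X Y :: "real \<Rightarrow> real"
  assumes X: "(X has_real_derivative c) (at t0)" "c \<noteq> 0" "X t0 = 0"
    and Y: "continuous_on UNIV Y" "\<delta>0 > 0" "\<forall>t. t \<noteq> t0 \<and> \<bar>t - t0\<bar> < \<delta>0 \<longrightarrow> Y t \<noteq> 0"
  obtains \<delta> \<sigma> \<sigma>' where "\<delta> > 0" "\<forall>t. \<bar>t - t0\<bar> < \<delta> \<and> X t > 0 \<longrightarrow> \<sigma> * Y t > 0"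
    "\<forall>t. \<bar>t - t0\<bar> < \<delta> \<and> X t < 0 \<longrightarrow> \<sigma>' * Y t > 0"
    "\<forall>\<epsilon>>0. \<exists>t. \<bar>t - t0\<bar> < \<epsilon> \<and> X t > 0" "\<forall>\<epsilon>>0. \<exists>t. \<bar>t - t0\<bar> < \<epsilon> \<and> X t < 0"
proof -
  have d: "((\<lambda>t. c * X t) has_real_derivative c * c) (at t0)" using X(1) by (auto intro!: derivative_eq_intros)
  have cc: "0 < c * c" using X(2) by (simp add: zero_less_mult_iff linorder_neq_iff disj_commute)
  obtain d1 where d1: "d1 > 0" "\<forall>h>0. h < d1 \<longrightarrow> c * X t0 < c * X (t0 + h)"
    using DERIV_pos_inc_right[OF d cc] by blast
  obtain d2 where d2: "d2 > 0" "\<forall>h>0. h < d2 \<longrightarrow> c * X (t0 - h) < c * X t0"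
    using DERIV_pos_inc_left[OF d cc] by blast
  define \<delta> where "\<delta> = min \<delta>0 (min d1 d2)"
  have \<delta>: "\<delta> > 0" using d1 d2 Y(2) by (simp add: \<delta>_def)
  have right: "c * X t > 0" if "t0 < t" "t < t0 + \<delta>" for t
    using d1(2)[rule_format, of "t - t0"] that X(3) by (simp add: \<delta>_def)
  have left: "c * X t < 0" if "t < t0" "t0 - \<delta> < t" for t
    using d2(2)[rule_format, of "t0 - t"] that X(3) by (simp add: \<delta>_def)
  have "\<forall>t\<in>{t0<..<t0 + \<delta>}. Y t \<noteq> 0" "\<forall>t\<in>{t0 - \<delta><..<t0}. Y t \<noteq> 0"
    using Y(3) by (auto simp: \<delta>_def)
  then obtain \<sigma> \<sigma>' where \<sigma>: "\<forall>t\<in>{t0<..<t0 + \<delta>}. \<sigma> * Y t > 0" "\<forall>t\<in>{t0 - \<delta><..<t0}. \<sigma>' * Y t > 0"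
    using constant_sign continuous_on_subset[OF Y(1)] by (metis subset_UNIV)
  have R: "\<forall>t. \<bar>t - t0\<bar> < \<delta> \<and> c * X t > 0 \<longrightarrow> \<sigma> * Y t > 0"
  proof (intro allI impI)
    fix t assume t: "\<bar>t - t0\<bar> < \<delta> \<and> c * X t > 0"
    have "\<not> t < t0"
    proof
      assume "t < t0"
      then have "c * X t < 0" using t by (intro left) auto
      then show False using t by simp
    qed
    moreover have "t \<noteq> t0" using t X(3) by auto
    ultimately have "t \<in> {t0<..<t0 + \<delta>}" using t by auto
    then show "\<sigma> * Y t > 0" using \<sigma> by blast
  qed
  have L: "\<forall>t. \<bar>t - t0\<bar> < \<delta> \<and> c * X t < 0 \<longrightarrow> \<sigma>' * Y t > 0"
  proof (intro allI impI)
    fix t assume t: "\<bar>t - t0\<bar> < \<delta> \<and> c * X t < 0"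
    have "\<not> t0 < t"
    proof
      assume "t0 < t"
      then have "c * X t > 0" using t by (intro right) auto
      then show False using t by simp
    qed
    moreover have "t \<noteq> t0" using t X(3) by auto
    ultimately have "t \<in> {t0 - \<delta><..<t0}" using t by auto
    then show "\<sigma>' * Y t > 0" using \<sigma> by blast
  qed
  have ex: "\<exists>t. \<bar>t - t0\<bar> < \<epsilon> \<and> c * X t > 0" "\<exists>t. \<bar>t - t0\<bar> < \<epsilon> \<and> c * X t < 0" if "\<epsilon> > 0" for \<epsilon>
  proof -
    define h where "h = min \<epsilon> \<delta> / 2"
    have h: "0 < h" "h < \<epsilon>" "h < \<delta>" using that \<delta> by (auto simp: h_def min_def)
    show "\<exists>t. \<bar>t - t0\<bar> < \<epsilon> \<and> c * X t > 0"
      by (rule exI[of _ "t0 + h"]) (use h right[of "t0 + h"] in simp)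
    show "\<exists>t. \<bar>t - t0\<bar> < \<epsilon> \<and> c * X t < 0"
      by (rule exI[of _ "t0 - h"]) (use h left[of "t0 - h"] in simp)
  qed
  show thesis
  proof (cases "c > 0")
    case True
    then have "c * X t > 0 \<longleftrightarrow> X t > 0" "c * X t < 0 \<longleftrightarrow> X t < 0" for t
      by (simp_all add: zero_less_mult_iff mult_less_0_iff)
    then show thesis using that[of \<delta> \<sigma> \<sigma>'] \<delta> R L ex by simp
  next
    case False
    then have "c * X t > 0 \<longleftrightarrow> X t < 0" "c * X t < 0 \<longleftrightarrow> X t > 0" for t
      using X(2) by (simp_all add: zero_less_mult_iff mult_less_0_iff)
    then show thesis using that[of \<delta> \<sigma>' \<sigma>] \<delta> R L ex by simp
  qed
qed

text \<open>The equation in the last assumption describes two circles touching the real axis at 0.\<close>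

lemma tangential:
  fixes X Y :: "real \<Rightarrow> real"
  assumes X: "(X has_real_derivative c) (at t0)" "X t0 = 0" and Y: "(Y has_real_derivative d) (at t0)" "Y t0 = 0"
    and "\<delta> > 0" "\<forall>t. \<bar>t - t0\<bar> < \<delta> \<longrightarrow> \<bar>Y t\<bar> = k * ((X t)\<^sup>2 + (Y t)\<^sup>2)"
  shows "d = 0"
proof -
  define q where "q t = k * ((X t)\<^sup>2 + (Y t)\<^sup>2)" for t
  have "(q has_real_derivative 0) (at t0)"
    unfolding q_def[abs_def] using X Y by (auto intro!: derivative_eq_intros)
  then have q: "((\<lambda>t. \<bar>(q t - q t0) / (t - t0)\<bar>) \<longlongrightarrow> \<bar>0\<bar>) (at t0)"
    unfolding has_field_derivative_iff by (rule tendsto_rabs)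
  have y: "((\<lambda>t. \<bar>(Y t - Y t0) / (t - t0)\<bar>) \<longlongrightarrow> \<bar>d\<bar>) (at t0)"
    using Y(1) unfolding has_field_derivative_iff by (rule tendsto_rabs)
  have "\<forall>\<^sub>F t in at t0. \<bar>(Y t - Y t0) / (t - t0)\<bar> = \<bar>(q t - q t0) / (t - t0)\<bar>"
    unfolding eventually_at
  proof (intro exI[of _ \<delta>] conjI ballI impI)
    fix t assume "t \<noteq> t0 \<and> dist t t0 < \<delta>"
    then have "\<bar>Y t\<bar> = q t" using assms(6) by (simp add: dist_real_def q_def)
    then have "\<bar>Y t\<bar> = \<bar>q t\<bar>" by (metis abs_idempotent)
    moreover have "q t0 = 0" using X(2) Y(2) by (simp add: q_def)
    ultimately show "\<bar>(Y t - Y t0) / (t - t0)\<bar> = \<bar>(q t - q t0) / (t - t0)\<bar>"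
      using Y(2) by (simp add: abs_divide)
  qed (use assms(5) in simp)
  then have "((\<lambda>t. \<bar>(Y t - Y t0) / (t - t0)\<bar>) \<longlongrightarrow> \<bar>0\<bar>) (at t0)"
    using q by (rule tendsto_cong[THEN iffD2])
  then show ?thesis using tendsto_unique[OF _ y] by force
qed

context hexgrid
begin

lemma arc_near_ends:
  assumes "is_corner H u s" "\<eta> > 0"
  shows "\<exists>z\<in>open_arc H u s. dist z (H - u / 2) < \<eta>" "\<exists>z\<in>open_arc H u s. dist z (H + u * s / 2) < \<eta>"
proof -
  have s: "turn s" using assms by blast
  define k where "k = (\<lambda>\<tau>. vertex H u s + radial u s / 2 * cis (ang s * \<tau>))"
  have "continuous_on UNIV k" unfolding k_def by (intro continuous_intros)
  then have c: "isCont k x" for x by (simp add: continuous_on_eq_continuous_at)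
  have k01: "k 0 = H - u / 2" "k 1 = H + u * s / 2"
    using arc_param_ends[OF s, of H u] turn_ang[OF s, symmetric] by (simp_all add: k_def)
  obtain d where d: "d > 0" "\<forall>x. dist x 0 < d \<longrightarrow> dist (k x) (k 0) < \<eta>"
    using c[of 0] assms(2) unfolding continuous_at_eps_delta by blast
  obtain d' where d': "d' > 0" "\<forall>x. dist x 1 < d' \<longrightarrow> dist (k x) (k 1) < \<eta>"
    using c[of 1] assms(2) unfolding continuous_at_eps_delta by blast
  have op: "k \<tau> \<in> open_arc H u s" if "0 < \<tau>" "\<tau> < 1" for \<tau>
    unfolding k_def by (rule open_arc_point[OF assms(1) that])
  define a where "a = min d 1 / 2"
  have "0 < a" "a < 1" "dist a 0 < d" using d(1) by (auto simp: a_def dist_real_def min_def)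
  then show "\<exists>z\<in>open_arc H u s. dist z (H - u / 2) < \<eta>"
    using d(2) op unfolding k01[symmetric] by blast
  define b where "b = 1 - min d' 1 / 2"
  have "0 < b" "b < 1" "dist b 1 < d'" using d'(1) by (auto simp: b_def dist_real_def min_def)
  then show "\<exists>z\<in>open_arc H u s. dist z (H + u * s / 2) < \<eta>"
    using d'(2) op unfolding k01[symmetric] by blast
qed

lemma turn_eq_sign:
  assumes "turn s" "turn s'" "Im s * y > 0" "Im s' * y > 0"
  shows "s = s'"
proof -
  have "(Im s)\<^sup>2 = (Im s')\<^sup>2" "Re s = Re s'"
    using turn_Re_Im[OF assms(1)] turn_Re_Im[OF assms(2)] by simp_all
  moreover have "Im s \<noteq> - Im s'" using assms(3,4) by auto
  ultimately show ?thesis by (simp add: complex_eq_iff power2_eq_iff)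
qed

text \<open>The curve passes each midpoint once and with a tangent, hence leaves it along exactly one of the
  two links on either side of the edge.\<close>

lemma unique_links_at_mid:
  assumes K: "finite K" "K \<subseteq> corners" and S: "S = (\<Union>c\<in>K. arcc c)" "smooth_simple_closed_curve S"
    and e: "(P, u) \<in> edges" and m: "P + u / 2 \<in> S"
  shows "\<exists>!s. turn s \<and> (P + u, u, s) \<in> K" "\<exists>!s. turn s \<and> (P, u * s * s, s) \<in> K"
proof -
  define m where "m = P + u / 2"
  have u: "u \<in> dirs" "u \<noteq> 0" using e dirs_nz by (auto simp: edges_def)
  obtain f f' where f: "\<forall>t. (f has_vector_derivative f' t) (at t)" "\<forall>t. f' t \<noteq> 0" "range f = S"
    and per: "\<forall>t. f (t + 1) = f t" and inj: "\<forall>a b. f a = f b \<longrightarrow> (\<exists>k::int. a = b + of_int k)"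
    using periodic_extension[OF S(2)] by blast
  obtain t0 where t0: "f t0 = m" using m f(3) unfolding m_def by (metis rangeE)
  have fc: "continuous_on UNIV f"
    using f(1) by (meson continuous_at_imp_continuous_on has_vector_derivative_continuous)
  obtain \<eta> where \<eta>: "\<eta> > 0" "\<forall>z\<in>S. dist z m < \<eta> \<longrightarrow>
    (\<exists>s. turn s \<and> ((P + u, u, s) \<in> K \<and> z \<in> arc (P + u) u s \<or> (P, u * s * s, s) \<in> K \<and> z \<in> arc P (u * s * s) s))"
    using near_mid[OF K e] unfolding m_def S(1) by blast
  define \<zeta> where "\<zeta> t = at_mid P u (f t)" for t
  define X where "X t = Re (\<zeta> t)" for t
  define Y where "Y t = Im (\<zeta> t)" for t
  have "isCont f t0" using fc by (simp add: continuous_on_eq_continuous_at)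
  then obtain \<delta>1 where \<delta>1: "\<delta>1 > 0" "\<forall>t. dist t t0 < \<delta>1 \<longrightarrow> dist (f t) m < \<eta>"
    using \<eta>(1) unfolding continuous_at_eps_delta t0 by blast
  have near: "\<exists>s. turn s \<and> ((P + u, u, s) \<in> K \<and> f t \<in> arc (P + u) u s \<or> (P, u * s * s, s) \<in> K \<and> f t \<in> arc P (u * s * s) s)"
    if "\<bar>t - t0\<bar> < \<delta>1" for t
  proof -
    have "f t \<in> S" "dist (f t) m < \<eta>" using \<delta>1(2) that f(3) by (auto simp: dist_real_def)
    then show ?thesis using \<eta>(2) by blast
  qed
  have circ: "\<exists>s. turn s \<and> (X t)\<^sup>2 + (Y t)\<^sup>2 = 2 * Im s / 3 * Y t" if "\<bar>t - t0\<bar> < \<delta>1" for t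
  proof -
    obtain s where s: "turn s" "f t \<in> arc (P + u) u s \<or> f t \<in> arc P (u * s * s) s"
      using near[OF \<open>\<bar>t - t0\<bar> < \<delta>1\<close>] by blast
    then have "dist (f t) (vertex (P + u) u s) = r" using at_mid_after(1)[OF e s(1)] at_mid_before(1)[OF e s(1)] by blast
    from at_mid_circle[OF e s(1) this] s(1) show ?thesis unfolding X_def Y_def \<zeta>_def by blast
  qed
  have \<zeta>_0: "\<zeta> t = 0 \<longleftrightarrow> f t = m" for t using u by (simp add: \<zeta>_def at_mid_def m_def)
  have \<zeta>_d: "(\<zeta> has_vector_derivative f' t0 / u) (at t0)"
  proof -
    have "((\<lambda>t. f t - m) has_vector_derivative f' t0) (at t0)"
      using has_vector_derivative_diff[OF f(1)[rule_format, of t0] has_vector_derivative_const[of m]] by simp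
    from bounded_linear.has_vector_derivative[OF bounded_linear_divide[of u] this]
    show ?thesis unfolding \<zeta>_def at_mid_def m_def .
  qed
  have Xd: "(X has_real_derivative Re (f' t0 / u)) (at t0)"
    unfolding X_def[abs_def] using bounded_linear.has_vector_derivative[OF bounded_linear_Re \<zeta>_d]
    by (simp add: has_real_derivative_iff_has_vector_derivative)
  have Yd: "(Y has_real_derivative Im (f' t0 / u)) (at t0)"
    unfolding Y_def[abs_def] using bounded_linear.has_vector_derivative[OF bounded_linear_Im \<zeta>_d]
    by (simp add: has_real_derivative_iff_has_vector_derivative)
  have XY0: "X t0 = 0" "Y t0 = 0" using \<zeta>_0[of t0] t0 by (simp_all add: X_def Y_def)
  have Yc: "continuous_on UNIV Y"
    unfolding Y_def \<zeta>_def at_mid_def using fc u by (intro continuous_intros) auto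
  \<comment> \<open>One equation for both circles, as \<bar>2 Im s / 3\<bar> = 1 /
    \<open>sqrt 3\<close> for either cube root.\<close>
  have absY: "\<bar>Y t\<bar> = sqrt 3 * ((X t)\<^sup>2 + (Y t)\<^sup>2)" if t: "\<bar>t - t0\<bar> < \<delta>1" for t
  proof -
    obtain s where s: "turn s" "(X t)\<^sup>2 + (Y t)\<^sup>2 = 2 * Im s / 3 * Y t" using circ[OF t] by blast
    have "\<bar>Im s\<bar> = sqrt (3 / 4)" using turn_Re_Im(2)[OF s(1)] by (metis real_sqrt_abs)
    also have "\<dots> = sqrt 3 / 2" by (simp add: real_sqrt_divide)
    finally have i: "\<bar>Im s\<bar> = sqrt 3 / 2" .
    have "\<bar>2 * Im s / 3\<bar> = 2 * \<bar>Im s\<bar> / 3" by (simp add: abs_mult)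
    then have "sqrt 3 * \<bar>2 * Im s / 3\<bar> = 1" unfolding i by simp
    then have "\<bar>Y t\<bar> = sqrt 3 * \<bar>2 * Im s / 3 * Y t\<bar>" by (simp add: abs_mult)
    then show ?thesis unfolding s(2)[symmetric] by simp
  qed
  have "Im (f' t0 / u) = 0"
    by (rule tangential[OF Xd XY0(1) Yd XY0(2) \<delta>1(1), of "sqrt 3"]) (use absY in blast)
  then have c: "Re (f' t0 / u) \<noteq> 0" 
  proof -
    have "f' t0 / u \<noteq> 0" using f(2) u by simp
    then show ?thesis using \<open>Im (f' t0 / u) = 0\<close> complex_eq_iff[of "f' t0 / u" 0] by simp
  qed
  \<comment> \<open>Y t = 0 forces X t = 0, so the curve is back at the midpoint; by injectivity
    modulo the period 1 this happens only at \<open>t0\<close> within distance 1.\<close>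
  have Ynz: "\<forall>t. t \<noteq> t0 \<and> \<bar>t - t0\<bar> < min \<delta>1 1 \<longrightarrow> Y t \<noteq> 0"
  proof (intro allI impI notI)
    fix t assume t: "t \<noteq> t0 \<and> \<bar>t - t0\<bar> < min \<delta>1 1" and "Y t = 0"
    then have "(X t)\<^sup>2 + (Y t)\<^sup>2 = 0" using absY[of t] by simp
    then have "\<zeta> t = 0" by (simp add: X_def Y_def complex_eq_iff)
    then have "f t = f t0" using \<zeta>_0 t0 by simp
    then obtain k :: int where "t = t0 + of_int k" using inj by blast
    then have "k = 0" using t by linarith
    then show False using t \<open>t = t0 + of_int k\<close> by simp
  qed
  have d1: "min \<delta>1 1 > 0" using \<delta>1(1) by simp
  obtain \<delta> \<sigma> \<sigma>' where \<delta>: "\<delta> > 0" and pos: "\<forall>t. \<bar>t - t0\<bar> < \<delta> \<and> X t > 0 \<longrightarrow> \<sigma> * Y t > 0"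
    and neg: "\<forall>t. \<bar>t - t0\<bar> < \<delta> \<and> X t < 0 \<longrightarrow> \<sigma>' * Y t > 0"
    and exp: "\<forall>\<epsilon>>0. \<exists>t. \<bar>t - t0\<bar> < \<epsilon> \<and> X t > 0" and exn: "\<forall>\<epsilon>>0. \<exists>t. \<bar>t - t0\<bar> < \<epsilon> \<and> X t < 0"
    using branches[OF Xd c XY0(1) Yc d1 Ynz] .
  obtain \<eta>' where \<eta>': "\<eta>' > 0" "\<forall>z\<in>S. dist z m < \<eta>' \<longrightarrow> (\<exists>t. t0 - \<delta> < t \<and> t < t0 + \<delta> \<and> f t = z)"
    using curve_near_point[OF fc per inj \<delta>, of t0] unfolding f(3) t0 by blast
  have Im_pos: "Im s * Im (at_mid P u z) > 0"
    if "turn s" "dist z (vertex (P + u) u s) = r" "z \<noteq> m" for s z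
  proof -
    have "at_mid P u z \<noteq> 0" using that(3) u by (simp add: at_mid_def m_def)
    then have "(Re (at_mid P u z))\<^sup>2 + (Im (at_mid P u z))\<^sup>2 > 0"
      by (metis cmod_power2 zero_less_norm_iff zero_less_power)
    then show ?thesis unfolding at_mid_circle[OF e that(1,2)] by (simp add: zero_less_mult_iff)
  qed
  have find: "\<exists>t. \<bar>t - t0\<bar> < \<delta> \<and> f t = z" if "z \<in> S" "dist z m < \<eta>'" for z
    using \<eta>'(2) that by (metis abs_diff_less_iff)
  have mK: "m \<notin> open_arc H w s" if "is_corner H w s" for H w s
    using mid_not_open_arc[OF e that] by (simp add: mid_def m_def)
  have sgn: "\<sigma> * y > 0 \<Longrightarrow> Im s * y > 0 \<Longrightarrow> Im s * \<sigma> > 0" for \<sigma> y and s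
    by (auto simp: zero_less_mult_iff)
  show "\<exists>!s. turn s \<and> (P + u, u, s) \<in> K"
  proof -
    have "\<exists>s. turn s \<and> (P + u, u, s) \<in> K"
    proof -
      obtain t where t: "\<bar>t - t0\<bar> < \<delta>1" "X t > 0" using exp \<delta>1(1) by blast
      then show ?thesis using near[OF t(1)] at_mid_before(2)[OF e] unfolding X_def \<zeta>_def by force
    qed
    \<comment> \<open>Every link leaving the midpoint is traced by parameters near \<open>t0\<close>
      with X > 0, where Y has the sign of \<sigma>. This determines the circle and thereby the cube
      root.\<close>
    moreover have "Im s * \<sigma> > 0" if s: "turn s" "(P + u, u, s) \<in> K" for s
    proof -
      have co: "is_corner (P + u) u s" using edge_corner[OF e s(1)] .
      have st: "P + u - u / 2 = m" by (simp add: m_def field_simps)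
      obtain z where z: "z \<in> open_arc (P + u) u s" "dist z m < \<eta>'"
        using arc_near_ends(1)[OF co \<eta>'(1)] unfolding st by blast
      then have za: "z \<in> arc (P + u) u s" "z \<noteq> m" using open_arc_arc mK[OF co] by blast+
      then have "z \<in> S" unfolding S(1) using s(2) by force
      then obtain t where t: "\<bar>t - t0\<bar> < \<delta>" "f t = z" using find z(2) by blast
      have "X t > 0" using at_mid_after(3)[OF e s(1) za(1)] za(2) t(2) by (simp add: X_def \<zeta>_def m_def)
      then have "\<sigma> * Y t > 0" using pos t(1) by blast
      moreover have "Im s * Y t > 0"
        using Im_pos[OF s(1) at_mid_after(1)[OF e s(1) za(1)] za(2)] t(2) by (simp add: Y_def \<zeta>_def)
      ultimately show ?thesis by (rule sgn)
    qed
    ultimately show ?thesis using turn_eq_sign by blast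
  qed
  show "\<exists>!s. turn s \<and> (P, u * s * s, s) \<in> K"
  proof -
    have "\<exists>s. turn s \<and> (P, u * s * s, s) \<in> K"
    proof -
      obtain t where t: "\<bar>t - t0\<bar> < \<delta>1" "X t < 0" using exn \<delta>1(1) by blast
      then show ?thesis using near[OF t(1)] at_mid_after(2)[OF e] unfolding X_def \<zeta>_def by force
    qed
    moreover have "Im s * \<sigma>' > 0" if s: "turn s" "(P, u * s * s, s) \<in> K" for s
    proof -
      have co: "is_corner P (u * s * s) s" using edge_corner'[OF e s(1)] .
      have us: "u * s * s * s = u" using turn_cube[OF s(1)] by (simp add: mult.assoc)
      obtain z where z: "z \<in> open_arc P (u * s * s) s" "dist z m < \<eta>'"
        using arc_near_ends(2)[OF co \<eta>'(1)] unfolding us m_def by blast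
      then have za: "z \<in> arc P (u * s * s) s" "z \<noteq> m" using open_arc_arc mK[OF co] by blast+
      then have "z \<in> S" unfolding S(1) using s(2) by force
      then obtain t where t: "\<bar>t - t0\<bar> < \<delta>" "f t = z" using find z(2) by blast
      have "X t < 0" using at_mid_before(3)[OF e s(1) za(1)] za(2) t(2) by (simp add: X_def \<zeta>_def m_def)
      then have "\<sigma>' * Y t > 0" using neg t(1) by blast
      moreover have "Im s * Y t > 0"
        using Im_pos[OF s(1) at_mid_before(1)[OF e s(1) za(1)] za(2)] t(2) by (simp add: Y_def \<zeta>_def)
      ultimately show ?thesis by (rule sgn)
    qed
    ultimately show ?thesis using turn_eq_sign by blast
  qed
qed

end

section \<open>Following the curve from edge to edge\<close>

lemma iterate_cycle:
  assumes "finite M" "x \<in> M" "\<And>y. y \<in> M \<Longrightarrow> f y \<in> M" "inj_on f M"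
  obtains n :: nat where "n > 0" "(f ^^ n) x = x" "\<forall>i j. i < n \<and> j < n \<and> (f ^^ i) x = (f ^^ j) x \<longrightarrow> i = j"
    "\<forall>k. (f ^^ k) x \<in> M"
proof -
  have M: "(f ^^ k) x \<in> M" for k by (induction k) (use assms in auto)
  have cancel: "(f ^^ (k + d)) x = (f ^^ k) x \<Longrightarrow> (f ^^ d) x = x" for k d
  proof (induction k)
    case (Suc k)
    have "f ((f ^^ (k + d)) x) = f ((f ^^ k) x)" using Suc.prems by simp
    then have "(f ^^ (k + d)) x = (f ^^ k) x" by (rule inj_onD[OF assms(4) _ M M])
    then show ?case by (rule Suc.IH)
  qed simp
  have "\<not> inj (\<lambda>k. (f ^^ k) x)"
  proof
    assume inj: "inj (\<lambda>k. (f ^^ k) x)"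
    have "range (\<lambda>k. (f ^^ k) x) \<subseteq> M" using M by blast
    then have "finite (range (\<lambda>k. (f ^^ k) x))" using assms(1) by (rule finite_subset)
    then show False using finite_imageD[OF _ inj] infinite_UNIV_nat by blast
  qed
  then obtain i' j' where ij': "(f ^^ i') x = (f ^^ j') x" "i' \<noteq> j'" unfolding inj_def by blast
  define i j where "i = min i' j'" "j = max i' j'"
  have ij: "(f ^^ i) x = (f ^^ j) x" "i < j" using ij' by (auto simp: i_j_def min_def max_def)
  then have "(f ^^ (i + (j - i))) x = (f ^^ i) x" by simp
  then have "(f ^^ (j - i)) x = x" by (rule cancel)
  then have ex: "\<exists>n. n > 0 \<and> (f ^^ n) x = x" using ij(2) by (intro exI[of _ "j - i"]) simp
  define n where "n = (LEAST n. n > 0 \<and> (f ^^ n) x = x)"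
  have n: "n > 0" "(f ^^ n) x = x" using LeastI_ex[OF ex] unfolding n_def by auto
  have least: "n \<le> k" if "k > 0" "(f ^^ k) x = x" for k
    unfolding n_def by (rule Least_le) (use that in auto)
  have aux: False if "i < j" "j < n" "(f ^^ i) x = (f ^^ j) x" for i j
  proof -
    have "(f ^^ (i + (j - i))) x = (f ^^ i) x" using that by simp
    then have "(f ^^ (j - i)) x = x" by (rule cancel)
    then have "n \<le> j - i" using that by (intro least) auto
    then show False using that by simp
  qed
  have "\<forall>i j. i < n \<and> j < n \<and> (f ^^ i) x = (f ^^ j) x \<longrightarrow> i = j"
  proof (intro allI impI)
    fix i j assume "i < n \<and> j < n \<and> (f ^^ i) x = (f ^^ j) x"
    then show "i = j" using aux[of i j] aux[of j i] by (cases i j rule: linorder_cases) auto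
  qed
  then show thesis using that[OF n] M by blast
qed

context hexgrid
begin

text \<open>Uniqueness of the link on either side of an edge defines a successor map that permutes
  the finitely many edges met by T. One orbit yields a closed curve inside T; the arcs left over
  form a disjoint closed set, which is empty because T is connected.\<close>

lemma tangle_cycle:
  assumes "hexagonal_tangle r vertices T"
  obtains E n where "hex_cycle p \<delta> r E n" "hex_cycle.curve E = T"
proof -
  obtain F where smooth: "smooth_simple_closed_curve T" and F: "finite F" "\<forall>L\<in>F. is_link r vertices L"
    "T = (\<Union>L\<in>F. link_arc L)" using assms unfolding hexagonal_tangle_def by blast
  define K where "K = {c \<in> corners. lnkc c \<in> F}"
  have Kc: "K \<subseteq> corners" unfolding K_def by blast
  have "inj_on lnkc K"
  proof (rule inj_onI)
    fix c c' assume c: "c \<in> K" "c' \<in> K" "lnkc c = lnkc c'"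
    obtain H u s H' u' s' where "c = (H, u, s)" "c' = (H', u', s')" by (metis prod_cases3)
    then show "c = c'" using lnk_inj[of H u s H' u' s'] c Kc by (auto simp: corners_def)
  qed
  moreover have "lnkc ` K \<subseteq> F" unfolding K_def by blast
  ultimately have Kf: "finite K" using F(1) by (meson finite_imageD finite_subset)
  have T: "T = (\<Union>c\<in>K. arcc c)"
  proof (intro equalityI subsetI)
    fix z assume "z \<in> T"
    then obtain L where L: "L \<in> F" "z \<in> link_arc L" unfolding F(3) by blast
    obtain H u s where c: "is_corner H u s" "L = lnk H u s" using is_link_cases F(2) L(1) by blast
    then have "(H, u, s) \<in> K" using L(1) by (auto simp: K_def corners_def)
    moreover have "z \<in> arc H u s" using L(2) c link_arc_lnk by simp
    ultimately show "z \<in> (\<Union>c\<in>K. arcc c)" by force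
  next
    fix z assume "z \<in> (\<Union>c\<in>K. arcc c)"
    then obtain H u s where c: "(H, u, s) \<in> K" "z \<in> arc H u s" by auto
    then have "turn s" "lnk H u s \<in> F" using Kc by (auto simp: K_def corners_def)
    then show "z \<in> T" unfolding F(3) using c(2) link_arc_lnk by blast
  qed
  define M where "M = {e \<in> edges. mid e \<in> T}"
  have uniq: "\<exists>!s. turn s \<and> (P + u, u, s) \<in> K" "\<exists>!s. turn s \<and> (P, u * s * s, s) \<in> K"
    if "(P, u) \<in> M" for P u
    using unique_links_at_mid[OF Kf Kc T smooth, of P u] that by (auto simp: M_def mid_def)
  have start: "(H - u, u) \<in> M" and stop: "(H, u * s) \<in> M" if "(H, u, s) \<in> K" for H u s
  proof -
    have c: "is_corner H u s" using that Kc by (auto simp: corners_def)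
    have "arc H u s \<subseteq> T" unfolding T using that by force
    moreover have "H - u / 2 = mid (H - u, u)" "H + u * s / 2 = mid (H, u * s)"
      by (simp_all add: mid_def field_simps)
    ultimately show "(H - u, u) \<in> M" "(H, u * s) \<in> M"
      using arc_ends[of H u s] corner_edge[OF c] corner_edge'[OF c] unfolding M_def by auto
  qed
  have "M \<subseteq> (\<lambda>(H, u, s). (H - u, u)) ` K"
  proof
    fix e assume "e \<in> M"
    obtain P u where e: "e = (P, u)" by force
    obtain s where "(P + u, u, s) \<in> K" using uniq(1) \<open>e \<in> M\<close> unfolding e by blast
    then show "e \<in> (\<lambda>(H, u, s). (H - u, u)) ` K" unfolding e by force
  qed
  then have Mf: "finite M" using Kf by (meson finite_imageI finite_subset)
  define nx where "nx = (\<lambda>(P, u). (P + u, u * (THE s. turn s \<and> (P + u, u, s) \<in> K)))"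
  have nx: "nx (P, u) = (P + u, u * s)" if "(P, u) \<in> M" "turn s" "(P + u, u, s) \<in> K" for P u s
    using the1_equality[OF uniq(1)[OF that(1)], of s] that(2,3) by (simp add: nx_def)
  have nxM: "nx e \<in> M" and nx_step: "step e (nx e)" and nx_corner: "corner_of e (nx e) \<in> K" if eM: "e \<in> M" for e
  proof -
    obtain P u where e: "e = (P, u)" by force
    obtain s where s: "turn s" "(P + u, u, s) \<in> K" using uniq(1) eM unfolding e by blast
    have ne: "nx e = (P + u, u * s)" using nx[OF _ s] eM unfolding e by blast
    show "nx e \<in> M" using stop[OF s(2)] unfolding ne .
    show "step e (nx e)" unfolding step_def ne using s(1) e by auto
    have "u \<noteq> 0" using eM dirs_nz by (auto simp: e M_def edges_def)
    then show "corner_of e (nx e) \<in> K" unfolding corner_of_def ne using s(2) by (simp add: e)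
  qed
  have "M \<subseteq> nx ` M"
  proof
    fix e assume eM: "e \<in> M"
    obtain P u where e: "e = (P, u)" by force
    obtain s where s: "turn s" "(P, u * s * s, s) \<in> K" using uniq(2) eM unfolding e by blast
    have us: "u * s * s * s = u" using turn_cube[OF s(1)] by (simp add: mult.assoc)
    have "nx (P - u * s * s, u * s * s) = (P, u)"
      using nx[OF start[OF s(2)] s(1)] s(2) us by simp
    then show "e \<in> nx ` M" using imageI[OF start[OF s(2)], of nx] unfolding e by simp
  qed
  moreover have "nx ` M \<subseteq> M" using nxM by blast
  ultimately have "nx ` M = M" by (rule subset_antisym[rotated])
  then have nx_inj: "inj_on nx M" by (intro eq_card_imp_inj_on[OF Mf]) simp
  have "T \<noteq> {}" using smooth path_image_nonempty unfolding smooth_simple_closed_curve_def by blast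
  then obtain H0 u0 s0 where "(H0, u0, s0) \<in> K" unfolding T by auto
  then obtain e0 where e0: "e0 \<in> M" using start by blast
  obtain n where n: "n > 0" "(nx ^^ n) e0 = e0"
    "\<forall>i j. i < n \<and> j < n \<and> (nx ^^ i) e0 = (nx ^^ j) e0 \<longrightarrow> i = j" "\<forall>k. (nx ^^ k) e0 \<in> M"
    using iterate_cycle[OF Mf e0 nxM nx_inj] .
  \<comment> \<open>Iterating modulo the period extends the orbit to negative indices.\<close>
  define E where "E = (\<lambda>i. (nx ^^ nat (i mod int n)) e0)"
  have E_M: "E i \<in> M" for i using n(4) by (simp add: E_def)
  have E_nx: "E (i + 1) = nx (E i)" for i
  proof (cases "i mod int n + 1 = int n")
    case True
    then have "(i + 1) mod int n = 0" by (metis mod_add_left_eq mod_self)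
    then have "E (i + 1) = e0" by (simp add: E_def)
    also have "e0 = (nx ^^ Suc (nat (i mod int n))) e0"
    proof -
      have "Suc (nat (i mod int n)) = n" using True n(1) by linarith
      then show ?thesis using n(2) by simp
    qed
    finally show ?thesis by (simp add: E_def)
  next
    case False
    have "0 \<le> i mod int n" "i mod int n < int n" using n(1) by simp_all
    then have "(i + 1) mod int n = i mod int n + 1"
      using False by (metis mod_add_left_eq mod_pos_pos_trivial add_nonneg_nonneg zero_le_one zless_imp_add1_zle order_less_le)
    then have "nat ((i + 1) mod int n) = Suc (nat (i mod int n))" using \<open>0 \<le> i mod int n\<close> by simp
    then show ?thesis by (simp add: E_def)
  qed
  interpret hex_cycle p \<delta> r E "int n"
  proof
    show "int n > 0" using n(1) by simp
    show "E i \<in> edges" for i using E_M unfolding M_def by blast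
    show "step (E i) (E (i + 1))" for i unfolding E_nx using nx_step E_M by blast
    show "E (i + int n) = E i" for i by (simp add: E_def)
    show "i mod int n = j mod int n" if "E i = E j" for i j
    proof -
      have "nat (i mod int n) < n" "nat (j mod int n) < n" using n(1) by (simp_all add: nat_less_iff)
      then have "nat (i mod int n) = nat (j mod int n)" using n(3) that unfolding E_def by blast
      then show ?thesis using n(1) by (simp add: nat_eq_iff)
    qed
  qed
  have cK: "cyc_corners \<subseteq> K"
    unfolding cyc_corners_def corner_of_E[symmetric] E_nx image_subset_iff using nx_corner[OF E_M] by blast
  define R where "R = (\<Union>c\<in>K - cyc_corners. arcc c)"
  have T_un: "T = curve \<union> R" unfolding T curve_def R_def using cK by blast
  \<comment> \<open>A common point must be the midpoint of an edge, and there the uniqueness of the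
    links before and after puts the second arc on the orbit as well.\<close>
  have "curve \<inter> R = {}"
  proof (rule equals0I)
    fix z assume "z \<in> curve \<inter> R"
    then obtain H u s H' u' s' where c: "(H, u, s) \<in> cyc_corners" "z \<in> arc H u s"
      "(H', u', s') \<in> K" "(H', u', s') \<notin> cyc_corners" "z \<in> arc H' u' s'"
      unfolding curve_def R_def by auto
    have co: "is_corner H u s" "is_corner H' u' s'" using c cK Kc by (auto simp: corners_def)
    have "z \<notin> open_arc H u s" using open_arc_disjoint[OF co _ c(5)] c(1,4) by blast
    then have "z = mid (H - u, u) \<or> z = mid (H, u * s)"
      using arc_cases[OF c(2)] by (auto simp: mid_def field_simps)
    moreover obtain i where i: "Hc i = H" "Uc i = u" "Sc i = s" using c(1) unfolding cyc_corners_def by auto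
    ultimately have "z = mid (E i) \<or> z = mid (E (i + 1))" unfolding E_eq[of i] E_next[of i] by simp
    then obtain j where j: "z = mid (E j)" by blast
    have "E j = (H' - u', u') \<or> E j = (H', u' * s')"
      using mid_in_arc[OF E_edges co(2)] c(5) j by blast
    then show False
    proof
      assume e: "E j = (H' - u', u')"
      then have "nx (E j) = (H', u' * s')"
        using nx[of "H' - u'" u' s'] E_M[of j] co(2) c(3) by simp
      then have "corner_of (E j) (E (j + 1)) = (H', u', s')"
        unfolding E_nx using e co(2) dirs_nz by (simp add: corner_of_def)
      then have "(Hc j, Uc j, Sc j) = (H', u', s')" unfolding corner_of_E .
      then show False using c(4) rangeI[of "\<lambda>i. (Hc i, Uc i, Sc i)" j] unfolding cyc_corners_def by simp
    next
      assume e: "E j = (H', u' * s')"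
      have us: "u' * s' * s' * s' = u'" using turn_cube[of s'] co(2) by (simp add: mult.assoc)
      have "turn s' \<and> (H', (u' * s') * s' * s', s') \<in> K" unfolding us using co(2) c(3) by simp
      moreover have "turn (Sc (j - 1)) \<and> (H', (u' * s') * Sc (j - 1) * Sc (j - 1), Sc (j - 1)) \<in> K"
      proof -
        have p: "Hc (j - 1) = H'" "Uc (j - 1) * Sc (j - 1) = u' * s'"
          using E_next[of "j - 1"] e by simp_all
        have cu: "Uc (j - 1) * Sc (j - 1) * Sc (j - 1) * Sc (j - 1) = Uc (j - 1)"
          using turn_cube[OF Sc_turn, of "j - 1"] by (simp add: mult.assoc)
        have "(Hc (j - 1), Uc (j - 1), Sc (j - 1)) \<in> K" using cK unfolding cyc_corners_def by blast
        then have "(H', Uc (j - 1) * Sc (j - 1) * Sc (j - 1) * Sc (j - 1), Sc (j - 1)) \<in> K"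
          unfolding cu p(1) .
        then show ?thesis using Sc_turn unfolding p(2) by blast
      qed
      ultimately have s: "Sc (j - 1) = s'"
      proof -
        assume 1: "turn s' \<and> (H', (u' * s') * s' * s', s') \<in> K"
          "turn (Sc (j - 1)) \<and> (H', (u' * s') * Sc (j - 1) * Sc (j - 1), Sc (j - 1)) \<in> K"
        have "(H', u' * s') \<in> M" using E_M[of j] e by simp
        from uniq(2)[OF this] 1 show ?thesis by (elim ex1E) blast
      qed
      have "Uc (j - 1) * Sc (j - 1) = u' * s'" "Hc (j - 1) = H'" using E_next[of "j - 1"] e by simp_all
      then have "Uc (j - 1) = u'" using s turn_nz co(2) by simp
      then show False using c(4) s \<open>Hc (j - 1) = H'\<close> unfolding cyc_corners_def by blast
    qed
  qed
  moreover have "closed curve" unfolding curve_def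
    by (rule closed_UN[OF finite_cyc_corners]) (use cK Kc arc_closed in \<open>auto simp: corners_def\<close>)
  moreover have "closed R" unfolding R_def
    by (rule closed_UN) (use Kf Kc arc_closed in \<open>auto simp: corners_def\<close>)
  moreover have "connected T"
    using smooth connected_simple_path_image unfolding smooth_simple_closed_curve_def by blast
  moreover have "curve \<noteq> {}" unfolding curve_range by blast
  ultimately have "R = {}" unfolding T_un connected_closed by blast
  then have "curve = T" using T_un by simp
  then show thesis using that hex_cycle_axioms by blast
qed

end

section \<open>Tours\<close>

context hexgrid
begin

type_synonym corner = "complex \<times> complex \<times> complex"

definition cpath :: "(complex \<times> complex) list \<Rightarrow> corner list" where
  "cpath xs = map2 corner_of xs (tl xs)"

lemma cpath_simps [simp]: "cpath [] = []" "cpath [x] = []" "cpath (x # y # zs) = corner_of x y # cpath (y # zs)"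
  by (simp_all add: cpath_def)

lemma cpath_append: "cpath (xs @ y # ys) = cpath (xs @ [y]) @ cpath (y # ys)"
  by (induction xs rule: induct_list012) auto

lemma length_cpath: "length (cpath xs) = length xs - 1"
  by (simp add: cpath_def)

lemma cpath_nth: "Suc k < length xs \<Longrightarrow> cpath xs ! k = corner_of (xs ! k) (xs ! Suc k)"
  by (simp add: cpath_def nth_tl)

text \<open>The closing edge is not repeated in the list; \<open>es @ [hd es]\<close> restores it
  wherever the last link matters.\<close>

definition tour :: "(complex \<times> complex) list \<Rightarrow> bool" where
  "tour es \<longleftrightarrow> es \<noteq> [] \<and> distinct es \<and> set es \<subseteq> edges \<and> successively step (es @ [hd es])"

definition tour_corners :: "(complex \<times> complex) list \<Rightarrow> corner set" where
  "tour_corners es = set (cpath (es @ [hd es]))"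

definition tour_curve :: "(complex \<times> complex) list \<Rightarrow> complex set" where
  "tour_curve es = (\<Union>c\<in>tour_corners es. arcc c)"

definition turns :: "complex \<Rightarrow> corner list \<Rightarrow> int" where
  "turns w cs = sum_list (map (\<lambda>(H, u, s). if s = w then 1 else - 1) cs)"

lemma turns_simps [simp]: "turns w [] = 0" "turns w ((H, u, s) # cs) = (if s = w then 1 else - 1) + turns w cs"
  "turns w (cs @ cs') = turns w cs + turns w cs'"
  by (simp_all add: turns_def)

definition tour_edge :: "(complex \<times> complex) list \<Rightarrow> int \<Rightarrow> complex \<times> complex" where
  "tour_edge es i = es ! nat (i mod int (length es))"

lemma tour_edge_nth: "k \<le> length es \<Longrightarrow> es \<noteq> [] \<Longrightarrow> (es @ [hd es]) ! k = tour_edge es (int k)"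
  by (cases "k = length es") (auto simp: tour_edge_def nth_append hd_conv_nth)

lemma tour_cycle:
  assumes "tour es"
  shows "hex_cycle p \<delta> r (tour_edge es) (int (length es))"
proof -
  define n where "n = length es"
  have es: "es \<noteq> []" "distinct es" "set es \<subseteq> edges" "successively step (es @ [hd es])"
    using assms by (auto simp: tour_def)
  then have n: "n > 0" by (simp add: n_def)
  have rng: "nat (i mod int n) < n" for i using n by (simp add: nat_less_iff)
  show ?thesis unfolding n_def[symmetric]
  proof
    show "int n > 0" using n by simp
    show "tour_edge es i \<in> edges" for i
      using es(3) nth_mem[of "nat (i mod int n)" es] rng[of i] unfolding tour_edge_def n_def by blast
    show "tour_edge es (i + int n) = tour_edge es i" for i by (simp add: tour_edge_def n_def)
    show "i mod int n = j mod int n" if "tour_edge es i = tour_edge es j" for i j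
    proof -
      have "nat (i mod int n) = nat (j mod int n)"
        using that rng nth_eq_iff_index_eq[OF es(2)] unfolding tour_edge_def n_def by blast
      then show ?thesis using n by (simp add: nat_eq_iff)
    qed
    show "step (tour_edge es i) (tour_edge es (i + 1))" for i
    proof -
      define k where "k = nat (i mod int n)"
      have k: "k < n" "int k = i mod int n" using rng[of i] n by (simp_all add: k_def)
      have "step ((es @ [hd es]) ! k) ((es @ [hd es]) ! Suc k)"
        using es(4) k(1) unfolding successively_conv_nth n_def by simp
      then have "step (tour_edge es (int k)) (tour_edge es (int (Suc k)))"
        using tour_edge_nth[of k es] tour_edge_nth[of "Suc k" es] k(1) es(1) by (simp add: n_def)
      moreover have "tour_edge es (int k) = tour_edge es i" unfolding tour_edge_def k(2) n_def by simp
      moreover have "tour_edge es (int (Suc k)) = tour_edge es (i + 1)"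
      proof -
        have "int (Suc k) mod int n = (i + 1) mod int n"
          using k(2) by (metis mod_add_left_eq of_nat_Suc add.commute)
        then show ?thesis unfolding tour_edge_def n_def by simp
      qed
      ultimately show ?thesis by simp
    qed
  qed
qed

lemma tour_cpath:
  assumes "tour es"
  shows "cpath (es @ [hd es]) = map (\<lambda>k. corner_of (tour_edge es (int k)) (tour_edge es (int k + 1))) [0..<length es]"
proof (rule nth_equalityI)
  have ne: "es \<noteq> []" using assms by (simp add: tour_def)
  show "length (cpath (es @ [hd es])) =
    length (map (\<lambda>k. corner_of (tour_edge es (int k)) (tour_edge es (int k + 1))) [0..<length es])"
    by (simp add: length_cpath)
  fix k assume "k < length (cpath (es @ [hd es]))"
  then have k: "k < length es" by (simp add: length_cpath)
  then show "cpath (es @ [hd es]) ! k =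
    map (\<lambda>k. corner_of (tour_edge es (int k)) (tour_edge es (int k + 1))) [0..<length es] ! k"
    using cpath_nth[of k "es @ [hd es]"] tour_edge_nth[of k es] tour_edge_nth[of "Suc k" es] ne
    by (simp add: add.commute)
qed

lemma tour_corners_cyc:
  assumes "tour es"
  shows "tour_corners es = hex_cycle.cyc_corners (tour_edge es)"
    and "tour_curve es = hex_cycle.curve (tour_edge es)"
    and "turns w (cpath (es @ [hd es])) =
      (\<Sum>k\<in>{0..<int (length es)}. if hex_cycle.Sc (tour_edge es) k = w then 1 else - 1)"
proof -
  interpret hex_cycle p \<delta> r "tour_edge es" "int (length es)" using tour_cycle[OF assms] .
  have cp: "cpath (es @ [hd es]) = map (\<lambda>k. (Hc (int k), Uc (int k), Sc (int k))) [0..<length es]"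
    unfolding tour_cpath[OF assms] corner_of_E ..
  have im: "{0..<int (length es)} = int ` {0..<length es}" by (simp add: image_int_atLeastLessThan)
  show 1: "tour_corners es = cyc_corners"
    unfolding tour_corners_def cp cyc_corners_eq im image_image by simp
  show "tour_curve es = curve" unfolding tour_curve_def curve_def 1 ..
  have "turns w (cpath (es @ [hd es])) = (\<Sum>k\<in>{0..<length es}. if Sc (int k) = w then 1 else - 1)"
    unfolding turns_def cp by (simp add: o_def interv_sum_list_conv_sum_set_nat)
  also have "\<dots> = (\<Sum>k\<in>{0..<int (length es)}. if Sc k = w then 1 else - 1)"
    unfolding im by (simp add: sum.reindex)
  finally show "turns w (cpath (es @ [hd es])) = (\<Sum>k\<in>{0..<int (length es)}. if Sc k = w then 1 else - 1)" .
qed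

lemma tour_tangle:
  assumes "tour es"
  shows "hexagonal_tangle r vertices (tour_curve es)"
    and "links_of r vertices (tour_curve es) = lnkc ` tour_corners es"
    and "tour_corners es \<subseteq> corners" and "bounded (inside (tour_curve es))"
proof -
  interpret hex_cycle p \<delta> r "tour_edge es" "int (length es)" using tour_cycle[OF assms] .
  show "hexagonal_tangle r vertices (tour_curve es)"
    "links_of r vertices (tour_curve es) = lnkc ` tour_corners es"
    "tour_corners es \<subseteq> corners" "bounded (inside (tour_curve es))"
    unfolding tour_corners_cyc[OF assms]
    using curve_tangle links_of_curve cyc_corners_corners Jordan(2) by simp_all
qed

lemma tour_sides:
  assumes "tour es" "is_corner H u s"
  shows "(H, u, s) \<in> tour_corners es \<Longrightarrow> H \<in> inside (tour_curve es) \<longleftrightarrow> vertex H u s \<notin> inside (tour_curve es)"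
    and "(H, u, s) \<notin> tour_corners es \<Longrightarrow> vertex H u s \<in> inside (tour_curve es) \<longleftrightarrow> H \<in> inside (tour_curve es)"
    and "(H, u, s) \<in> tour_corners es \<Longrightarrow>
      convex_link r (tour_curve es) (lnk H u s) \<longleftrightarrow> vertex H u s \<in> inside (tour_curve es)"
proof -
  interpret hex_cycle p \<delta> r "tour_edge es" "int (length es)" using tour_cycle[OF assms(1)] .
  show "(H, u, s) \<in> tour_corners es \<Longrightarrow> H \<in> inside (tour_curve es) \<longleftrightarrow> vertex H u s \<notin> inside (tour_curve es)"
    "(H, u, s) \<notin> tour_corners es \<Longrightarrow> vertex H u s \<in> inside (tour_curve es) \<longleftrightarrow> H \<in> inside (tour_curve es)"
    "(H, u, s) \<in> tour_corners es \<Longrightarrow>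
      convex_link r (tour_curve es) (lnk H u s) \<longleftrightarrow> vertex H u s \<in> inside (tour_curve es)"
    unfolding tour_corners_cyc[OF assms(1)]
    using corner_sides non_corner_side[OF assms(2)] corner_convex by blast+
qed

lemma turns_sq:
  assumes "turn w" "\<forall>c\<in>set cs. turn (snd (snd c))"
  shows "turns (w * w) cs = - turns w cs"
  using assms(2)
proof (induction cs)
  case (Cons c cs)
  obtain H u s where c: "c = (H, u, s)" by (rule prod_cases3)
  have "s = w \<or> s = w * w" using turn_cases Cons.prems assms(1) c by auto
  then show ?case using Cons c turn_sq_neq[OF assms(1)] by auto
qed simp

lemma tour_orientation_exists:
  assumes "tour es"
  obtains w where "turn w" "turns w (cpath (es @ [hd es])) = 3"
    "\<forall>(H, u, s)\<in>tour_corners es. vertex H u s \<in> inside (tour_curve es) \<longleftrightarrow> s = w"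
proof -
  interpret hex_cycle p \<delta> r "tour_edge es" "int (length es)" using tour_cycle[OF assms(1)] .
  obtain w where "turn w" "(\<Sum>k\<in>{0..<int (length es)}. if Sc k = w then 1 else - 1 :: int) = 3"
    "\<And>H u s. (H, u, s) \<in> cyc_corners \<Longrightarrow> vertex H u s \<in> inside curve \<longleftrightarrow> s = w"
    by (rule orientation) (rule that)
  then show thesis using that[of w] unfolding tour_corners_cyc[OF assms(1)] by auto
qed

text \<open>The other cube root has excess -3, so excess 3 singles out \<open>w\<close>. Convexity
  of every link is thus decided by a count on the list.\<close>

lemma tour_orientation:
  assumes "tour es" "turn w" "turns w (cpath (es @ [hd es])) = 3" "(H, u, s) \<in> tour_corners es"
  shows "vertex H u s \<in> inside (tour_curve es) \<longleftrightarrow> s = w"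
proof -
  obtain w' where w': "turn w'" "turns w' (cpath (es @ [hd es])) = 3"
    "\<forall>(H, u, s)\<in>tour_corners es. vertex H u s \<in> inside (tour_curve es) \<longleftrightarrow> s = w'"
    using tour_orientation_exists[OF assms(1)] .
  have "\<forall>c\<in>set (cpath (es @ [hd es])). turn (snd (snd c))"
    using tour_tangle(3)[OF assms(1)] unfolding tour_corners_def corners_def by auto
  from turns_sq[OF assms(2) this] have "w' \<noteq> w * w" using w'(2) assms(3) by auto
  then have "w' = w" using turn_cases[OF w'(1) assms(2)] by blast
  then show ?thesis using w'(3) assms(4) by blast
qed

text \<open>A corner remembers the edge from which it starts. Hence corners are as distinct as
  edges, and each edge starts exactly one of them.\<close>

lemma tour_corner_start:
  assumes "tour es"
  shows "map (\<lambda>(H, u, s). (H - u, u)) (cpath (es @ [hd es])) = es"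
    and "inj_on (\<lambda>(H, u, s). (H - u, u)) (tour_corners es)"
    and "distinct (cpath (es @ [hd es]))"
proof -
  interpret hex_cycle p \<delta> r "tour_edge es" "int (length es)" using tour_cycle[OF assms(1)] .
  have "map (\<lambda>(H, u, s). (H - u, u)) (cpath (es @ [hd es])) = map (\<lambda>k. tour_edge es (int k)) [0..<length es]"
    unfolding tour_cpath[OF assms] corner_of_E by (simp add: o_def E_eq[symmetric])
  also have "\<dots> = es" by (rule nth_equalityI) (simp_all add: tour_edge_def)
  finally show 1: "map (\<lambda>(H, u, s). (H - u, u)) (cpath (es @ [hd es])) = es" .
  have "distinct es" using assms by (simp add: tour_def)
  then have "distinct (map (\<lambda>(H, u, s). (H - u, u)) (cpath (es @ [hd es])))" unfolding 1 .
  then show "inj_on (\<lambda>(H, u, s). (H - u, u)) (tour_corners es)" "distinct (cpath (es @ [hd es]))"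
    unfolding distinct_map tour_corners_def by auto
qed

lemma tangle_tour:
  assumes "hexagonal_tangle r vertices T"
  obtains es where "tour es" "tour_curve es = T"
proof -
  obtain E n where E: "hex_cycle p \<delta> r E n" "hex_cycle.curve E = T" using tangle_cycle[OF assms] .
  interpret hex_cycle p \<delta> r E n using E(1) .
  define es where "es = map (\<lambda>k. E (int k)) [0..<nat n]"
  have len: "int (length es) = n" using n_pos by (simp add: es_def)
  have te: "tour_edge es i = E i" for i
  proof -
    have "nat (i mod n) < nat n" using n_pos by simp
    then have "tour_edge es i = E (i mod n)" using n_pos unfolding tour_edge_def len by (simp add: es_def)
    also have "i mod n = i + n * (- (i div n))" by (simp add: minus_mult_div_eq_mod[symmetric])
    finally show ?thesis by (simp only: E_periodic_mult)
  qed
  have ne: "es \<noteq> []" using n_pos by (simp add: es_def)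
  have "tour es" unfolding tour_def
  proof (intro conjI ne)
    show "distinct es" unfolding es_def distinct_map
    proof (intro conjI inj_onI)
      fix x y assume "x \<in> set [0..<nat n]" "y \<in> set [0..<nat n]" "E (int x) = E (int y)"
      then show "x = y" using E_inj[of "int x" "int y"] by simp
    qed simp
    show "set es \<subseteq> edges" unfolding es_def using E_edges by auto
    show "successively step (es @ [hd es])" unfolding successively_conv_nth
    proof (intro allI impI)
      fix k assume "Suc k < length (es @ [hd es])"
      then have "k < length es" by simp
      then show "step ((es @ [hd es]) ! k) ((es @ [hd es]) ! Suc k)"
        using tour_edge_nth[of k es] tour_edge_nth[of "Suc k" es] ne E_step[of "int k"] by (simp add: te add.commute)
    qed
  qed
  moreover have "tour_edge es = E" using te by blast
  then have "tour_curve es = T" using tour_corners_cyc(2)[OF \<open>tour es\<close>] E(2) by simp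
  ultimately show thesis using that by blast
qed

section \<open>Surgery on tours\<close>

definition curv :: "complex \<Rightarrow> corner \<Rightarrow> curvature" where
  "curv w c = (if snd (snd c) = w then Convex else Concave)"

lemma cpath_chain:
  assumes "successively step (x # xs)" "set (x # xs) \<subseteq> edges"
  shows "link_chain (mid x) (map lnkc (cpath (x # xs))) (mid (last (x # xs)))"
  using assms
proof (induction xs arbitrary: x)
  case (Cons y ys)
  have st: "step x y" "x \<in> edges" using Cons.prems by simp_all
  obtain s where s: "turn s" "y = (fst x + snd x, snd x * s)" "corner_of x y = (fst x + snd x, snd x, s)"
    using corner_of_step[OF st] by blast
  have "link_ends (lnkc (corner_of x y)) = {mid x, mid y}"
    unfolding s(3) using link_ends_lnk[OF s(1), of "fst x + snd x" "snd x"] by (simp add: s(2) mid_def field_simps)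
  moreover have "link_chain (mid y) (map lnkc (cpath (y # ys))) (mid (last (y # ys)))"
    using Cons by simp
  ultimately show ?case by auto
qed simp

lemma lnkc_inj: "inj_on lnkc corners"
proof (rule inj_onI)
  fix c c' assume c: "c \<in> corners" "c' \<in> corners" "lnkc c = lnkc c'"
  obtain H u s where 1: "c = (H, u, s)" by (rule prod_cases3)
  obtain H' u' s' where 2: "c' = (H', u', s')" by (rule prod_cases3)
  show "c = c'" using lnk_inj[of H u s H' u' s'] c unfolding 1 2 by (auto simp: corners_def)
qed

text \<open>The list is split so that the replaced stretch runs from \<open>e\<close> to
  \<open>e'\<close>, both edges being kept: links lie between edges, so a stretch with
  \<open>xs\<close> removed or exchanged still has the same end points.\<close>

lemma tour_consecutive:
  assumes "tour (e # xs @ e' # ys)" "turn w" "turns w (cpath ((e # xs @ e' # ys) @ [e])) = 3"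
  shows "consecutive_links r vertices (tour_curve (e # xs @ e' # ys)) (mid e)
      (map lnkc (cpath (e # xs @ [e']))) (mid e')"
    and "map (link_curvature r (tour_curve (e # xs @ e' # ys))) (map lnkc (cpath (e # xs @ [e']))) =
      map (curv w) (cpath (e # xs @ [e']))"
    and "links_of r vertices (tour_curve (e # xs @ e' # ys)) - set (map lnkc (cpath (e # xs @ [e']))) =
      lnkc ` set (cpath (e' # ys @ [e]))"
proof -
  define es where "es = e # xs @ e' # ys"
  have T: "tour es" using assms(1) by (simp add: es_def)
  have hd: "es @ [hd es] = (e # xs) @ e' # (ys @ [e])" by (simp add: es_def)
  have cp: "cpath (es @ [hd es]) = cpath (e # xs @ [e']) @ cpath (e' # ys @ [e])"
    unfolding hd using cpath_append[of "e # xs" e' "ys @ [e]"] by (simp only: append_Cons)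
  have tc: "tour_corners es = set (cpath (e # xs @ [e'])) \<union> set (cpath (e' # ys @ [e]))"
    unfolding tour_corners_def cp by simp
  have dist: "distinct (cpath (e # xs @ [e']))" "set (cpath (e # xs @ [e'])) \<inter> set (cpath (e' # ys @ [e])) = {}"
    using tour_corner_start(3)[OF T] unfolding cp by auto
  have sub: "tour_corners es \<subseteq> corners" by (rule tour_tangle(3)[OF T])
  have inj: "inj_on lnkc (tour_corners es)" using lnkc_inj sub by (rule inj_on_subset)
  have li: "links_of r vertices (tour_curve es) = lnkc ` tour_corners es" by (rule tour_tangle(2)[OF T])
  have succ: "successively step (e # xs @ [e'])"
  proof -
    have "es @ [hd es] = (e # xs @ [e']) @ ys @ [e]" by (simp add: es_def)
    then have "successively step ((e # xs @ [e']) @ ys @ [e])" using T unfolding tour_def by simp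
    then show ?thesis unfolding successively_append_iff by blast
  qed
  have chain: "link_chain (mid e) (map lnkc (cpath (e # xs @ [e']))) (mid e')"
    using cpath_chain[OF succ] T by (auto simp: tour_def es_def)
  have dl: "distinct (map lnkc (cpath (e # xs @ [e'])))"
    unfolding distinct_map using dist(1) inj_on_subset[OF inj] tc by blast
  show "consecutive_links r vertices (tour_curve (e # xs @ e' # ys)) (mid e)
      (map lnkc (cpath (e # xs @ [e']))) (mid e')"
    unfolding consecutive_links_def es_def[symmetric] li set_map tc using chain dl by blast
  have "link_curvature r (tour_curve es) (lnkc c) = curv w c" if c: "c \<in> tour_corners es" for c
  proof -
    obtain H u s where 1: "c = (H, u, s)" by (rule prod_cases3)
    have co: "is_corner H u s" using c sub 1 by (auto simp: corners_def)
    have "turns w (cpath (es @ [hd es])) = 3" using assms(3) unfolding es_def by simp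
    then have "vertex H u s \<in> inside (tour_curve es) \<longleftrightarrow> s = w"
      using tour_orientation[OF T assms(2)] c 1 by blast
    then show ?thesis using tour_sides(3)[OF T co] c 1 by (simp add: link_curvature_def curv_def)
  qed
  then show "map (link_curvature r (tour_curve (e # xs @ e' # ys))) (map lnkc (cpath (e # xs @ [e']))) =
      map (curv w) (cpath (e # xs @ [e']))"
    unfolding es_def[symmetric] using tc by simp
  show "links_of r vertices (tour_curve (e # xs @ e' # ys)) - set (map lnkc (cpath (e # xs @ [e']))) =
      lnkc ` set (cpath (e' # ys @ [e]))"
  proof -
    have "lnkc ` tour_corners es - lnkc ` set (cpath (e # xs @ [e'])) =
      lnkc ` (tour_corners es - set (cpath (e # xs @ [e'])))"
      by (rule inj_on_image_set_diff[OF inj, symmetric]) (use tc in auto)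
    also have "tour_corners es - set (cpath (e # xs @ [e'])) = set (cpath (e' # ys @ [e]))"
      using tc dist(2) by blast
    finally show ?thesis unfolding es_def[symmetric] li by simp
  qed
qed

text \<open>The kept links are those from \<open>e'\<close> round to \<open>e\<close> and come from
  the same list in both tours; the excess 3 on both sides supplies the curvatures.\<close>

lemma surgery_replacement:
  assumes "tour (e # xs @ e' # ys)" "turns w (cpath ((e # xs @ e' # ys) @ [e])) = 3"
    and "tour (e # xs' @ e' # ys)" "turns w (cpath ((e # xs' @ e' # ys) @ [e])) = 3" and "turn w"
  shows "replacement (map (curv w) (cpath (e # xs @ [e']))) (map (curv w) (cpath (e # xs' @ [e']))) r vertices
    (tour_curve (e # xs @ e' # ys)) (tour_curve (e # xs' @ e' # ys))"
  unfolding replacement_def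
proof (intro conjI exI)
  show "hexagonal_tangle r vertices (tour_curve (e # xs @ e' # ys))" by (rule tour_tangle(1)[OF assms(1)])
  show "hexagonal_tangle r vertices (tour_curve (e # xs' @ e' # ys))" by (rule tour_tangle(1)[OF assms(3)])
  show "links_of r vertices (tour_curve (e # xs @ e' # ys)) - set (map lnkc (cpath (e # xs @ [e']))) =
    links_of r vertices (tour_curve (e # xs' @ e' # ys)) - set (map lnkc (cpath (e # xs' @ [e'])))"
    unfolding tour_consecutive(3)[OF assms(1,5,2)] tour_consecutive(3)[OF assms(3,5,4)] ..
qed (rule tour_consecutive[OF assms(1,5,2)] tour_consecutive[OF assms(3,5,4)])+

end

text \<open>Around an inner hexagon, \<open>p\<close> and \<open>q\<close> tell whether the two
  other hexagons at one of three alternate corners are inner, and \<open>b\<close> whether the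
  corner between this one and the next is enclosed. The value \<open>g\<close> is (2 - p - q) / (1 +
  p + q) - (1 - b): the shares of convex links minus the concave link.\<close>

lemma positive_weight_pattern:
  fixes p0 p1 p2 q0 q1 q2 b0 b1 b2 :: bool
  defines "g \<equiv> \<lambda>p q b. (if p \<and> q then - 1 else if p \<or> q then - 1 / 2 else 1) + (if b then 1 else 0 :: real)"
  assumes "b0 \<longrightarrow> p1 \<and> q0" "b1 \<longrightarrow> p2 \<and> q1" "b2 \<longrightarrow> p0 \<and> q2"
    and "g p0 q0 b0 + g p1 q1 b1 + g p2 q2 b2 > 0"
  shows "\<not> p1 \<and> \<not> q1 \<and> (\<not> p2 \<and> \<not> q2 \<or> b2) \<or> \<not> p2 \<and> \<not> q2 \<and> (\<not> p0 \<and> \<not> q0 \<or> b0) \<or>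
    \<not> p0 \<and> \<not> q0 \<and> (\<not> p1 \<and> \<not> q1 \<or> b1)"
  using assms(2-5) unfolding g_def
  by (cases p0; cases q0; cases p1; cases q1; cases p2; cases q2; simp split: if_splits)

context hexgrid
begin

section \<open>Weights of inner hexagons\<close>

lemma vertex_same:
  assumes "turn s"
  shows "vertex (H + u * s) (u * s) s = vertex H u s" "vertex (H - u) (u * s * s) s = vertex H u s"
  using vertex_next[OF assms] vertex_prev[OF assms] by auto

text \<open>A bound on the positive definite norm form bounds both integer coordinates.\<close>

lemma finite_centers:
  assumes "bounded B"
  shows "finite (centers \<inter> B)"
proof -
  obtain R where R: "\<forall>z\<in>B. norm z \<le> R" using assms unfolding bounded_iff by blast
  let ?w = "cis (2 * pi / 3)"
  define C where "C = (norm p + R) / norm \<delta>"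
  define N where "N = \<lceil>2 * C\<rceil>"
  have "z \<in> (\<lambda>(m, n). p + \<delta> * (of_int m + of_int n * ?w)) ` ({-N..N} \<times> {-N..N})" if z: "z \<in> centers \<inter> B" for z
  proof -
    obtain m n where mn: "z = p + \<delta> * (of_int m + of_int n * ?w)"
      using z unfolding centers_def eis_def by blast
    have "norm (z - p) \<le> R + norm p" using norm_triangle_ineq4[of z p] R z by fastforce
    then have "norm \<delta> * norm (of_int m + of_int n * ?w) \<le> norm p + R" unfolding mn by (simp add: norm_mult)
    then have "norm (of_int m + of_int n * ?w) \<le> C" using \<delta>_nz by (simp add: C_def field_simps)
    then have nc: "cmod (of_real (of_int m) + of_real (of_int n) * ?w) \<le> C" by simp
    have "(cmod (of_real (of_int m) + of_real (of_int n) * ?w))\<^sup>2 \<le> C\<^sup>2"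
      using nc by (intro power_mono) auto
    then have q: "(real_of_int m)\<^sup>2 - of_int m * of_int n + (of_int n)\<^sup>2 \<le> C\<^sup>2"
      unfolding cmod_turn_comb[OF turn_cis] .
    have C0: "C \<ge> 0" using nc norm_ge_zero by (rule order_trans[rotated])
    have sq: "\<bar>x\<bar> \<le> 2 * C" if "3 * x\<^sup>2 \<le> 4 * C\<^sup>2" for x :: real
    proof -
      have "x\<^sup>2 \<le> 4 * C\<^sup>2" using that zero_le_power2[of x] by linarith
      then have "\<bar>x\<bar> \<le> \<bar>2 * C\<bar>" unfolding abs_le_square_iff by (simp add: power_mult_distrib)
      then show ?thesis using C0 by simp
    qed
    have e: "4 * ((real_of_int m)\<^sup>2 - of_int m * of_int n + (of_int n)\<^sup>2) = (2 * of_int n - of_int m)\<^sup>2 + 3 * (of_int m)\<^sup>2"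
      "4 * ((real_of_int m)\<^sup>2 - of_int m * of_int n + (of_int n)\<^sup>2) = (2 * of_int m - of_int n)\<^sup>2 + 3 * (of_int n)\<^sup>2"
      by (simp_all add: power2_eq_square algebra_simps)
    have aux: "3 * y \<le> 4 * c" if "4 * t = x + 3 * y" "t \<le> c" "0 \<le> x" for t x y c :: real
      using that by linarith
    have "\<bar>real_of_int m\<bar> \<le> 2 * C" "\<bar>real_of_int n\<bar> \<le> 2 * C"
      by (rule sq, rule aux[OF e(1) q zero_le_power2], rule sq, rule aux[OF e(2) q zero_le_power2])
    then have "m \<in> {-N..N}" "n \<in> {-N..N}" unfolding N_def by simp_all linarith+
    then show ?thesis using mn by force
  qed
  then have "centers \<inter> B \<subseteq> (\<lambda>(m, n). p + \<delta> * (of_int m + of_int n * ?w)) ` ({-N..N} \<times> {-N..N})" by blast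
  then show ?thesis by (rule finite_subset) simp
qed

end

locale oriented_tour = hexgrid +
  fixes es :: "(complex \<times> complex) list" and w :: complex
  assumes tour: "tour es" and w: "turn w" and turns: "turns w (cpath (es @ [hd es])) = 3"
begin

definition inner :: "complex \<Rightarrow> bool" where "inner z \<longleftrightarrow> z \<in> inside (tour_curve es)"

text \<open>If vertex and centre are on different sides, the link of this corner is in the tour, and
  as it turns by \<open>w\<close> it is convex. So only the vertex can be enclosed without the
  centre; for \<open>w * w\<close> it is the reverse.\<close>

lemma corner_w:
  assumes "H \<in> centers" "u \<in> dirs"
  shows "(H, u, w) \<in> tour_corners es \<longleftrightarrow> inner (vertex H u w) \<and> \<not> inner H"
    and "inner H \<Longrightarrow> inner (vertex H u w)"
proof -
  have c: "is_corner H u w" using assms w by simp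
  show "(H, u, w) \<in> tour_corners es \<longleftrightarrow> inner (vertex H u w) \<and> \<not> inner H" "inner H \<Longrightarrow> inner (vertex H u w)"
    using tour_sides(1,2)[OF tour c] tour_orientation[OF tour w turns, of H u w] unfolding inner_def by blast+
qed

lemma corner_ww:
  assumes "H \<in> centers" "u \<in> dirs"
  shows "(H, u, w * w) \<in> tour_corners es \<longleftrightarrow> inner H \<and> \<not> inner (vertex H u (w * w))"
    and "inner (vertex H u (w * w)) \<Longrightarrow> inner H"
proof -
  have c: "is_corner H u (w * w)" using assms w by simp
  show "(H, u, w * w) \<in> tour_corners es \<longleftrightarrow> inner H \<and> \<not> inner (vertex H u (w * w))"
    "inner (vertex H u (w * w)) \<Longrightarrow> inner H"
    using tour_sides(1,2)[OF tour c] tour_orientation[OF tour w turns, of H u "w * w"] turn_sq_neq[OF w]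
    unfolding inner_def by blast+
qed

lemma ww [simp]: "u * w * w * (w * w) = u * w" "u * (w * w) * (w * w) = u * w" "u * w * w * w = u"
  using turn_cube[OF w] by (simp_all add: mult.assoc)

text \<open>All three hexagons at an enclosed vertex of the second kind are inner, since a link
  separating it from one of them would be convex although it turns by \<open>w * w\<close>.\<close>

lemma inner_down:
  assumes "H \<in> centers" "u \<in> dirs" "inner (vertex H u (w * w))"
  shows "inner H" "inner (H + u * w * w)" "inner (H - u)"
proof -
  have s: "turn (w * w)" using w by simp
  have d: "u * w * w \<in> dirs" "u * w \<in> dirs" using assms(2) w dirs_turn by blast+
  have c: "H + u * w * w \<in> centers" "H - u \<in> centers" using assms(1,2) d centers_add centers_diff by blast+
  show "inner H" using corner_ww(2)[OF assms(1,2)] assms(3) .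
  have "vertex (H + u * w * w) (u * w * w) (w * w) = vertex H u (w * w)"
    using vertex_same(1)[OF s, of H u] by (simp only: mult.assoc)
  then show "inner (H + u * w * w)" using corner_ww(2)[OF c(1) d(1)] assms(3) by simp
  have "vertex (H - u) (u * w) (w * w) = vertex H u (w * w)"
    using vertex_same(2)[OF s, of H u] by simp
  then show "inner (H - u)" using corner_ww(2)[OF c(2) d(2)] assms(3) by simp
qed

definition hexes :: "complex set" where "hexes = {H \<in> centers. inner H}"

lemma finite_hexes: "finite hexes"
proof -
  have "hexes = centers \<inter> inside (tour_curve es)" unfolding hexes_def inner_def by blast
  then show ?thesis using finite_centers[OF tour_tangle(4)[OF tour]] by simp
qed

abbreviation ind :: "bool \<Rightarrow> real" where "ind b \<equiv> (if b then 1 else 0)"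

text \<open>The number of inner hexagons among the three around \<open>vertex H u w\<close>; its
  unit weights are split into that many shares.\<close>

definition deg :: "complex \<Rightarrow> complex \<Rightarrow> real" where
  "deg H u = ind (inner H) + ind (inner (H + u * w)) + ind (inner (H - u))"

definition left_turns :: "(complex \<times> complex) set" where
  "left_turns = {(H, u). (H, u, w) \<in> tour_corners es}"

definition right_turns :: "(complex \<times> complex) set" where
  "right_turns = {(H, u). (H, u, w * w) \<in> tour_corners es}"

lemma left_right: "finite left_turns" "finite right_turns" "int (card left_turns) - int (card right_turns) = 3"
proof -
  define cs where "cs = cpath (es @ [hd es])"
  have tc: "tour_corners es = set cs" by (simp add: tour_corners_def cs_def)
  have dist: "distinct cs" unfolding cs_def by (rule tour_corner_start(3)[OF tour])
  have two: "s = w \<or> s = w * w" if "(H, u, s) \<in> set cs" for H u s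
    using tour_tangle(3)[OF tour] that turn_cases[OF _ w] unfolding tc corners_def by blast
  define A where "A = {c \<in> set cs. snd (snd c) = w}"
  define B where "B = {c \<in> set cs. snd (snd c) = w * w}"
  have A: "A = (\<lambda>(H, u). (H, u, w)) ` left_turns" and B: "B = (\<lambda>(H, u). (H, u, w * w)) ` right_turns"
    unfolding A_def B_def left_turns_def right_turns_def tc by force+
  have inj: "inj_on (\<lambda>(H, u). (H, u, k)) X" for X :: "(complex \<times> complex) set" and k :: complex
    by (auto simp: inj_on_def)
  have fin: "finite A" "finite B" unfolding A_def B_def by simp_all
  then show "finite left_turns" "finite right_turns" using finite_imageD[OF _ inj] unfolding A B by blast+
  have AB: "set cs = A \<union> B" "A \<inter> B = {}" unfolding A_def B_def using two turn_sq_neq[OF w] by force+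
  have "turns w cs = (\<Sum>c\<in>set cs. if snd (snd c) = w then 1 else - 1)"
    unfolding turns_def using dist by (simp add: sum_list_distinct_conv_sum_set case_prod_beta)
  also have "\<dots> = (\<Sum>c\<in>A. 1) + (\<Sum>c\<in>B. - 1)"
    unfolding AB(1) sum.union_disjoint[OF fin AB(2)]
    using turn_sq_neq[OF w] by (intro arg_cong2[of _ _ _ _ "(+)"] sum.cong) (auto simp: A_def B_def)
  finally have "int (card A) - int (card B) = 3" using turns by (simp add: cs_def)
  moreover have "card A = card left_turns" "card B = card right_turns" unfolding A B by (simp_all add: card_image inj)
  ultimately show "int (card left_turns) - int (card right_turns) = 3" by simp
qed

lemma right_turns_sum:
  "real (card right_turns) = (\<Sum>(H, u)\<in>hexes \<times> dirs. ind (\<not> inner (vertex H u (w * w))))"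
proof -
  have "right_turns = {x \<in> hexes \<times> dirs. case x of (H, u) \<Rightarrow> \<not> inner (vertex H u (w * w))}"
    unfolding right_turns_def hexes_def
    using corner_ww tour_tangle(3)[OF tour] by (auto simp: corners_def)
  then show ?thesis using finite_hexes finite_dirs
    by (simp add: case_prod_beta sum.If_cases Int_def conj_commute)
qed

text \<open>Each convex link is shared out equally among the inner hexagons at its vertex.\<close>

lemma left_turns_sum:
  assumes "\<forall>(H, u)\<in>left_turns. inner (H + u * w) \<or> inner (H - u)"
  shows "real (card left_turns) =
    (\<Sum>(H, u)\<in>hexes \<times> dirs. (ind (\<not> inner (H - u)) + ind (\<not> inner (H + u * w))) / deg H u)"
proof -
  define a where "a = (\<lambda>(H, u). ind (inner (H + u * w)) / deg H u)"
  define b where "b = (\<lambda>(H, u). ind (inner (H - u)) / deg H u)"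
  have lt: "(H, u) \<in> left_turns \<longleftrightarrow> H \<in> centers \<and> u \<in> dirs \<and> inner (vertex H u w) \<and> \<not> inner H" for H u
    unfolding left_turns_def using corner_w tour_tangle(3)[OF tour] by (auto simp: corners_def)
  have one: "a x + b x = 1" if "x \<in> left_turns" for x
  proof -
    obtain H u where x: "x = (H, u)" by force
    have "inner (H + u * w) \<or> inner (H - u)" "\<not> inner H" using assms that lt unfolding x by auto
    then show ?thesis unfolding x a_def b_def deg_def by auto
  qed
  have "real (card left_turns) = (\<Sum>x\<in>left_turns. a x) + (\<Sum>x\<in>left_turns. b x)"
    unfolding sum.distrib[symmetric] using one by simp
  moreover have "(\<Sum>x\<in>left_turns. a x) = (\<Sum>(H, u)\<in>hexes \<times> dirs. ind (\<not> inner (H - u)) / deg H u)"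
  proof -
    have "(\<Sum>x\<in>left_turns. a x) = (\<Sum>x\<in>{x \<in> left_turns. inner (fst x + snd x * w)}. a x)"
      by (rule sum.mono_neutral_right) (auto simp: left_right(1) a_def split: if_splits)
    also have "\<dots> = (\<Sum>(H, u)\<in>{x \<in> hexes \<times> dirs. \<not> inner (fst x - snd x)}. 1 / deg H u)"
    \<comment> \<open>The same vertex seen from the inner hexagon that receives the share instead of
      from the outer hexagon of the link; \<open>deg\<close> is unchanged as it counts the same
      three hexagons.\<close>
    proof (rule sum.reindex_bij_witness[where i = "\<lambda>(H, u). (H - u, u * w * w)" and j = "\<lambda>(H, u). (H + u * w, u * w)"])
      fix x assume "x \<in> {x \<in> left_turns. inner (fst x + snd x * w)}"
      then obtain H u where x: "x = (H, u)" and L: "H \<in> centers" "u \<in> dirs" "inner (vertex H u w)" "\<not> inner H"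
        and i: "inner (H + u * w)" by (cases x) (auto simp: lt)
      show "(case case x of (H, u) \<Rightarrow> (H + u * w, u * w) of (H, u) \<Rightarrow> (H - u, u * w * w)) = x"
        by (simp add: x)
      show "(case x of (H, u) \<Rightarrow> (H + u * w, u * w)) \<in> {x \<in> hexes \<times> dirs. \<not> inner (fst x - snd x)}"
        using L i dirs_turn w centers_add by (simp add: x hexes_def)
      have e: "H + u * w + u * w * w = H - u" by (simp add: mult.assoc turn_sq[OF w] algebra_simps)
      show "(case case x of (H, u) \<Rightarrow> (H + u * w, u * w) of (H, u) \<Rightarrow> 1 / deg H u) = a x"
        using L i by (simp add: x a_def deg_def e)
    next
      fix x assume "x \<in> {x \<in> hexes \<times> dirs. \<not> inner (fst x - snd x)}"
      then obtain H u where x: "x = (H, u)" and L: "H \<in> centers" "u \<in> dirs" "inner H" "\<not> inner (H - u)"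
        by (cases x) (auto simp: hexes_def)
      show "(case case x of (H, u) \<Rightarrow> (H - u, u * w * w) of (H, u) \<Rightarrow> (H + u * w, u * w)) = x"
        by (simp add: x)
      have "inner (vertex (H - u) (u * w * w) w)"
        unfolding vertex_same(2)[OF w] using corner_w(2) L by blast
      then show "(case x of (H, u) \<Rightarrow> (H - u, u * w * w)) \<in> {x \<in> left_turns. inner (fst x + snd x * w)}"
        using L w dirs_turn centers_diff by (simp add: x lt)
    qed
    also have "\<dots> = (\<Sum>x\<in>{x \<in> hexes \<times> dirs. \<not> inner (fst x - snd x)}. ind (\<not> inner (fst x - snd x)) / deg (fst x) (snd x))"
      by (rule sum.cong) auto
    also have "\<dots> = (\<Sum>x\<in>hexes \<times> dirs. ind (\<not> inner (fst x - snd x)) / deg (fst x) (snd x))"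
      by (rule sum.mono_neutral_left) (auto simp: finite_hexes finite_dirs)
    finally show ?thesis by (simp add: case_prod_beta)
  qed
  moreover have "(\<Sum>x\<in>left_turns. b x) = (\<Sum>(H, u)\<in>hexes \<times> dirs. ind (\<not> inner (H + u * w)) / deg H u)"
  proof -
    have "(\<Sum>x\<in>left_turns. b x) = (\<Sum>x\<in>{x \<in> left_turns. inner (fst x - snd x)}. b x)"
      by (rule sum.mono_neutral_right) (auto simp: left_right(1) b_def split: if_splits)
    also have "\<dots> = (\<Sum>(H, u)\<in>{x \<in> hexes \<times> dirs. \<not> inner (fst x + snd x * w)}. 1 / deg H u)"
    proof (rule sum.reindex_bij_witness[where i = "\<lambda>(H, u). (H + u * w, u * w)" and j = "\<lambda>(H, u). (H - u, u * w * w)"])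
      fix x assume "x \<in> {x \<in> left_turns. inner (fst x - snd x)}"
      then obtain H u where x: "x = (H, u)" and L: "H \<in> centers" "u \<in> dirs" "inner (vertex H u w)" "\<not> inner H"
        and i: "inner (H - u)" by (cases x) (auto simp: lt)
      show "(case case x of (H, u) \<Rightarrow> (H - u, u * w * w) of (H, u) \<Rightarrow> (H + u * w, u * w)) = x"
        by (simp add: x)
      show "(case x of (H, u) \<Rightarrow> (H - u, u * w * w)) \<in> {x \<in> hexes \<times> dirs. \<not> inner (fst x + snd x * w)}"
        using L i dirs_turn w centers_diff by (simp add: x hexes_def)
      have e: "H - u - u * w * w = H + u * w" by (simp add: mult.assoc turn_sq[OF w] algebra_simps)
      show "(case case x of (H, u) \<Rightarrow> (H - u, u * w * w) of (H, u) \<Rightarrow> 1 / deg H u) = b x"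
        using L i by (simp add: x b_def deg_def e)
    next
      fix x assume "x \<in> {x \<in> hexes \<times> dirs. \<not> inner (fst x + snd x * w)}"
      then obtain H u where x: "x = (H, u)" and L: "H \<in> centers" "u \<in> dirs" "inner H" "\<not> inner (H + u * w)"
        by (cases x) (auto simp: hexes_def)
      show "(case case x of (H, u) \<Rightarrow> (H + u * w, u * w) of (H, u) \<Rightarrow> (H - u, u * w * w)) = x"
        by (simp add: x)
      have "inner (vertex (H + u * w) (u * w) w)"
        unfolding vertex_same(1)[OF w] using corner_w(2) L by blast
      then show "(case x of (H, u) \<Rightarrow> (H + u * w, u * w)) \<in> {x \<in> left_turns. inner (fst x - snd x)}"
        using L w dirs_turn centers_add by (simp add: x lt)
    qed
    also have "\<dots> = (\<Sum>x\<in>{x \<in> hexes \<times> dirs. \<not> inner (fst x + snd x * w)}. ind (\<not> inner (fst x + snd x * w)) / deg (fst x) (snd x))"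
      by (rule sum.cong) auto
    also have "\<dots> = (\<Sum>x\<in>hexes \<times> dirs. ind (\<not> inner (fst x + snd x * w)) / deg (fst x) (snd x))"
      by (rule sum.mono_neutral_left) (auto simp: finite_hexes finite_dirs)
    finally show ?thesis by (simp add: case_prod_beta)
  qed
  ultimately show ?thesis
    unfolding add_divide_distrib by (simp add: case_prod_beta sum.distrib)
qed

text \<open>The first two negations say that \<open>H\<close> is the only inner hexagon at one
  corner, so the curve runs round two thirds of the circle there. Either the same holds at the next
  corner of that kind (a shear insertion), or the corner in between at \<open>u * w * w\<close> is
  enclosed (a reflection).\<close>

lemma removable_hexagon:
  assumes "\<forall>(H, u)\<in>left_turns. inner (H + u * w) \<or> inner (H - u)"
  obtains H u where "H \<in> centers" "u \<in> dirs" "inner H" "\<not> inner (H + u * w * w)" "\<not> inner (H - u * w)"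
    "\<not> inner (H + u) \<and> \<not> inner (H - u * w * w) \<or> inner (vertex H (u * w * w) (w * w))"
proof -
  define wt where "wt H u = (ind (\<not> inner (H - u)) + ind (\<not> inner (H + u * w))) / deg H u
      - ind (\<not> inner (vertex H u (w * w)))" for H u
  have "(\<Sum>(H, u)\<in>hexes \<times> dirs. wt H u) = real (card left_turns) - real (card right_turns)"
    unfolding left_turns_sum[OF assms] right_turns_sum wt_def by (simp add: case_prod_beta sum_subtractf)
  also have "\<dots> = 3" using left_right(3) by linarith
  finally have "(\<Sum>H\<in>hexes. \<Sum>u\<in>dirs. wt H u) = 3" by (simp add: sum.cartesian_product)
  then have "\<exists>H\<in>hexes. (\<Sum>u\<in>dirs. wt H u) > 0"
    using sum_nonpos[of hexes "\<lambda>H. \<Sum>u\<in>dirs. wt H u"] by (force simp: not_le)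
  then obtain H where H: "H \<in> centers" "inner H" and pos: "(\<Sum>u\<in>dirs. wt H u) > 0"
    unfolding hexes_def by blast
  define P Q B where "P u = inner (H + u * w)" and "Q u = inner (H - u)" and "B u = inner (vertex H u (w * w))" for u
  have wt: "wt H u = (if P u \<and> Q u then - 1 else if P u \<or> Q u then - 1 / 2 else 1) + (if B u then 1 else 0)" for u
    using H(2) unfolding wt_def deg_def P_def Q_def B_def by simp
  have dirs: "dirs = {\<delta>, \<delta> * w, \<delta> * w * w}" by (rule dirs_eq[OF w dirs_\<delta>])
  have ne: "\<delta> \<noteq> \<delta> * w" "\<delta> \<noteq> \<delta> * w * w" "\<delta> * w \<noteq> \<delta> * w * w"
    using \<delta>_nz turn_neq_1[OF w] turn_neq_1[OF turn_square[OF w]] turn_nz[OF w] by (auto simp: mult.assoc)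
  have "wt H \<delta> + wt H (\<delta> * w) + wt H (\<delta> * w * w) > 0" using pos ne unfolding dirs by simp
  moreover have b: "B u \<Longrightarrow> P (u * w) \<and> Q u" if "u \<in> dirs" for u
    using inner_down[OF H(1) that] unfolding B_def P_def Q_def by simp
  then have "B \<delta> \<Longrightarrow> P (\<delta> * w) \<and> Q \<delta>" "B (\<delta> * w) \<Longrightarrow> P (\<delta> * w * w) \<and> Q (\<delta> * w)"
    "B (\<delta> * w * w) \<Longrightarrow> P \<delta> \<and> Q (\<delta> * w * w)"
    using b[of \<delta>] b[of "\<delta> * w"] b[of "\<delta> * w * w"] unfolding dirs by simp_all
  ultimately have "\<not> P (\<delta> * w) \<and> \<not> Q (\<delta> * w) \<and> (\<not> P (\<delta> * w * w) \<and> \<not> Q (\<delta> * w * w) \<or> B (\<delta> * w * w)) \<or>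
    \<not> P (\<delta> * w * w) \<and> \<not> Q (\<delta> * w * w) \<and> (\<not> P \<delta> \<and> \<not> Q \<delta> \<or> B \<delta>) \<or>
    \<not> P \<delta> \<and> \<not> Q \<delta> \<and> (\<not> P (\<delta> * w) \<and> \<not> Q (\<delta> * w) \<or> B (\<delta> * w))"
    unfolding wt by (intro positive_weight_pattern) auto
  then have "\<exists>u\<in>dirs. \<not> P (u * w) \<and> \<not> Q (u * w) \<and> (\<not> P (u * w * w) \<and> \<not> Q (u * w * w) \<or> B (u * w * w))"
    unfolding dirs by auto
  then obtain u where "u \<in> dirs" "\<not> P (u * w)" "\<not> Q (u * w)"
    "\<not> P (u * w * w) \<and> \<not> Q (u * w * w) \<or> B (u * w * w)" by blast
  then show thesis using that[of H u] H unfolding P_def Q_def B_def by simp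
qed

end

lemma successively_join:
  "successively P (xs @ y # ys) \<longleftrightarrow> successively P (xs @ [y]) \<and> successively P (y # ys)"
  by (auto simp: successively_append_iff)

lemma constructible_sphere:
  assumes "hexagonal_tangle r V (sphere v r)" "v \<in> V"
  shows "constructible r V (sphere v r)"
  unfolding constructible_def using assms by (intro exI[of _ 0] exI[of _ "\<lambda>_. sphere v r"]) auto

lemma constructible_step:
  assumes "constructible r V S" "tangle_operation r V S S'" "hexagonal_tangle r V S'"
  shows "constructible r V S'"
proof -
  obtain k :: nat and \<tau> where \<tau>: "\<forall>i\<le>k. hexagonal_tangle r V (\<tau> i)" "\<exists>v\<in>V. \<tau> 0 = sphere v r" "\<tau> k = S"
    "\<forall>i<k. tangle_operation r V (\<tau> i) (\<tau> (Suc i))" using assms(1) unfolding constructible_def by blast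
  have "\<forall>i<Suc k. tangle_operation r V ((\<tau>(Suc k := S')) i) ((\<tau>(Suc k := S')) (Suc i))"
    using \<tau>(3,4) assms(2) by (auto simp: less_Suc_eq)
  moreover have "\<forall>i\<le>Suc k. hexagonal_tangle r V ((\<tau>(Suc k := S')) i)"
    using \<tau>(1) assms(3) by (auto simp: le_Suc_eq)
  ultimately show ?thesis unfolding constructible_def using \<tau>(2)
    by (intro exI[of _ "Suc k"] exI[of _ "\<tau>(Suc k := S')"]) auto
qed

context hexgrid
begin

section \<open>Reduction of tours\<close>

lemma tour_next:
  assumes "tour es" "es = xs @ (H - u, u) # ys" "(H, u, s) \<in> tour_corners es"
  shows "hd (ys @ [hd es]) = (H, u * s)"
proof -
  let ?e = "(H - u, u)"
  obtain z zs where z: "ys @ [hd es] = z # zs" by (cases "ys @ [hd es]") auto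
  then have es: "es @ [hd es] = xs @ ?e # z # zs" using assms(2) by simp
  have e: "?e \<in> edges" using assms(1,2) by (auto simp: tour_def)
  have "successively step (?e # z # zs)"
    using assms(1) unfolding tour_def es successively_append_iff by blast
  then have st: "step ?e z" by simp
  obtain s' where "z = (fst ?e + snd ?e, snd ?e * s')" "corner_of ?e z = (fst ?e + snd ?e, snd ?e, s')"
    by (rule corner_of_step[OF st e])
  then have s': "z = (H, u * s')" "corner_of ?e z = (H, u, s')" by simp_all
  have "cpath (es @ [hd es]) = cpath (xs @ [?e]) @ corner_of ?e z # cpath (z # zs)"
    unfolding es using cpath_append[of xs ?e "z # zs"] by (simp only: cpath_simps)
  then have "(H, u, s') \<in> tour_corners es" unfolding tour_corners_def s'(2) by simp
  then have "s' = s" using inj_onD[OF tour_corner_start(2)[OF assms(1)], of "(H, u, s')" "(H, u, s)"] assms(3)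
    by simp
  then show ?thesis unfolding z using s'(1) by simp
qed

lemma tour_next_Cons:
  assumes "tour es" "es = xs @ (H - u, u) # ys" "(H, u, s) \<in> tour_corners es" "hd es \<noteq> (H, u * s)"
  obtains zs where "ys = (H, u * s) # zs"
proof -
  have h: "hd (ys @ [hd es]) = (H, u * s)" by (rule tour_next[OF assms(1-3)])
  then have "ys \<noteq> []" using assms(4) by (intro notI) simp
  then have "ys = (H, u * s) # tl ys" using h by (cases ys) simp_all
  then show thesis by (rule that)
qed

text \<open>Only the multiset of corners is compared: excess and curve do not depend on where the
  list starts.\<close>

lemma tour_rotate:
  assumes "tour (xs @ ys)" "ys \<noteq> []"
  shows "tour (ys @ xs)" "mset (cpath ((ys @ xs) @ [hd (ys @ xs)])) = mset (cpath ((xs @ ys) @ [hd (xs @ ys)]))"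
proof -
  have "tour (ys @ xs) \<and> mset (cpath ((ys @ xs) @ [hd (ys @ xs)])) = mset (cpath ((xs @ ys) @ [hd (xs @ ys)]))"
  proof (cases xs)
    case Nil
    then show ?thesis using assms by simp
  next
    case (Cons a as)
    obtain b bs where b: "ys = b # bs" using assms(2) by (cases ys) auto
    have 1: "(xs @ ys) @ [hd (xs @ ys)] = (a # as) @ b # (bs @ [a])" by (simp add: Cons b)
    have 2: "(ys @ xs) @ [hd (ys @ xs)] = (b # bs) @ a # (as @ [b])" by (simp add: Cons b)
    have "successively step (a # (as @ [b])) \<and> successively step (b # (bs @ [a]))"
      using assms(1) unfolding tour_def 1 successively_join[of step "a # as" b "bs @ [a]"] by simp
    then have "successively step ((ys @ xs) @ [hd (ys @ xs)])"
      unfolding 2 successively_join[of step "b # bs" a "as @ [b]"] by simp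
    moreover have "mset (cpath ((b # bs) @ a # (as @ [b]))) = mset (cpath ((a # as) @ b # (bs @ [a])))"
      using arg_cong[OF cpath_append[of "b # bs" a "as @ [b]"], of mset]
        arg_cong[OF cpath_append[of "a # as" b "bs @ [a]"], of mset] by (simp del: cpath_simps)
    moreover have "ys @ xs \<noteq> [] \<and> distinct (ys @ xs) \<and> set (ys @ xs) \<subseteq> edges"
      using assms unfolding tour_def by auto
    ultimately show ?thesis unfolding tour_def 1 2 by blast
  qed
  then show "tour (ys @ xs)" "mset (cpath ((ys @ xs) @ [hd (ys @ xs)])) = mset (cpath ((xs @ ys) @ [hd (xs @ ys)]))"
    by auto
qed

lemma turns_mset: "mset cs = mset cs' \<Longrightarrow> turns w cs = turns w cs'"
  unfolding turns_def by (simp only: sum_mset_sum_list[symmetric] mset_map)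

text \<open>Up to a positive factor the signed area of the polygon of hexagon centres traced by the tour.\<close>

definition area :: "complex \<Rightarrow> (complex \<times> complex) list \<Rightarrow> real" where
  "area w es = (\<Sum>(P, u)\<leftarrow>es. Im (cnj P * u)) * Im w"

lemma area_mset: "mset es = mset es' \<Longrightarrow> area w es = area w es'"
  unfolding area_def by (simp only: sum_mset_sum_list[symmetric] mset_map)

lemma tour_sum:
  assumes "successively step (e # xs)"
  shows "fst (last (e # xs)) = fst e + (\<Sum>(P, u)\<leftarrow>butlast (e # xs). u)"
  using assms
proof (induction xs arbitrary: e)
  case (Cons y ys)
  have "fst y = fst e + snd e" using Cons.prems by (auto simp: step_def)
  then show ?case using Cons by (simp add: case_prod_beta add.assoc)
qed simp

lemma tour_dist:
  assumes "successively step (e # xs)" "set (e # xs) \<subseteq> edges" "x \<in> set (e # xs)"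
  shows "norm (fst x - fst e) \<le> real (length xs) * norm \<delta>"
  using assms
proof (induction xs arbitrary: e)
  case (Cons y ys)
  show ?case
  proof (cases "x = e")
    case False
    then have x: "norm (fst x - fst y) \<le> real (length ys) * norm \<delta>" using Cons by simp
    have y: "fst y = fst e + snd e" using Cons.prems(1) by (auto simp: step_def)
    have e: "norm (snd e) = norm \<delta>" using Cons.prems(2) dirs_norm norm_\<delta> by (auto simp: edges_def)
    have "fst x - fst e = (fst x - fst y) + snd e" unfolding y by simp
    then have "norm (fst x - fst e) \<le> norm (fst x - fst y) + norm (snd e)" using norm_triangle_ineq by metis
    also have "\<dots> \<le> real (length (y # ys)) * norm \<delta>" using x e by (simp add: algebra_simps)
    finally show ?thesis .
  qed simp
qed simp

text \<open>The steps of a closed tour sum to 0, so base points may be measured from the first one.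
  Each is then at most n \<bar>\<delta>\<bar> away for a tour of length n, which bounds the n
  summands by n \<bar>\<delta>\<bar>\<bar>\<delta>\<bar>, and the square of \<bar>\<delta>\<bar> is
  12 r r.\<close>

lemma area_bound:
  assumes "tour es" "turn w"
  shows "area w es \<ge> - (12 * r\<^sup>2 * (real (length es))\<^sup>2)"
proof -
  obtain e xs where es: "es = e # xs" using assms(1) by (cases es) (auto simp: tour_def)
  define P0 where "P0 = fst e"
  have succ: "successively step (e # xs @ [e])" "set es \<subseteq> edges" using assms(1) by (auto simp: tour_def es)
  have "(\<Sum>(P, u)\<leftarrow>es. u) = 0" using tour_sum[OF succ(1)] by (simp add: es)
  then have z: "Im (cnj P0 * (\<Sum>(P, u)\<leftarrow>es. u)) = 0" by simp
  have "(\<Sum>(P, u)\<leftarrow>zs. Im (cnj P * u)) = (\<Sum>(P, u)\<leftarrow>zs. Im (cnj (P - P0) * u)) + Im (cnj P0 * (\<Sum>(P, u)\<leftarrow>zs. u))" for zs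
    by (induction zs) (auto simp: algebra_simps)
  from this[of es] have a: "area w es = (\<Sum>(P, u)\<leftarrow>es. Im (cnj (P - P0) * u)) * Im w"
    unfolding area_def z by (simp only: add_0_right)
  have "\<bar>Im (cnj (fst x - P0) * snd x)\<bar> \<le> real (length es) * (norm \<delta>)\<^sup>2" if x: "x \<in> set es" for x
  proof -
    have "successively step (e # xs)" using succ(1) successively_append_iff[of step "e # xs" "[e]"] by simp
    then have "norm (fst x - P0) \<le> real (length xs) * norm \<delta>"
      using tour_dist[of e xs x] succ(2) x unfolding es P0_def by blast
    also have "\<dots> \<le> real (length es) * norm \<delta>" by (intro mult_right_mono) (auto simp: es)
    finally have "norm (fst x - P0) * norm \<delta> \<le> real (length es) * norm \<delta> * norm \<delta>" by (intro mult_right_mono) auto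
    moreover have "norm (snd x) = norm \<delta>" using succ(2) x dirs_norm norm_\<delta> by (auto simp: edges_def)
    moreover have "\<bar>Im (cnj (fst x - P0) * snd x)\<bar> \<le> norm (cnj (fst x - P0) * snd x)" by (rule abs_Im_le_cmod)
    moreover have "norm (cnj (fst x - P0) * snd x) = norm (fst x - P0) * norm (snd x)"
      by (simp only: norm_mult complex_mod_cnj)
    ultimately show ?thesis by (simp only: power2_eq_square mult.assoc)
  qed
  then have b: "\<forall>x\<in>set es. \<bar>Im (cnj (fst x - P0) * snd x)\<bar> \<le> real (length es) * (norm \<delta>)\<^sup>2" by blast
  have "\<bar>\<Sum>(P, u)\<leftarrow>zs. Im (cnj (P - P0) * u)\<bar> \<le> real (length zs) * c"
    if "\<forall>x\<in>set zs. \<bar>Im (cnj (fst x - P0) * snd x)\<bar> \<le> c" for zs c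
    using that
  proof (induction zs)
    case (Cons z zs)
    then show ?case
      using abs_triangle_ineq[of "Im (cnj (fst z - P0) * snd z)" "\<Sum>(P, u)\<leftarrow>zs. Im (cnj (P - P0) * u)"]
      by (simp only: list.set ball_simps insert_iff list.map sum_list.Cons case_prod_beta length_Cons of_nat_Suc
          distrib_right mult_1) linarith
  qed simp
  from this[OF b] have "\<bar>\<Sum>(P, u)\<leftarrow>es. Im (cnj (P - P0) * u)\<bar> \<le> real (length es) * (real (length es) * (norm \<delta>)\<^sup>2)" .
  moreover have "\<bar>Im w\<bar> \<le> 1" using abs_Im_le_cmod[of w] turn_norm[OF assms(2)] by simp
  ultimately have "\<bar>area w es\<bar> \<le> real (length es) * (real (length es) * (norm \<delta>)\<^sup>2) * 1"
    unfolding a abs_mult by (intro mult_mono) auto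
  also have "\<dots> = 12 * r\<^sup>2 * (real (length es))\<^sup>2" by (simp add: norm_\<delta> power_mult_distrib power2_eq_square)
  finally show ?thesis by linarith
qed

text \<open>The three arcs cut out the sectors x, y \<ge> 0, then x \<le> 0, x \<le> y, and finally
  y \<le> 0, y \<le> x, which cover the plane; turning by \<open>s\<close> maps one to the next and
  preserves \<open>quad\<close>.\<close>

lemma three_arcs:
  assumes "is_corner H u s"
  shows "arc H u s \<union> arc (H + u * s) (u * s) s \<union> arc (H - u) (u * s * s) s = sphere (vertex H u s) r"
proof
  have s: "turn s" and u: "u \<in> dirs" using assms by auto
  have d: "u * s \<in> dirs" "u * s * s \<in> dirs" using dirs_turn s u by blast+
  show "arc H u s \<union> arc (H + u * s) (u * s) s \<union> arc (H - u) (u * s * s) s \<subseteq> sphere (vertex H u s) r"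
    using arc_on_circle[OF _ u s, of _ H] arc_on_circle[OF _ d(1) s, of _ "H + u * s"]
      arc_on_circle[OF _ d(2) s, of _ "H - u"]
    unfolding vertex_same[OF s] by (auto simp: dist_commute)
  show "sphere (vertex H u s) r \<subseteq> arc H u s \<union> arc (H + u * s) (u * s) s \<union> arc (H - u) (u * s * s) s"
  proof
    fix z assume "z \<in> sphere (vertex H u s) r"
    then have z: "dist z (vertex H u s) = r" by (simp add: dist_commute)
    obtain x y where xy: "z = pt H u s x y" using pt_exists[OF u s] .
    have q: "quad x y = 1 / 4" using z on_circle_iff(1)[OF u s] unfolding xy by blast
    have k: "X * (- 1 - 2 * s) + Y * (2 + s) = s * ((Y - X) * (- 1 - 2 * s) + - X * (2 + s))"
      "X * (- 1 - 2 * s) + Y * (2 + s) = s * s * (- Y * (- 1 - 2 * s) + (X - Y) * (2 + s))" for X Y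
      by (simp_all add: algebra_simps turn_sq[OF s] turn_sq_left[OF s])
    have 1: "z = pt (H + u * s) (u * s) s (y - x) (- x)"
      unfolding xy pt_def vertex_same[OF s] k(1)[of "of_real x" "of_real y"] by simp
    have 2: "z = pt (H - u) (u * s * s) s (- y) (x - y)"
      unfolding xy pt_def vertex_same[OF s] k(2)[of "of_real x" "of_real y"] by (simp add: mult.assoc)
    have qq: "quad (y - x) (- x) = 1 / 4" "quad (- y) (x - y) = 1 / 4"
      using q unfolding quad_def by (simp_all add: power2_eq_square algebra_simps)
    consider "0 \<le> x" "0 \<le> y" | "x \<le> 0" "x \<le> y" | "y \<le> 0" "y \<le> x" by linarith
    then show "z \<in> arc H u s \<union> arc (H + u * s) (u * s) s \<union> arc (H - u) (u * s * s) s"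
    proof cases
      case 1
      then have "z \<in> arc H u s" using xy q unfolding arc_def by blast
      then show ?thesis by blast
    next
      case 2
      then have "z \<in> arc (H + u * s) (u * s) s" using \<open>z = pt (H + u * s) (u * s) s (y - x) (- x)\<close> qq(1)
        unfolding arc_def by (intro CollectI exI[of _ "y - x"] exI[of _ "- x"]) auto
      then show ?thesis by blast
    next
      case 3
      then have "z \<in> arc (H - u) (u * s * s) s" using 2 qq(2)
        unfolding arc_def by (intro CollectI exI[of _ "- y"] exI[of _ "x - y"]) auto
      then show ?thesis by blast
    qed
  qed
qed

lemma corner_of_turn: "u \<noteq> 0 \<Longrightarrow> u' = u * s \<Longrightarrow> corner_of (P, u) (Q, u') = (Q, u, s)"
  by (simp add: corner_of_def)

end

section \<open>The configurations at the end of a reduction and those that can be undone\<close>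

context oriented_tour
begin

lemma stepI: "turn s \<Longrightarrow> Q = P + u \<Longrightarrow> u' = u * s \<Longrightarrow> step (P, u) (Q, u')"
  by (auto simp: step_def)

text \<open>The successor of an edge stands next to it in the list unless the tour closes there,
  which the condition on \<open>hd es\<close> excludes.\<close>

lemma next_edge:
  assumes "es = xs @ (P, u) # ys" "(Q, u, s) \<in> tour_corners es" "Q = P + u" "u' = u * s" "hd es \<noteq> (Q, u')"
  shows "\<exists>zs. ys = (Q, u') # zs"
proof -
  have "es = xs @ (Q - u, u) # ys" "hd es \<noteq> (Q, u * s)" using assms by simp_all
  then obtain zs where "ys = (Q, u * s) # zs" by (rule tour_next_Cons[OF tour _ assms(2)])
  then show ?thesis using assms(4) by blast
qed

lemma tour_edge_corner:
  assumes "(P, u) \<in> set es"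
  shows "P \<in> centers" "u \<in> dirs" "(P + u, u, w) \<in> tour_corners es \<or> (P + u, u, w * w) \<in> tour_corners es"
proof -
  have "(P, u) \<in> edges" using assms tour by (auto simp: tour_def)
  then show "P \<in> centers" "u \<in> dirs" by (auto simp: edges_def)
  have "(P, u) \<in> (\<lambda>(H, u, s). (H - u, u)) ` set (cpath (es @ [hd es]))"
    using assms arg_cong[OF tour_corner_start(1)[OF tour], of set] by simp
  then obtain H s where H: "(H, u, s) \<in> tour_corners es" "P = H - u" unfolding tour_corners_def by auto
  then have "turn s" using tour_tangle(3)[OF tour] by (auto simp: corners_def)
  then have "s = w \<or> s = w * w" using turn_cases w by blast
  then show "(P + u, u, w) \<in> tour_corners es \<or> (P + u, u, w * w) \<in> tour_corners es" using H by auto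
qed

lemma corners_at:
  assumes "H \<in> centers" "u \<in> dirs"
  shows "inner H \<Longrightarrow> \<not> inner (H + u * w) \<Longrightarrow> (H + u * w, u * w, w) \<in> tour_corners es"
    and "inner H \<Longrightarrow> \<not> inner (H - u) \<Longrightarrow> (H - u, u * w * w, w) \<in> tour_corners es"
    and "inner H \<Longrightarrow> \<not> inner (H + u * w * w) \<or> \<not> inner (H - u) \<Longrightarrow> (H, u, w * w) \<in> tour_corners es"
proof -
  have d: "u * w \<in> dirs" "u * w * w \<in> dirs" using assms(2) w dirs_turn by blast+
  have c: "H + u * w \<in> centers" "H - u \<in> centers" using assms d centers_add centers_diff by blast+
  show "(H + u * w, u * w, w) \<in> tour_corners es" if "inner H" "\<not> inner (H + u * w)"
    using corner_w(1)[OF c(1) d(1)] corner_w(2)[OF assms] that vertex_same(1)[OF w] by simp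
  show "(H - u, u * w * w, w) \<in> tour_corners es" if "inner H" "\<not> inner (H - u)"
    using corner_w(1)[OF c(2) d(2)] corner_w(2)[OF assms] that vertex_same(2)[OF w] by simp
  show "(H, u, w * w) \<in> tour_corners es" if "inner H" "\<not> inner (H + u * w * w) \<or> \<not> inner (H - u)"
    using corner_ww(1)[OF assms] inner_down[OF assms] that by blast
qed

text \<open>With all three hexagons at the enclosed vertex outer, each of the three links of its
  circle belongs to the tour. They follow one another and return to the first edge, so there is
  nothing else.\<close>

lemma constructible_circle:
  assumes "(H, u) \<in> left_turns" "\<not> inner (H + u * w)" "\<not> inner (H - u)" "hd es = (H - u, u)"
  shows "constructible r vertices (tour_curve es)"
proof -
  have c0: "(H, u, w) \<in> tour_corners es" using assms(1) by (simp add: left_turns_def)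
  then have H: "H \<in> centers" "u \<in> dirs" using tour_tangle(3)[OF tour] by (auto simp: corners_def)
  have v: "inner (vertex H u w)" using corner_w(1)[OF H] c0 by blast
  have d: "u * w \<in> dirs" "u * w * w \<in> dirs" using H(2) w dirs_turn by blast+
  have c: "H + u * w \<in> centers" "H - u \<in> centers" using H d centers_add centers_diff by blast+
  have c1: "(H + u * w, u * w, w) \<in> tour_corners es"
    using corner_w(1)[OF c(1) d(1)] v assms(2) vertex_same(1)[OF w] by simp
  have c2: "(H - u, u * w * w, w) \<in> tour_corners es"
    using corner_w(1)[OF c(2) d(2)] v assms(3) vertex_same(2)[OF w] by simp
  have k: "u * w * w = - u - u * w" using turn_sq[OF w] by algebra
  have nz: "u \<noteq> 0" "w \<noteq> 0" "w \<noteq> 1" "w * w \<noteq> 1"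
    using dirs_nz[OF H(2)] turn_nz[OF w] turn_neq_1[OF w] turn_neq_1[OF turn_square[OF w]] by auto
  obtain ys where es: "es = (H - u, u) # ys" using assms(4) tour by (cases es) (auto simp: tour_def)
  obtain zs where zs: "ys = (H, u * w) # zs"
    using next_edge[of "[]" "H - u" u ys H w "u * w"] es c0 nz by auto
  obtain xs where xs: "zs = (H + u * w, u * w * w) # xs"
    using next_edge[of "[(H - u, u)]" H "u * w" zs "H + u * w" w "u * w * w"] es zs c1 nz by (auto simp: mult.assoc)
  have "hd (xs @ [hd es]) = (H - u, u * w * w * w)"
    using tour_next[OF tour, of "[(H - u, u), (H, u * w)]" "H - u" "u * w * w" xs w] es zs xs c2 by (simp add: k)
  then have h: "hd (xs @ [(H - u, u)]) = (H - u, u)" by (simp add: es)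
  have "xs = []"
  proof (rule ccontr)
    assume "xs \<noteq> []"
    then have "(H - u, u) \<in> set xs" using h by (cases xs) auto
    then show False using tour unfolding tour_def es zs xs by simp
  qed
  moreover have cc: "corner_of (H + u * w, u * w * w) (H - u, u) = (H - u, u * w * w, w)"
    by (rule corner_of_turn) (use nz in simp_all)
  ultimately have "tour_corners es = {corner_of (H - u, u) (H, u * w), corner_of (H, u * w) (H + u * w, u * w * w),
      corner_of (H + u * w, u * w * w) (H - u, u)}"
    unfolding tour_corners_def by (simp add: es zs xs)
  also have "\<dots> = {(H, u, w), (H + u * w, u * w, w), (H - u, u * w * w, w)}"
    unfolding cc using nz by (simp add: corner_of_turn)
  finally have "tour_curve es = sphere (vertex H u w) r"
    using three_arcs[of H u w] H w unfolding tour_curve_def by (simp add: Un_assoc)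
  moreover have "vertex H u w \<in> vertices" using H w by simp
  ultimately show ?thesis using constructible_sphere[of r vertices] tour_tangle(1)[OF tour] by simp
qed

text \<open>The walk visits \<open>H\<close> three times. Deleting the two triangular loops
  \<open>e1\<close>, \<open>e2\<close>, \<open>e3\<close> and \<open>e4\<close>, \<open>e5\<close>,
  \<open>e6\<close> leaves a single turn by \<open>w\<close> from \<open>e0\<close> to
  \<open>e7\<close>; distinctness is inherited because no edge is new.\<close>

lemma shear_case:
  assumes H: "H \<in> centers" "u \<in> dirs" "inner H" and out: "\<not> inner (H + u * w * w)" "\<not> inner (H - u * w)"
    "\<not> inner (H + u)" "\<not> inner (H - u * w * w)" and hd: "hd es = (H - u, u)"
  obtains es' where "oriented_tour p \<delta> r es' w" "tangle_operation r vertices (tour_curve es') (tour_curve es)"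
    "length es' < length es"
proof -
  define e0 e1 e2 e3 e4 e5 e6 e7 where "e0 = (H - u, u)" and "e1 = (H, u * w * w)" and "e2 = (H + u * w * w, u)"
    and "e3 = (H - u * w, u * w)" and "e4 = (H, u)" and "e5 = (H + u, u * w)"
    and "e6 = (H - u * w * w, u * w * w)" and "e7 = (H, u * w)"
  note e = e0_def e1_def e2_def e3_def e4_def e5_def e6_def e7_def
  have k: "u * w * w = - u - u * w" using turn_sq[OF w] by algebra
  have k': "x * (w * w) = x * w * w" for x by (simp only: mult.assoc)
  have q: "H + u * w * w + u = H - u * w" "H + u + u * w = H - u * w * w" "H + u * w + u = H - u * w * w"
    by (simp_all add: k)
  have nz: "u \<noteq> 0" "w \<noteq> 0" "w \<noteq> 1" "w * w \<noteq> 1"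
    using dirs_nz[OF H(2)] turn_nz[OF w] turn_neq_1[OF w] turn_neq_1[OF turn_square[OF w]] by auto
  have uw: "u * w \<noteq> 0" "u * w * w \<noteq> 0" "u * w \<noteq> u" "u * w * w \<noteq> u"
    using nz by (auto simp: mult.assoc)
  have "H + u * w * w = H - u - u * w" by (simp add: k)
  then have "H - u \<noteq> H + u * w * w" using uw(1) by simp
  note uw = uw this
  have d: "u * w \<in> dirs" "u * w * w \<in> dirs" using H(2) w dirs_turn by blast+
  have c1: "(H, u, w * w) \<in> tour_corners es" using corners_at(3)[OF H(1,2)] H(3) out by blast
  have c2: "(H + u * w * w, u * w * w, w) \<in> tour_corners es"
    using corners_at(1)[OF H(1) d(1)] H(3) out by blast
  have c3: "(H - u * w, u, w) \<in> tour_corners es"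
    using corners_at(2)[OF H(1) d(1)] H(3) out by simp
  have c4: "(H, u * w, w * w) \<in> tour_corners es"
    using corners_at(3)[OF H(1) d(1)] H(3) out by blast
  have c5: "(H + u, u, w) \<in> tour_corners es"
    using corners_at(1)[OF H(1) d(2)] H(3) out by simp
  have c6: "(H - u * w * w, u * w, w) \<in> tour_corners es"
    using corners_at(2)[OF H(1) d(2)] H(3) out by simp
  have c7: "(H, u * w * w, w * w) \<in> tour_corners es"
    using corners_at(3)[OF H(1) d(2)] H(3) out by blast
  obtain y1 where y1: "es = e0 # y1" using hd tour by (cases es) (auto simp: tour_def e0_def)
  obtain y2 where y2: "y1 = e1 # y2"
    using next_edge[of "[]" "H - u" "u" y1 "H" "w * w" "u * w * w", OF _ c1] uw
    by (auto simp: y1 e k' q)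
  obtain y3 where y3: "y2 = e2 # y3"
    using next_edge[of "[e0]" "H" "u * w * w" y2 "H + u * w * w" "w" "u", OF _ c2] uw
    by (auto simp: y1 y2 e k' q)
  obtain y4 where y4: "y3 = e3 # y4"
    using next_edge[of "[e0, e1]" "H + u * w * w" "u" y3 "H - u * w" "w" "u * w", OF _ c3] uw
    by (auto simp: y1 y2 y3 e k' q)
  obtain y5 where y5: "y4 = e4 # y5"
    using next_edge[of "[e0, e1, e2]" "H - u * w" "u * w" y4 "H" "w * w" "u", OF _ c4] uw
    by (auto simp: y1 y2 y3 y4 e k' q)
  obtain y6 where y6: "y5 = e5 # y6"
    using next_edge[of "[e0, e1, e2, e3]" "H" "u" y5 "H + u" "w" "u * w", OF _ c5] uw
    by (auto simp: y1 y2 y3 y4 y5 e k' q)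
  obtain y7 where y7: "y6 = e6 # y7"
    using next_edge[of "[e0, e1, e2, e3, e4]" "H + u" "u * w" y6 "H - u * w * w" "w" "u * w * w", OF _ c6] uw
    by (auto simp: y1 y2 y3 y4 y5 y6 e k' q)
  obtain rest where y8: "y7 = e7 # rest"
    using next_edge[of "[e0, e1, e2, e3, e4, e5]" "H - u * w * w" "u * w * w" y7 "H" "w * w" "u * w", OF _ c7] uw
    by (auto simp: y1 y2 y3 y4 y5 y6 y7 e k' q)
  have es: "es = e0 # [e1, e2, e3, e4, e5, e6] @ e7 # rest" by (simp add: y1 y2 y3 y4 y5 y6 y7 y8)
  define es' where "es' = e0 # [] @ e7 # rest"
  have co: "corner_of e0 e1 = (H, u, w * w)" "corner_of e1 e2 = (H + u * w * w, u * w * w, w)"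
    "corner_of e2 e3 = (H - u * w, u, w)" "corner_of e3 e4 = (H, u * w, w * w)" "corner_of e4 e5 = (H + u, u, w)"
    "corner_of e5 e6 = (H - u * w * w, u * w, w)" "corner_of e6 e7 = (H, u * w * w, w * w)"
    "corner_of e0 e7 = (H, u, w)"
    unfolding e using uw nz by (intro corner_of_turn; simp add: k')+
  have "step e0 e7" using w by (auto simp: step_def e)
  then have T: "tour es'" using tour unfolding es es'_def tour_def by auto
  have tu: "turns w (cpath (es' @ [e0])) = 3"
    using turns turn_sq_neq[OF w] by (simp add: es es'_def co)
  have "replacement (map (curv w) (cpath (e0 # [] @ [e7])))
      (map (curv w) (cpath (e0 # [e1, e2, e3, e4, e5, e6] @ [e7]))) r vertices (tour_curve es') (tour_curve es)"
    unfolding es es'_def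
    by (rule surgery_replacement) (use tour turns T tu w in \<open>simp_all add: es es'_def\<close>)
  then have "shear_insertion r vertices (tour_curve es') (tour_curve es)"
    using turn_sq_neq[OF w] by (simp add: shear_insertion_def co curv_def)
  moreover have "oriented_tour p \<delta> r es' w"
    by unfold_locales (use T w tu in \<open>simp_all add: es'_def\<close>)
  ultimately show thesis using that[of es'] by (simp add: tangle_operation_def es es'_def)
qed

text \<open>The triangular loop \<open>e1\<close>, \<open>e2\<close>, \<open>e3\<close> at
  \<open>H\<close> is exchanged for the loop \<open>f1\<close>, \<open>f2\<close>, \<open>f3\<close>
  of the opposite sense on the other side.\<close>

lemma reflection_case:
  assumes H: "H \<in> centers" "u \<in> dirs" "inner H" and out: "\<not> inner (H + u * w * w)" "\<not> inner (H - u * w)"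
    and v: "inner (vertex H (u * w * w) (w * w))" and hd: "hd es = (H - u, u)"
  obtains es' where "oriented_tour p \<delta> r es' w" "tangle_operation r vertices (tour_curve es') (tour_curve es)"
    "length es' = length es" "area w es' = area w es - 18 * r\<^sup>2"
proof -
  define e0 e1 e2 e3 e4 f1 f2 f3 where "e0 = (H - u, u)" and "e1 = (H, u * w * w)" and "e2 = (H + u * w * w, u)"
    and "e3 = (H - u * w, u * w)" and "e4 = (H, u)" and "f1 = (H, u * w)" and "f2 = (H + u * w, u)"
    and "f3 = (H - u * w * w, u * w * w)"
  note e = e0_def e1_def e2_def e3_def e4_def f1_def f2_def f3_def
  have k: "u * w * w = - u - u * w" using turn_sq[OF w] by algebra
  have k': "x * (w * w) = x * w * w" for x by (simp only: mult.assoc)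
  have q: "H + u * w * w + u = H - u * w" "H + u + u * w = H - u * w * w" "H + u * w + u = H - u * w * w"
    by (simp_all add: k)
  have nz: "u \<noteq> 0" "w \<noteq> 0" "w \<noteq> 1" "w * w \<noteq> 1"
    using dirs_nz[OF H(2)] turn_nz[OF w] turn_neq_1[OF w] turn_neq_1[OF turn_square[OF w]] by auto
  have uw: "u * w \<noteq> 0" "u * w * w \<noteq> 0" "u * w \<noteq> u" "u * w * w \<noteq> u" "u * w * w \<noteq> u * w"
    using nz by (auto simp: mult.assoc)
  have "H + u * w * w = H - u - u * w" by (simp add: k)
  then have "H - u \<noteq> H + u * w * w" using uw(1) by simp
  note uw = uw this
  have d: "u * w \<in> dirs" "u * w * w \<in> dirs" using H(2) w dirs_turn by blast+
  have c1: "(H, u, w * w) \<in> tour_corners es" using corners_at(3)[OF H(1,2)] H(3) out by blast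
  have c2: "(H + u * w * w, u * w * w, w) \<in> tour_corners es"
    using corners_at(1)[OF H(1) d(1)] H(3) out by blast
  have c3: "(H - u * w, u, w) \<in> tour_corners es"
    using corners_at(2)[OF H(1) d(1)] H(3) out by simp
  have c4: "(H, u * w, w * w) \<in> tour_corners es"
    using corners_at(3)[OF H(1) d(1)] H(3) out by blast
  obtain y1 where y1: "es = e0 # y1" using hd tour by (cases es) (auto simp: tour_def e0_def)
  obtain y2 where y2: "y1 = e1 # y2"
    using next_edge[of "[]" "H - u" "u" y1 "H" "w * w" "u * w * w", OF _ c1] uw
    by (auto simp: y1 e k' q)
  obtain y3 where y3: "y2 = e2 # y3"
    using next_edge[of "[e0]" "H" "u * w * w" y2 "H + u * w * w" "w" "u", OF _ c2] uw
    by (auto simp: y1 y2 e k' q)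
  obtain y4 where y4: "y3 = e3 # y4"
    using next_edge[of "[e0, e1]" "H + u * w * w" "u" y3 "H - u * w" "w" "u * w", OF _ c3] uw
    by (auto simp: y1 y2 y3 e k' q)
  obtain rest where y5: "y4 = e4 # rest"
    using next_edge[of "[e0, e1, e2]" "H - u * w" "u * w" y4 "H" "w * w" "u", OF _ c4] uw
    by (auto simp: y1 y2 y3 y4 e k' q)
  have es: "es = e0 # [e1, e2, e3] @ e4 # rest" by (simp add: y1 y2 y3 y4 y5)
  define es' where "es' = e0 # [f1, f2, f3] @ e4 # rest"
  have down: "inner (H + u * w)" "inner (H - u * w * w)"
    using inner_down[OF H(1) d(2) v] by simp_all
  have s: "turn (w * w)" using w by simp
  have vs: "vertex (H + u * w) (u * w) (w * w) = vertex H (u * w * w) (w * w)"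
    "vertex (H - u * w * w) u (w * w) = vertex H (u * w * w) (w * w)"
    using vertex_same[OF s, of H "u * w * w"] by (simp_all add: k')
  have hc: "H + u * w \<in> centers" "H - u * w * w \<in> centers" using H(1) d centers_add centers_diff by blast+
  \<comment> \<open>Each edge of the tour starts one of two corners. For the new edges both are
    impossible: the corner turning by \<open>w\<close> has an inner centre, the one turning by
    \<open>w * w\<close> an enclosed vertex.\<close>
  have new: "f1 \<notin> set es" "f2 \<notin> set es" "f3 \<notin> set es"
  proof -
    show "f1 \<notin> set es"
      using tour_edge_corner(3)[of H "u * w"] corner_w(1)[OF hc(1) d(1)] corner_ww(1)[OF hc(1) d(1)] down v
      unfolding vs f1_def by blast
    show "f2 \<notin> set es"
      using tour_edge_corner(3)[of "H + u * w" u] corner_w(1)[OF hc(2) H(2)] corner_ww(1)[OF hc(2) H(2)] down v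
      unfolding vs f2_def q by blast
    show "f3 \<notin> set es"
      using tour_edge_corner(3)[of "H - u * w * w" "u * w * w"] corner_w(1)[OF H(1) d(2)] corner_ww(1)[OF H(1) d(2)] H(3) v
      unfolding f3_def diff_add_cancel by blast
  qed
  have co: "corner_of e0 e1 = (H, u, w * w)" "corner_of e1 e2 = (H + u * w * w, u * w * w, w)"
    "corner_of e2 e3 = (H - u * w, u, w)" "corner_of e3 e4 = (H, u * w, w * w)" "corner_of e0 f1 = (H, u, w)"
    "corner_of f1 f2 = (H + u * w, u * w, w * w)" "corner_of f2 f3 = (H - u * w * w, u, w * w)"
    "corner_of f3 e4 = (H, u * w * w, w)"
    unfolding e using uw nz by (intro corner_of_turn; simp add: k')+
  have st: "step e0 f1" "step f1 f2" "step f2 f3" "step f3 e4"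
    unfolding e
    by (rule stepI[OF w], simp, simp, rule stepI[OF s], simp, simp add: k', rule stepI[OF s], simp add: q, simp add: k',
        rule stepI[OF w], simp, simp)
  have fe: "f1 \<in> edges" "f2 \<in> edges" "f3 \<in> edges" using H d hc by (auto simp: e edges_def)
  have "distinct [f1, f2, f3]" unfolding e using uw by auto
  then have T: "tour es'" using tour st fe new unfolding es es'_def tour_def by auto
  have tu: "turns w (cpath (es' @ [e0])) = 3"
    using turns turn_sq_neq[OF w] by (simp add: es es'_def co)
  have "replacement (map (curv w) (cpath (e0 # [f1, f2, f3] @ [e4])))
      (map (curv w) (cpath (e0 # [e1, e2, e3] @ [e4]))) r vertices (tour_curve es') (tour_curve es)"
    unfolding es es'_def
    by (rule surgery_replacement) (use tour turns T tu w in \<open>simp_all add: es es'_def\<close>)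
  then have "reflection r vertices (tour_curve es') (tour_curve es)"
    using turn_sq_neq[OF w] by (simp add: reflection_def co curv_def)
  moreover have "oriented_tour p \<delta> r es' w"
    by unfold_locales (use T w tu in \<open>simp_all add: es'_def\<close>)
  moreover have "area w es' = area w es - 18 * r\<^sup>2"
  proof -
    have n: "(Re u)\<^sup>2 + (Im u)\<^sup>2 = 12 * r\<^sup>2"
      using dirs_norm[OF H(2)] by (simp add: cmod_power2[symmetric] power_mult_distrib)
    define g where "g = (\<lambda>(P, u). Im (cnj P * u))"
    \<comment> \<open>Two triangles of side \<bar>u\<bar> with opposite senses differ in doubled
      area by \<open>sqrt 3\<close> times 12 r r; the factor \<open>Im w\<close>, of absolute value
      \<open>sqrt 3\<close> / 2, turns this into 18 r r.\<close>
    have "g e1 + g e2 + g e3 - (g f1 + g f2 + g f3) = 2 * ((Re u)\<^sup>2 + (Im u)\<^sup>2) * Im w"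
      unfolding g_def e k using turn_Re_Im(1)[OF w] by (simp add: power2_eq_square algebra_simps add_divide_distrib diff_divide_distrib)
    then have "(g e1 + g e2 + g e3 - (g f1 + g f2 + g f3)) * Im w = 24 * r\<^sup>2 * (Im w)\<^sup>2"
      unfolding n by (simp add: power2_eq_square)
    also have "\<dots> = 18 * r\<^sup>2" using turn_Re_Im(2)[OF w] by simp
    finally have "g f1 * Im w + g f2 * Im w + g f3 * Im w = g e1 * Im w + g e2 * Im w + g e3 * Im w - 18 * r\<^sup>2"
      by (simp add: algebra_simps)
    then show ?thesis unfolding area_def g_def[symmetric] es es'_def by (simp add: distrib_right)
  qed
  ultimately show thesis using that[of es'] by (simp add: tangle_operation_def es es'_def)
qed

lemma rotated:
  assumes "e \<in> set es"
  obtains es' where "oriented_tour p \<delta> r es' w" "hd es' = e" "mset es' = mset es" "tour_curve es' = tour_curve es"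
proof -
  obtain xs ys where es: "es = xs @ e # ys" using split_list[OF assms] by blast
  let ?es' = "(e # ys) @ xs"
  have T: "tour ?es'" "mset (cpath (?es' @ [hd ?es'])) = mset (cpath (es @ [hd es]))"
    using tour_rotate[of xs "e # ys"] tour unfolding es by blast+
  have "oriented_tour p \<delta> r ?es' w"
    by unfold_locales (use T w turns turns_mset[OF T(2)] in simp_all)
  moreover have "tour_corners ?es' = tour_corners es"
    unfolding tour_corners_def using mset_eq_setD[OF T(2)] .
  ultimately show thesis using that[of ?es'] by (simp add: tour_curve_def es)
qed

end

context hexgrid
begin

lemma tour_constructible:
  assumes "oriented_tour p \<delta> r es w"
  shows "constructible r vertices (tour_curve es)"
proof -
  \<comment> \<open>The added term is the bound of \<open>area_bound\<close>, so the quotient is not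
    negative for a tour; undoing a reflection lowers it by exactly 1.\<close>
  define f where "f = (\<lambda>es. nat \<lfloor>(area w es + 12 * r\<^sup>2 * (real (length es))\<^sup>2) / (18 * r\<^sup>2)\<rfloor>)"
  show ?thesis using assms
  proof (induction es rule: wf_induct_rule[OF wf_measures[of "[length, f]"]])
    case (1 es)
    then interpret A: oriented_tour p \<delta> r es w by blast
    have descend: "constructible r vertices (tour_curve es)"
      if "oriented_tour p \<delta> r es' w" "tangle_operation r vertices (tour_curve es') (tour_curve es)"
        "length es' < length es \<or> length es' = length es \<and> area w es' = area w es - 18 * r\<^sup>2" for es'
    proof -
      interpret B: oriented_tour p \<delta> r es' w by (rule that(1))
      have "(es', es) \<in> measures [length, f]"
      proof (cases "length es' < length es")
        case False
        then have l: "length es' = length es" and a: "area w es' = area w es - 18 * r\<^sup>2" using that(3) by auto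
        define c where "c = 12 * r\<^sup>2 * (real (length es))\<^sup>2"
        have "area w es' + c \<ge> 0" using area_bound[OF B.tour B.w] by (simp add: l c_def)
        then have "(area w es' + c) / (18 * r\<^sup>2) \<ge> 0" by simp
        moreover have "(area w es + c) / (18 * r\<^sup>2) = (area w es' + c) / (18 * r\<^sup>2) + 1"
          using r_pos by (simp add: a field_simps)
        ultimately have "f es' < f es" unfolding f_def l c_def[symmetric] by simp
        then show ?thesis using l by simp
      qed simp
      then have "constructible r vertices (tour_curve es')" using "1.IH" that(1) by blast
      then show ?thesis using that(2) A.tour by (rule constructible_step[OF _ _ tour_tangle(1)])
    qed
    have start: "(H - u, u) \<in> set es" if "(H, u, s) \<in> tour_corners es" for H u s
    proof -
      have "(H - u, u) \<in> (\<lambda>(H, u, s). (H - u, u)) ` set (cpath (es @ [hd es]))"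
        using that unfolding tour_corners_def by force
      then show ?thesis using arg_cong[OF tour_corner_start(1)[OF A.tour], of set] by simp
    qed
    show ?case
    proof (cases "\<forall>(H, u)\<in>A.left_turns. A.inner (H + u * w) \<or> A.inner (H - u)")
      case False
      then obtain H u where H: "(H, u) \<in> A.left_turns" "\<not> A.inner (H + u * w)" "\<not> A.inner (H - u)" by blast
      then have "(H - u, u) \<in> set es" using start[of H u w] by (simp add: A.left_turns_def)
      then obtain es' where es': "oriented_tour p \<delta> r es' w" "hd es' = (H - u, u)" "mset es' = mset es"
        "tour_curve es' = tour_curve es" by (rule A.rotated)
      interpret B: oriented_tour p \<delta> r es' w by (rule es'(1))
      have in': "B.inner = A.inner" unfolding A.inner_def[abs_def] B.inner_def[abs_def] es'(4) ..
      have "(H, u) \<in> B.left_turns"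
        using H(1) tour_tangle(3)[OF A.tour] A.corner_w(1)[of H u] B.corner_w(1)[of H u]
        unfolding A.left_turns_def B.left_turns_def in' by (auto simp: corners_def)
      then show ?thesis using B.constructible_circle[of H u] H es'(2) unfolding in' es'(4) by blast
    next
      case True
      then obtain H u where H: "H \<in> centers" "u \<in> dirs" "A.inner H" "\<not> A.inner (H + u * w * w)"
        "\<not> A.inner (H - u * w)"
        "\<not> A.inner (H + u) \<and> \<not> A.inner (H - u * w * w) \<or> A.inner (vertex H (u * w * w) (w * w))"
        by (rule A.removable_hexagon)
      have "(H, u, w * w) \<in> tour_corners es" using A.corners_at(3)[OF H(1,2)] H(3,4) by blast
      then have "(H - u, u) \<in> set es" by (rule start)
      then obtain es' where es': "oriented_tour p \<delta> r es' w" "hd es' = (H - u, u)" "mset es' = mset es"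
        "tour_curve es' = tour_curve es" by (rule A.rotated)
      interpret B: oriented_tour p \<delta> r es' w by (rule es'(1))
      have in': "B.inner = A.inner" unfolding A.inner_def[abs_def] B.inner_def[abs_def] es'(4) ..
      have len: "length es' = length es" and ar: "area w es' = area w es"
        using es'(3) mset_eq_length area_mset by blast+
      show ?thesis
      proof (cases "A.inner (vertex H (u * w * w) (w * w))")
        case True
        obtain es'' where "oriented_tour p \<delta> r es'' w" "tangle_operation r vertices (tour_curve es'') (tour_curve es')"
          "length es'' = length es'" "area w es'' = area w es' - 18 * r\<^sup>2"
          by (rule B.reflection_case[of H u]) (use H True es'(2) in \<open>simp_all add: in'\<close>)
        then show ?thesis using descend[of es''] unfolding es'(4) len ar by blast
      next
        case False
        then have "\<not> A.inner (H + u)" "\<not> A.inner (H - u * w * w)" using H(6) by auto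
        then obtain es'' where "oriented_tour p \<delta> r es'' w"
          "tangle_operation r vertices (tour_curve es'') (tour_curve es')" "length es'' < length es'"
          by (rule_tac B.shear_case[of H u]) (use H es'(2) in \<open>simp_all add: in'\<close>)
        then show ?thesis using descend[of es''] unfolding es'(4) len by blast
      qed
    qed
  qed
qed

end

theorem theorem4p2:
  fixes r :: real and p d :: complex and T :: "complex set"
  assumes "r > 0" and "norm d = 2 * r"
    and "hexagonal_tangle r (tiling_vertices p d) T"
  shows "constructible r (tiling_vertices p d) T"
proof -
  \<comment> \<open>The vector from \<open>p\<close> to the centre obtained from m = 1 and n = 0 in
    \<open>hexagon_centers\<close>.\<close>
  let ?\<delta> = "of_real (sqrt 3) * d * cis (pi / 6)"
  interpret hexgrid p ?\<delta> r
    by unfold_locales (use assms in \<open>simp_all add: norm_mult\<close>)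
  have V: "tiling_vertices p d = vertices" using hexgrid_axioms by (rule tiling_vertices_hexgrid)
  obtain es where es: "tour es" "tour_curve es = T" using tangle_tour assms(3) unfolding V by blast
  obtain w where "turn w" "turns w (cpath (es @ [hd es])) = 3"
    using tour_orientation_exists[OF es(1)] by blast
  then have "oriented_tour p ?\<delta> r es w" using es(1) by unfold_locales
  from tour_constructible[OF this] show ?thesis unfolding V es(2) .
qed

end
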